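(* Let $E$ and $F$ be vector bundles over a manifold $M$. There is a bornological $C^\infty(M)$-module isomorphism $$\Gamma_c(E)\otimes^\beta_{C^\infty(M)}\Gamma(F)\cong\Gamma_c(E\otimes F).$$
   Context: $\mathbb{K}$ is $\mathbb{R}$ or $\mathbb{C}$; functions and vector bundles are over $\mathbb{K}$. Manifolds are smooth, finite dimensional, second countable, Hausdorff; vector bundles have finite dimensional fibers. Boundedness in locally convex spaces is the usual (von Neumann) one; a bornological module isomorphism is a module isomorphism such that it and its inverse map bounded sets to bounded sets. For a vector bundle $E\to M$, the space $\Gamma(E)$ of smooth sections carries the usual Fréchet topology of uniform convergence of all derivatives of local representations (in charts and trivializations) on compact sets; for $L\subseteq M$ compact the space $\Gamma_{c,L}(E)$ of sections with support in $L$ carries the subspace topology, and the space $\Gamma_c(E)$ of compactly supported sections carries the strict inductive limit (LF) topology $\varinjlim\Gamma_{c,L}(E)$, with $L$ ranging over a compact exhaustion of $M$. $C^\infty(M)$ carries the Fréchet topology as sections of the trivial line bundle. For locally convex (Hausdorff) spaces $P,Q$, $P\otimes_\beta Q$ is the algebraic tensor product over $\mathbb{K}$ with the finest locally convex topology making $(x,y)\mapsto x\otimes y$ bounded. For bounded modules $P,Q$ over a commutative algebra $A$ (locally convex spaces with bounded algebra and module multiplications), $P\otimes_A^\beta Q:=(P\otimes_\beta Q)/J$ with the quotient topology, where $J$ is the closure of the subspace generated by all $pa\otimes q-p\otimes aq$ ($p\in P,q\in Q,a\in A$); it is an $A$-module via $a\cdot(p\otimes q)=(pa)\otimes q$. 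*)

theory Defs
  imports
    "HOL-Analysis.Analysis"
    "HOL-Library.Poly_Mapping"
    "HOL-Algebra.Algebraic_Closure_Type"
begin

section \<open>Scalars and modules\<close>

text \<open>
  A real normed field satisfying this axiom is isomorphic, as a normed field, to the reals or to
  the complex numbers: multiplicativity of the norm determines it.
\<close>

class real_or_complex = real_normed_field +
  assumes real_or_complex:
    "(\<forall>x. \<exists>a. x = a *\<^sub>R 1) \<or>
     (\<exists>i. i * i = - 1 \<and> (\<forall>x. \<exists>a b. x = a *\<^sub>R 1 + b *\<^sub>R i))"

instance real :: real_or_complex
  by standard simp

instance complex :: real_or_complex
proof
  have "\<exists>a b. x = a *\<^sub>R 1 + b *\<^sub>R \<i>" for x :: complex
    by (rule exI[of _ "Re x"], rule exI[of _ "Im x"]) (simp add: complex_eq_iff)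
  then show "(\<forall>x::complex. \<exists>a. x = a *\<^sub>R 1) \<or>
     (\<exists>i. i * i = - 1 \<and> (\<forall>x::complex. \<exists>a b. x = a *\<^sub>R 1 + b *\<^sub>R i))"
    by (intro disjI2 exI[of _ \<i>]) simp
qed

text \<open>
  Vector spaces over \<open>'k\<close> are modules over \<^const>\<open>ring_of_type_algebra\<close> in the sense of
  \<^locale>\<open>Module.module\<close>. The fields \<^const>\<open>monoid.mult\<close> and \<^const>\<open>monoid.one\<close> of the module record
  play no role for modules.
\<close>

definition mk_module ::
  "'v set \<Rightarrow> 'v \<Rightarrow> ('v \<Rightarrow> 'v \<Rightarrow> 'v) \<Rightarrow> ('k \<Rightarrow> 'v \<Rightarrow> 'v) \<Rightarrow> ('k, 'v) module"
  where "mk_module C z pl sm =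
    \<lparr>carrier = C, monoid.mult = undefined, one = undefined, zero = z, add = pl, smult = sm\<rparr>"

abbreviation vector_space_over_type :: "('k::field, 'v, 'z) module_scheme \<Rightarrow> bool"
  where "vector_space_over_type V \<equiv> Module.module (ring_of_type_algebra :: 'k ring) V"

definition lin_span :: "('k::field, 'v, 'z) module_scheme \<Rightarrow> 'v set \<Rightarrow> 'v set"
  where "lin_span V S = (\<lambda>H. submodule H (ring_of_type_algebra :: 'k ring) V) hull S"

definition linear_iso ::
  "('k, 'v, 'y) module_scheme \<Rightarrow> ('k, 'w, 'z) module_scheme \<Rightarrow> ('v \<Rightarrow> 'w) set"
  where "linear_iso V W =
    {f. bij_betw f (carrier V) (carrier W) \<and>
        (\<forall>x\<in>carrier V. \<forall>y\<in>carrier V. f (x \<oplus>\<^bsub>V\<^esub> y) = f x \<oplus>\<^bsub>W\<^esub> f y) \<and>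
        (\<forall>c. \<forall>x\<in>carrier V. f (c \<odot>\<^bsub>V\<^esub> x) = c \<odot>\<^bsub>W\<^esub> f x)}"

text \<open>The space of \<open>r\<close>-tuples of scalars, as sequences vanishing from \<open>r\<close> on.\<close>

definition tuples :: "nat \<Rightarrow> ('k::field, nat \<Rightarrow> 'k) module"
  where "tuples r = mk_module {v. \<forall>i\<ge>r. v i = 0} (\<lambda>_. 0) (\<lambda>v w i. v i + w i) (\<lambda>c v i. c * v i)"

definition unit_tuple :: "nat \<Rightarrow> nat \<Rightarrow> 'k::field"
  where "unit_tuple j = (\<lambda>i. if i = j then 1 else 0)"


subsection \<open>Quotients\<close>

text \<open>
  The operator on cosets induced by an operator \<open>f\<close> that maps the subspace \<open>J\<close> to itself:
  it sends \<open>J + x\<close> to \<open>J + f x\<close>.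
\<close>

definition quot_op :: "('k, 'v, 'z) module_scheme \<Rightarrow> 'v set \<Rightarrow> ('v \<Rightarrow> 'v) \<Rightarrow> 'v set \<Rightarrow> 'v set"
  where "quot_op V J f Y = J <+>\<^bsub>V\<^esub> f ` Y"

definition quot_module :: "('k, 'v, 'z) module_scheme \<Rightarrow> 'v set \<Rightarrow> ('k, 'v set) module"
  where "quot_module V J =
    mk_module (a_rcosets\<^bsub>V\<^esub> J) J (set_add V) (\<lambda>c. quot_op V J (smult V c))"

definition quot_topology ::
  "('k, 'v, 'z) module_scheme \<Rightarrow> 'v set \<Rightarrow> 'v topology \<Rightarrow> 'v set topology"
  where "quot_topology V J T =
    topology (\<lambda>W. W \<subseteq> a_rcosets\<^bsub>V\<^esub> J \<and> openin T {x \<in> topspace T. J +>\<^bsub>V\<^esub> x \<in> W})"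

lemma openin_quot_topology:
  "openin (quot_topology V J T) W \<longleftrightarrow>
    W \<subseteq> a_rcosets\<^bsub>V\<^esub> J \<and> openin T {x \<in> topspace T. J +>\<^bsub>V\<^esub> x \<in> W}"
proof -
  let ?P = "\<lambda>W. W \<subseteq> a_rcosets\<^bsub>V\<^esub> J \<and> openin T {x \<in> topspace T. J +>\<^bsub>V\<^esub> x \<in> W}"
  have "?P (S \<inter> S')" if "?P S" "?P S'" for S S'
  proof -
    have "{x \<in> topspace T. J +>\<^bsub>V\<^esub> x \<in> S \<inter> S'} =
        {x \<in> topspace T. J +>\<^bsub>V\<^esub> x \<in> S} \<inter> {x \<in> topspace T. J +>\<^bsub>V\<^esub> x \<in> S'}"
      by auto
    then show ?thesis using that by (auto intro: openin_Int)
  qed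
  moreover have "?P (\<Union>\<K>)" if "\<forall>S\<in>\<K>. ?P S" for \<K>
  proof -
    have "{x \<in> topspace T. J +>\<^bsub>V\<^esub> x \<in> \<Union>\<K>} = (\<Union>S\<in>\<K>. {x \<in> topspace T. J +>\<^bsub>V\<^esub> x \<in> S})"
      by auto
    then show ?thesis using that by auto
  qed
  ultimately have "istopology ?P"
    unfolding istopology_def by blast
  then show ?thesis
    unfolding quot_topology_def by (simp add: topology_inverse')
qed


subsection \<open>Algebraic tensor products of vector spaces\<close>

definition free_module :: "'x set \<Rightarrow> ('k::field, 'x \<Rightarrow>\<^sub>0 'k) module"
  where "free_module S = mk_module {u. Poly_Mapping.keys u \<subseteq> S} 0 (+) (\<lambda>c. Poly_Mapping.map ((*) c))"

definition tensor_relators ::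
  "('k::field, 'v, 'y) module_scheme \<Rightarrow> ('k, 'w, 'z) module_scheme \<Rightarrow> (('v \<times> 'w) \<Rightarrow>\<^sub>0 'k) set"
  where "tensor_relators P Q =
    {Poly_Mapping.single (p \<oplus>\<^bsub>P\<^esub> p', q) 1 - Poly_Mapping.single (p, q) 1 - Poly_Mapping.single (p', q) 1
      | p p' q. p \<in> carrier P \<and> p' \<in> carrier P \<and> q \<in> carrier Q} \<union>
    {Poly_Mapping.single (p, q \<oplus>\<^bsub>Q\<^esub> q') 1 - Poly_Mapping.single (p, q) 1 - Poly_Mapping.single (p, q') 1
      | p q q'. p \<in> carrier P \<and> q \<in> carrier Q \<and> q' \<in> carrier Q} \<union>
    {Poly_Mapping.single (c \<odot>\<^bsub>P\<^esub> p, q) 1 - Poly_Mapping.single (p, q) c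
      | c p q. p \<in> carrier P \<and> q \<in> carrier Q} \<union>
    {Poly_Mapping.single (p, c \<odot>\<^bsub>Q\<^esub> q) 1 - Poly_Mapping.single (p, q) c
      | c p q. p \<in> carrier P \<and> q \<in> carrier Q}"

definition tensor_ker ::
  "('k::field, 'v, 'y) module_scheme \<Rightarrow> ('k, 'w, 'z) module_scheme \<Rightarrow> (('v \<times> 'w) \<Rightarrow>\<^sub>0 'k) set"
  where "tensor_ker P Q = lin_span (free_module (carrier P \<times> carrier Q)) (tensor_relators P Q)"

definition tensor_module ::
  "('k::field, 'v, 'y) module_scheme \<Rightarrow> ('k, 'w, 'z) module_scheme
    \<Rightarrow> ('k, (('v \<times> 'w) \<Rightarrow>\<^sub>0 'k) set) module"
  where "tensor_module P Q = quot_module (free_module (carrier P \<times> carrier Q)) (tensor_ker P Q)"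

definition pure_tensor ::
  "('k::field, 'v, 'y) module_scheme \<Rightarrow> ('k, 'w, 'z) module_scheme
    \<Rightarrow> 'v \<Rightarrow> 'w \<Rightarrow> (('v \<times> 'w) \<Rightarrow>\<^sub>0 'k) set"
  where "pure_tensor P Q p q =
    tensor_ker P Q +>\<^bsub>free_module (carrier P \<times> carrier Q)\<^esub> Poly_Mapping.single (p, q) 1"

text \<open>For linear \<open>f\<close>, the operator \<open>f \<otimes> id\<close>, sending \<open>p \<otimes> q\<close> to \<open>f p \<otimes> q\<close>.\<close>

definition tensor_op ::
  "('k::field, 'v, 'y) module_scheme \<Rightarrow> ('k, 'w, 'z) module_scheme \<Rightarrow> ('v \<Rightarrow> 'v)
    \<Rightarrow> (('v \<times> 'w) \<Rightarrow>\<^sub>0 'k) set \<Rightarrow> (('v \<times> 'w) \<Rightarrow>\<^sub>0 'k) set"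
  where "tensor_op P Q f =
    quot_op (free_module (carrier P \<times> carrier Q)) (tensor_ker P Q)
      (\<lambda>u. \<Sum>(p, q)\<in>Poly_Mapping.keys u. Poly_Mapping.single (f p, q) (Poly_Mapping.lookup u (p, q)))"


section \<open>Locally convex spaces\<close>

definition locally_convex_topology ::
  "('k::real_or_complex, 'v, 'z) module_scheme \<Rightarrow> 'v topology \<Rightarrow> bool"
  where "locally_convex_topology V T \<longleftrightarrow>
    topspace T = carrier V \<and>
    continuous_map (prod_topology T T) T (\<lambda>(x, y). x \<oplus>\<^bsub>V\<^esub> y) \<and>
    continuous_map (prod_topology (euclidean :: 'k topology) T) T (\<lambda>(c, x). c \<odot>\<^bsub>V\<^esub> x) \<and>
    (\<forall>U. openin T U \<and> \<zero>\<^bsub>V\<^esub> \<in> U \<longrightarrow>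
      (\<exists>W\<subseteq>U. openin T W \<and> \<zero>\<^bsub>V\<^esub> \<in> W \<and>
        (\<forall>x\<in>W. \<forall>y\<in>W. \<forall>t\<in>{0..1}. (of_real t \<odot>\<^bsub>V\<^esub> x) \<oplus>\<^bsub>V\<^esub> (of_real (1 - t) \<odot>\<^bsub>V\<^esub> y) \<in> W)))"

text \<open>
  The supremum of all locally convex topologies with the property \<open>P\<close>. It is itself locally convex;
  for the two properties used below (boundedness of a bilinear map into the space, continuity of
  linear maps into the space) it has the property again, hence is the finest such topology.
\<close>

definition finest_locally_convex ::
  "('k::real_or_complex, 'v, 'z) module_scheme \<Rightarrow> ('v topology \<Rightarrow> bool) \<Rightarrow> 'v topology"
  where "finest_locally_convex V P =
    topology_generated_by {U. \<exists>T. locally_convex_topology V T \<and> P T \<and> openin T U}"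

definition von_neumann_bounded ::
  "('k::real_or_complex, 'v, 'z) module_scheme \<Rightarrow> 'v topology \<Rightarrow> 'v set \<Rightarrow> bool"
  where "von_neumann_bounded V T B \<longleftrightarrow>
    B \<subseteq> carrier V \<and>
    (\<forall>U. openin T U \<and> \<zero>\<^bsub>V\<^esub> \<in> U \<longrightarrow> (\<exists>r>0. \<forall>c. norm c \<ge> r \<longrightarrow> B \<subseteq> smult V c ` U))"

text \<open>
  Locally convex spaces with an action of an algebra whose elements have type \<open>'a\<close>. Scalar
  multiplication and the action are separate components: the topology, boundedness and the tensor
  product over \<open>'k\<close> refer to the former.
\<close>

record ('a, 'k, 'v) lc_module = "('k, 'v) module" +
  topol :: "'v topology"
  act :: "'a \<Rightarrow> 'v \<Rightarrow> 'v"

definition mk_lc_module ::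
  "('k, 'v) module \<Rightarrow> 'v topology \<Rightarrow> ('a \<Rightarrow> 'v \<Rightarrow> 'v) \<Rightarrow> ('a, 'k, 'v) lc_module"
  where "mk_lc_module V T ac = module.extend V (lc_module.fields T ac)"

abbreviation bounded_in :: "('a, 'k::real_or_complex, 'v) lc_module \<Rightarrow> 'v set \<Rightarrow> bool"
  where "bounded_in P \<equiv> von_neumann_bounded P (topol P)"

definition beta_topology ::
  "('a, 'k::real_or_complex, 'v) lc_module \<Rightarrow> ('a, 'k, 'w) lc_module
    \<Rightarrow> (('v \<times> 'w) \<Rightarrow>\<^sub>0 'k) set topology"
  where "beta_topology P Q = finest_locally_convex (tensor_module P Q)
    (\<lambda>T. \<forall>B C. bounded_in P B \<and> bounded_in Q C \<longrightarrow>
      von_neumann_bounded (tensor_module P Q) T {pure_tensor P Q x y | x y. x \<in> B \<and> y \<in> C})"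

definition balanced_ker ::
  "('a, 'b) ring_scheme \<Rightarrow> ('a, 'k::real_or_complex, 'v) lc_module \<Rightarrow> ('a, 'k, 'w) lc_module
    \<Rightarrow> (('v \<times> 'w) \<Rightarrow>\<^sub>0 'k) set set"
  where "balanced_ker A P Q =
    beta_topology P Q closure_of lin_span (tensor_module P Q)
      {pure_tensor P Q (act P a p) q \<ominus>\<^bsub>tensor_module P Q\<^esub> pure_tensor P Q p (act Q a q)
        | a p q. a \<in> carrier A \<and> p \<in> carrier P \<and> q \<in> carrier Q}"

text \<open>The bornological tensor product of \<open>P\<close> and \<open>Q\<close> over \<open>A\<close>.\<close>

definition bornological_tensor ::
  "('a, 'b) ring_scheme \<Rightarrow> ('a, 'k::real_or_complex, 'v) lc_module \<Rightarrow> ('a, 'k, 'w) lc_module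
    \<Rightarrow> ('a, 'k, (('v \<times> 'w) \<Rightarrow>\<^sub>0 'k) set set) lc_module"
  where "bornological_tensor A P Q = mk_lc_module
    (quot_module (tensor_module P Q) (balanced_ker A P Q))
    (quot_topology (tensor_module P Q) (balanced_ker A P Q) (beta_topology P Q))
    (\<lambda>a. quot_op (tensor_module P Q) (balanced_ker A P Q) (tensor_op P Q (act P a)))"

definition bornological_module_iso ::
  "('a, 'b) ring_scheme \<Rightarrow> ('a, 'k::real_or_complex, 'v) lc_module \<Rightarrow> ('a, 'k, 'w) lc_module
    \<Rightarrow> ('v \<Rightarrow> 'w) set"
  where "bornological_module_iso A P Q =
    {f \<in> linear_iso P Q.
        (\<forall>a\<in>carrier A. \<forall>x\<in>carrier P. f (act P a x) = act Q a (f x)) \<and>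
        (\<forall>B. bounded_in P B \<longrightarrow> bounded_in Q (f ` B)) \<and>
        (\<forall>B. bounded_in Q B \<longrightarrow> bounded_in P (inv_into (carrier P) f ` B))}"


section \<open>Smooth manifolds\<close>

text \<open>Iterated directional derivatives; the first entry of the list is differentiated along first.\<close>

primrec iter_deriv ::
  "'e list \<Rightarrow> ('e::real_normed_vector \<Rightarrow> 'f::real_normed_vector) \<Rightarrow> 'e \<Rightarrow> 'f"
  where
    "iter_deriv [] f = f"
  | "iter_deriv (v # vs) f = iter_deriv vs (\<lambda>x. frechet_derivative f (at x) v)"

text \<open>
  Used for open \<open>U\<close> in a finite-dimensional space only, where it is the usual notion: all iterated
  directional derivatives exist and are (totally) differentiable, in particular continuous.
\<close>

definition smooth_on :: "'e set \<Rightarrow> ('e::real_normed_vector \<Rightarrow> 'f::real_normed_vector) \<Rightarrow> bool"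
  where "smooth_on U f \<longleftrightarrow> (\<forall>vs. \<forall>x\<in>U. iter_deriv vs f differentiable (at x))"

record ('m, 'e) manifold =
  mtop :: "'m topology"
  atlas :: "('m set \<times> ('m \<Rightarrow> 'e)) set"

abbreviation points :: "('m, 'e) manifold \<Rightarrow> 'm set"
  where "points M \<equiv> topspace (mtop M)"

text \<open>
  The model space is a finite-dimensional inner product space rather than a
  \<^class>\<open>euclidean_space\<close>, since the latter class excludes dimension 0. The atlas need not be maximal.
\<close>

definition smooth_manifold :: "('m, 'e::real_inner) manifold \<Rightarrow> bool"
  where "smooth_manifold M \<longleftrightarrow>
    (\<exists>B::'e set. finite B \<and> span B = UNIV) \<and>
    Hausdorff_space (mtop M) \<and> second_countable (mtop M) \<and>
    (\<forall>(U, c)\<in>atlas M. openin (mtop M) U \<and> open (c ` U) \<and>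
      homeomorphic_map (subtopology (mtop M) U) (top_of_set (c ` U)) c) \<and>
    (\<Union>(U, c)\<in>atlas M. U) = points M \<and>
    (\<forall>(U, c)\<in>atlas M. \<forall>(V, d)\<in>atlas M. smooth_on (c ` (U \<inter> V)) (d \<circ> inv_into U c))"

definition compact_exhaustion :: "'m topology \<Rightarrow> (nat \<Rightarrow> 'm set) \<Rightarrow> bool"
  where "compact_exhaustion S L \<longleftrightarrow>
    (\<forall>n. compactin S (L n) \<and> L n \<subseteq> S interior_of L (Suc n)) \<and> (\<Union>n. L n) = topspace S"

text \<open>Smoothness of a function on an open subset \<open>W\<close> of \<open>M\<close>.\<close>

definition smooth_fun_on ::
  "('m, 'e::real_inner) manifold \<Rightarrow> 'm set \<Rightarrow> ('m \<Rightarrow> 'f::real_normed_vector) \<Rightarrow> bool"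
  where "smooth_fun_on M W f \<longleftrightarrow> (\<forall>(U, c)\<in>atlas M. smooth_on (c ` (U \<inter> W)) (f \<circ> inv_into U c))"

text \<open>Functions and sections on \<open>M\<close> are normalised to \<^term>\<open>undefined\<close> outside \<open>M\<close>.\<close>

definition smooth_functions :: "('m, 'e::real_inner) manifold \<Rightarrow> ('m \<Rightarrow> 'k::real_or_complex) ring"
  where "smooth_functions M =
    \<lparr>carrier = {f \<in> extensional (points M). smooth_fun_on M (points M) f},
     monoid.mult = (\<lambda>f g. \<lambda>x\<in>points M. f x * g x),
     one = (\<lambda>x\<in>points M. 1),
     zero = (\<lambda>x\<in>points M. 0),
     add = (\<lambda>f g. \<lambda>x\<in>points M. f x + g x)\<rparr>"


section \<open>Vector bundles and their sections\<close>

text \<open>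
  A vector bundle is given by its fibers and an atlas of local trivializations \<open>(U, r, \<phi>)\<close>, where
  \<open>\<phi> x\<close> maps the fiber over \<open>x \<in> U\<close> isomorphically to the \<open>r\<close>-tuples of scalars, with smooth
  transition matrices. The rank may vary between connected components.
\<close>

record ('k, 'm, 'v) vec_bundle =
  fiber :: "'m \<Rightarrow> ('k, 'v) module"
  trivs :: "('m set \<times> nat \<times> ('m \<Rightarrow> 'v \<Rightarrow> nat \<Rightarrow> 'k)) set"

definition vector_bundle ::
  "('m, 'e::real_inner) manifold \<Rightarrow> ('k::real_or_complex, 'm, 'v) vec_bundle \<Rightarrow> bool"
  where "vector_bundle M E \<longleftrightarrow>
    (\<forall>x\<in>points M. vector_space_over_type (fiber E x)) \<and>
    (\<forall>(U, r, \<phi>)\<in>trivs E. openin (mtop M) U \<and> (\<forall>x\<in>U. \<phi> x \<in> linear_iso (fiber E x) (tuples r))) \<and>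
    (\<Union>(U, r, \<phi>)\<in>trivs E. U) = points M \<and>
    (\<forall>(U, r, \<phi>)\<in>trivs E. \<forall>(V, s, \<psi>)\<in>trivs E. \<forall>j<r. \<forall>i<s.
      smooth_fun_on M (U \<inter> V)
        (\<lambda>x. \<psi> x (inv_into (carrier (fiber E x)) (\<phi> x) (unit_tuple j)) i))"

definition sections ::
  "('m, 'e::real_inner) manifold \<Rightarrow> ('k::real_or_complex, 'm, 'v) vec_bundle \<Rightarrow> ('m \<Rightarrow> 'v) set"
  where "sections M E =
    {s \<in> (\<Pi>\<^sub>E x\<in>points M. carrier (fiber E x)).
      \<forall>(U, r, \<phi>)\<in>trivs E. \<forall>i<r. smooth_fun_on M U (\<lambda>x. \<phi> x (s x) i)}"

definition supp ::
  "('m, 'e) manifold \<Rightarrow> ('k, 'm, 'v) vec_bundle \<Rightarrow> ('m \<Rightarrow> 'v) \<Rightarrow> 'm set"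
  where "supp M E s = mtop M closure_of {x \<in> points M. s x \<noteq> \<zero>\<^bsub>fiber E x\<^esub>}"

definition sections_supported_in ::
  "('m, 'e::real_inner) manifold \<Rightarrow> ('k::real_or_complex, 'm, 'v) vec_bundle \<Rightarrow> 'm set
    \<Rightarrow> ('m \<Rightarrow> 'v) set"
  where "sections_supported_in M E L = {s \<in> sections M E. supp M E s \<subseteq> L}"

definition compact_sections ::
  "('m, 'e::real_inner) manifold \<Rightarrow> ('k::real_or_complex, 'm, 'v) vec_bundle \<Rightarrow> ('m \<Rightarrow> 'v) set"
  where "compact_sections M E = {s \<in> sections M E. compactin (mtop M) (supp M E s)}"

text \<open>The vector space structure on a set \<open>S\<close> of sections.\<close>

definition section_module ::
  "('m, 'e) manifold \<Rightarrow> ('k, 'm, 'v) vec_bundle \<Rightarrow> ('m \<Rightarrow> 'v) set \<Rightarrow> ('k, 'm \<Rightarrow> 'v) module"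
  where "section_module M E S = mk_module S
    (\<lambda>x\<in>points M. \<zero>\<^bsub>fiber E x\<^esub>)
    (\<lambda>s t. \<lambda>x\<in>points M. s x \<oplus>\<^bsub>fiber E x\<^esub> t x)
    (\<lambda>c s. \<lambda>x\<in>points M. c \<odot>\<^bsub>fiber E x\<^esub> s x)"

definition section_act ::
  "('m, 'e) manifold \<Rightarrow> ('k, 'm, 'v) vec_bundle \<Rightarrow> ('m \<Rightarrow> 'k) \<Rightarrow> ('m \<Rightarrow> 'v) \<Rightarrow> ('m \<Rightarrow> 'v)"
  where "section_act M E a s = (\<lambda>x\<in>points M. a x \<odot>\<^bsub>fiber E x\<^esub> s x)"

text \<open>The \<open>i\<close>-th component of the local representation of a section.\<close>

definition local_rep ::
  "'m set \<Rightarrow> ('m \<Rightarrow> 'e) \<Rightarrow> ('m \<Rightarrow> 'v \<Rightarrow> nat \<Rightarrow> 'k) \<Rightarrow> nat \<Rightarrow> ('m \<Rightarrow> 'v) \<Rightarrow> 'e \<Rightarrow> 'k"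
  where "local_rep U c \<phi> i s = (\<lambda>x. \<phi> x (s x) i) \<circ> inv_into U c"

text \<open>
  The topology of uniform convergence on compact sets of all derivatives of local representations.
  On the compact set \<open>c ` C\<close> the pointwise strict bound amounts to one on the supremum. The set of
  all sections is inserted because there are no charts if \<open>M\<close> is empty.
\<close>

definition section_topology ::
  "('m, 'e::real_inner) manifold \<Rightarrow> ('k::real_or_complex, 'm, 'v) vec_bundle
    \<Rightarrow> ('m \<Rightarrow> 'v) topology"
  where "section_topology M E = topology_generated_by (insert (sections M E)
    {{t \<in> sections M E. \<forall>y\<in>c ` C.
        norm (iter_deriv vs (\<lambda>z. local_rep U c \<phi> i t z - local_rep U c \<phi> i s z) y) < \<epsilon>}
      | U c V r \<phi> i C vs s \<epsilon>. (U, c) \<in> atlas M \<and> (V, r, \<phi>) \<in> trivs E \<and> i < r \<and>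
          compactin (mtop M) C \<and> C \<subseteq> U \<inter> V \<and> s \<in> sections M E \<and> \<epsilon> > 0})"

definition smooth_sections ::
  "('m, 'e::real_inner) manifold \<Rightarrow> ('k::real_or_complex, 'm, 'v) vec_bundle
    \<Rightarrow> ('m \<Rightarrow> 'k, 'k, 'm \<Rightarrow> 'v) lc_module"
  where "smooth_sections M E = mk_lc_module
    (section_module M E (sections M E)) (section_topology M E) (section_act M E)"

text \<open>
  The inductive limit topology is the finest locally convex one for which the inclusions of the
  steps are continuous.
\<close>

definition lf_topology ::
  "('m, 'e::real_inner) manifold \<Rightarrow> (nat \<Rightarrow> 'm set) \<Rightarrow> ('k::real_or_complex, 'm, 'v) vec_bundle
    \<Rightarrow> ('m \<Rightarrow> 'v) topology"
  where "lf_topology M L E =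
    finest_locally_convex (section_module M E (compact_sections M E))
      (\<lambda>T. \<forall>n. continuous_map
        (subtopology (section_topology M E) (sections_supported_in M E (L n))) T (\<lambda>s. s))"

definition smooth_compact_sections ::
  "('m, 'e::real_inner) manifold \<Rightarrow> (nat \<Rightarrow> 'm set) \<Rightarrow> ('k::real_or_complex, 'm, 'v) vec_bundle
    \<Rightarrow> ('m \<Rightarrow> 'k, 'k, 'm \<Rightarrow> 'v) lc_module"
  where "smooth_compact_sections M L E = mk_lc_module
    (section_module M E (compact_sections M E)) (lf_topology M L E) (section_act M E)"


subsection \<open>Tensor product of vector bundles\<close>

text \<open>
  The isomorphism of a tensor product of fibers to the \<open>r * s\<close>-tuples induced by trivializations
  \<open>f\<close>, \<open>g\<close> of ranks \<open>r\<close>, \<open>s\<close>; the pair of indices \<open>(i, j)\<close> is encoded as \<open>i * s + j\<close>.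
  The linear extension of \<open>f \<otimes> g\<close> to formal sums is constant on each coset \<open>Y\<close>.
\<close>

definition tensor_triv ::
  "nat \<Rightarrow> ('v \<Rightarrow> nat \<Rightarrow> 'k::field) \<Rightarrow> ('w \<Rightarrow> nat \<Rightarrow> 'k) \<Rightarrow> (('v \<times> 'w) \<Rightarrow>\<^sub>0 'k) set \<Rightarrow> nat \<Rightarrow> 'k"
  where "tensor_triv s f g Y = the_elem
    ((\<lambda>u k. \<Sum>(v, w)\<in>Poly_Mapping.keys u.
        Poly_Mapping.lookup u (v, w) * f v (k div s) * g w (k mod s)) ` Y)"

definition tensor_bundle ::
  "('k::real_or_complex, 'm, 'v) vec_bundle \<Rightarrow> ('k, 'm, 'w) vec_bundle
    \<Rightarrow> ('k, 'm, (('v \<times> 'w) \<Rightarrow>\<^sub>0 'k) set) vec_bundle"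
  where "tensor_bundle E F =
    \<lparr>fiber = (\<lambda>x. tensor_module (fiber E x) (fiber F x)),
     trivs = {(U \<inter> V, r * s, \<lambda>x. tensor_triv s (\<phi> x) (\<psi> x))
       | U r \<phi> V s \<psi>. (U, r, \<phi>) \<in> trivs E \<and> (V, s, \<psi>) \<in> trivs F}\<rparr>"

end

theory Submission
  imports Defs
begin

text \<open>
  Pointwise multiplication of sections is bilinear and bounded, and it identifies
  \<open>p a \<otimes> q\<close> with \<open>p \<otimes> a q\<close>, so it induces a linear map \<open>\<Phi>\<close> from the tensor product over \<open>C\<^sup>\<infinity>(M)\<close> to
  \<open>\<Gamma>\<^sub>c(E \<otimes> F)\<close>. For a compact set \<open>L\<close> choose cut-off functions \<open>a\<^sub>k\<close>, \<open>b\<^sub>k\<close>, supported in domains of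
  trivializations of \<open>F\<close>, with \<open>\<Sum> a\<^sub>k b\<^sub>k = 1\<close> on \<open>L\<close>. If \<open>e\<^sub>k\<^sub>j\<close> are the local frames with
  dual frames \<open>e'\<^sub>k\<^sub>j\<close>, then \<open>R u = \<Sum> a\<^sub>k (id \<otimes> e'\<^sub>k\<^sub>j) u \<otimes> b\<^sub>k e\<^sub>k\<^sub>j\<close> is bounded on sections \<open>u\<close> supported
  in \<open>L\<close>, satisfies \<open>\<Phi> (R u) = u\<close>, and \<open>R (s t) - s \<otimes> t\<close> lies in the span of the balancing relators
  (before taking closures). Hence the kernel of \<open>\<Phi>\<close> on the algebraic tensor product is this span; it is
  closed because \<open>\<Phi>\<close> is continuous. The inverse of \<open>\<Phi>\<close> is bounded because a bounded subset of the
  inductive limit lies in a step, where the inverse is given by a single \<open>R\<close>.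
\<close>

section \<open>Calculus of smooth functions\<close>

text \<open>Two features shape the argument. The cover by trivializations of \<open>F\<close> may be
  infinite, so a finite formula for an inverse exists only over a compact set; the maps
  \<open>R\<close> for different compact sets agree only modulo the relators. Moreover, the tensor
  topology and the inductive limit topology are suprema of families of locally convex topologies, so
  boundedness is tested in one member at a time (\<open>bounded_finest_iff\<close>), and the suprema
  themselves are never shown to be locally convex. The cut-offs come in pairs because two local
  objects must be extended by zero: one factor globalizes the contraction with the dual frame, the
  other globalizes the frame. On a product of s and t the contraction is s times a smooth function
  depending on t. This function crosses the tensor sign, and summing over the frame rebuilds t, up
  to the factor given by the sum of the products of cut-offs. That factor is 1 only on the chosen
  compact set and may change t elsewhere; it is therefore moved back to s, which vanishes off that
  set. This is where compact support of the left factor enters.\<close>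

lemma frechet_derivative_cong_open:
  assumes "open U" "x \<in> U" "\<And>y. y \<in> U \<Longrightarrow> f y = g y"
  shows "frechet_derivative f (at x) = frechet_derivative g (at x)"
proof -
  have "(f has_derivative D) (at x) \<longleftrightarrow> (g has_derivative D) (at x)" for D
    using assms by (metis has_derivative_transform_within_open)
  then show ?thesis
    unfolding frechet_derivative_def by simp
qed

lemma iter_deriv_cong_open:
  assumes "open U" "x \<in> U" "\<And>y. y \<in> U \<Longrightarrow> f y = g y"
  shows "iter_deriv vs f x = iter_deriv vs g x"
  using assms(2,3)
proof (induction vs arbitrary: f g x)
  case (Cons v vs)
  have "frechet_derivative f (at y) v = frechet_derivative g (at y) v" if "y \<in> U" for y
    using frechet_derivative_cong_open[OF assms(1) that, of f g] Cons.prems(2) by simp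
  then show ?case
    unfolding iter_deriv.simps by (rule Cons.IH[OF Cons.prems(1)])
qed simp

lemma differentiable_cong_open:
  assumes "open U" "x \<in> U" "\<And>y. y \<in> U \<Longrightarrow> f y = g y" "f differentiable (at x)"
  shows "g differentiable (at x)"
  using assms unfolding differentiable_def by (metis has_derivative_transform_within_open)

lemma smooth_on_cong_open:
  assumes "open U" "\<And>y. y \<in> U \<Longrightarrow> f y = g y" "smooth_on U f"
  shows "smooth_on U g"
proof -
  have "iter_deriv vs f y = iter_deriv vs g y" if "y \<in> U" for vs y
    using iter_deriv_cong_open[OF assms(1) that] assms(2) by blast
  then show ?thesis
    using assms(3) differentiable_cong_open[OF assms(1)] unfolding smooth_on_def by blast
qed

lemma smooth_on_subset: "smooth_on U f \<Longrightarrow> V \<subseteq> U \<Longrightarrow> smooth_on V f"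
  unfolding smooth_on_def by blast

lemma smooth_on_local:
  assumes "\<And>x. x \<in> U \<Longrightarrow> \<exists>W g. open W \<and> x \<in> W \<and> smooth_on W g \<and> (\<forall>y\<in>W. f y = g y)"
  shows "smooth_on U f"
  unfolding smooth_on_def
proof (intro allI ballI)
  fix vs x assume "x \<in> U"
  then obtain W g where "open W" "x \<in> W" "smooth_on W g" "\<forall>y\<in>W. f y = g y"
    using assms by blast
  then have "smooth_on W f"
    using smooth_on_cong_open[of W g f] by simp
  then show "iter_deriv vs f differentiable (at x)"
    using \<open>x \<in> W\<close> unfolding smooth_on_def by blast
qed

lemma smooth_on_differentiable: "smooth_on U f \<Longrightarrow> x \<in> U \<Longrightarrow> f differentiable (at x)"
  unfolding smooth_on_def by (metis iter_deriv.simps(1))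

lemma smooth_on_deriv: "smooth_on U f \<Longrightarrow> smooth_on U (\<lambda>x. frechet_derivative f (at x) v)"
  unfolding smooth_on_def by (metis iter_deriv.simps(2))

text \<open>Smoothness speaks of all lists of directions, so induction on the list proves it for any
  class of differentiable functions closed under directional derivatives. Closure up to equality on
  \<open>U\<close> is enough, because iterated derivatives at points of an open set depend only on
  the values there.\<close>

lemma smooth_on_coinduct:
  assumes "open U" "P f"
    and step: "\<And>f. P f \<Longrightarrow> (\<forall>x\<in>U. f differentiable (at x)) \<and>
      (\<forall>v. \<exists>g. P g \<and> (\<forall>x\<in>U. frechet_derivative f (at x) v = g x))"
  shows "smooth_on U f"
proof -
  have "\<forall>x\<in>U. iter_deriv vs f differentiable (at x)" if "P f" for vs f
    using that
  proof (induction vs arbitrary: f)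
    case (Cons v vs)
    then obtain g where g: "P g" "\<forall>x\<in>U. frechet_derivative f (at x) v = g x"
      using step by blast
    have eq: "iter_deriv vs g y = iter_deriv vs (\<lambda>x. frechet_derivative f (at x) v) y" if "y \<in> U" for y
      by (rule iter_deriv_cong_open[OF assms(1) that]) (simp add: g(2))
    show ?case
      unfolding iter_deriv.simps
      using differentiable_cong_open[OF assms(1), of _ "iter_deriv vs g" "iter_deriv vs (\<lambda>x. frechet_derivative f (at x) v)"] eq Cons.IH[OF g(1)] by blast
  qed (use step in auto)
  then show ?thesis
    using assms(2) unfolding smooth_on_def by blast
qed

lemma frechet_derivative_eqI:
  "(f has_derivative f') (at x) \<Longrightarrow> frechet_derivative f (at x) v = f' v"
  using frechet_derivative_at by metis

lemma derivative_stepI: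
  assumes "\<And>x. x \<in> U \<Longrightarrow> (h has_derivative (\<lambda>v. h' v x)) (at x)" "\<And>v. P (h' v)"
  shows "(\<forall>x\<in>U. h differentiable (at x)) \<and>
    (\<forall>v. \<exists>k. P k \<and> (\<forall>x\<in>U. frechet_derivative h (at x) v = k x))"
  using assms frechet_derivative_eqI unfolding differentiable_def by blast

lemma smooth_on_has_derivative:
  "smooth_on U f \<Longrightarrow> x \<in> U \<Longrightarrow> (f has_derivative frechet_derivative f (at x)) (at x)"
  using smooth_on_differentiable frechet_derivative_works by blast

text \<open>
  Closing a class \<open>G\<close> of functions under sums and products with smooth functions suffices for
  coinduction, since derivatives of the functions in question are such expressions again.
\<close>

inductive smooth_algebra ::
  "'e set \<Rightarrow> (('e::real_normed_vector \<Rightarrow> 'f::real_normed_algebra) \<Rightarrow> bool) \<Rightarrow> ('e \<Rightarrow> 'f) \<Rightarrow> bool"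
  for U G where
    base: "G f \<Longrightarrow> smooth_algebra U G f"
  | smooth: "smooth_on U f \<Longrightarrow> smooth_algebra U G f"
  | add: "smooth_algebra U G f \<Longrightarrow> smooth_algebra U G g \<Longrightarrow> smooth_algebra U G (\<lambda>x. f x + g x)"
  | mult: "smooth_algebra U G f \<Longrightarrow> smooth_algebra U G g \<Longrightarrow> smooth_algebra U G (\<lambda>x. f x * g x)"

lemma smooth_on_algebra:
  assumes "open U" "smooth_algebra U G f"
    and step: "\<And>f. G f \<Longrightarrow> (\<forall>x\<in>U. f differentiable (at x)) \<and>
      (\<forall>v. \<exists>g. smooth_algebra U G g \<and> (\<forall>x\<in>U. frechet_derivative f (at x) v = g x))"
  shows "smooth_on U f"
  using assms(1,2)
proof (rule smooth_on_coinduct)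
  fix f assume "smooth_algebra U G f"
  then show "(\<forall>x\<in>U. f differentiable (at x)) \<and>
      (\<forall>v. \<exists>g. smooth_algebra U G g \<and> (\<forall>x\<in>U. frechet_derivative f (at x) v = g x))"
  proof induction
    case (base f)
    then show ?case by (rule step)
  next
    case (smooth f)
    then show ?case
      using smooth_on_differentiable smooth_on_deriv smooth_algebra.smooth by blast
  next
    case (add f g)
    have D: "((\<lambda>x. f x + g x) has_derivative
        (\<lambda>v. frechet_derivative f (at x) v + frechet_derivative g (at x) v)) (at x)" if "x \<in> U" for x
      using add.IH that by (intro has_derivative_add) (auto simp: frechet_derivative_works)
    have "\<exists>h. smooth_algebra U G h \<and> (\<forall>x\<in>U. frechet_derivative (\<lambda>x. f x + g x) (at x) v = h x)" for v
    proof -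
      obtain f' g' where f': "smooth_algebra U G f'" "\<forall>x\<in>U. frechet_derivative f (at x) v = f' x"
        and g': "smooth_algebra U G g'" "\<forall>x\<in>U. frechet_derivative g (at x) v = g' x"
        using add.IH by meson
      then show ?thesis
        by (intro exI[of _ "\<lambda>x. f' x + g' x"])
          (simp add: frechet_derivative_eqI[OF D] f' g' smooth_algebra.add)
    qed
    then show ?case
      using D unfolding differentiable_def by blast
  next
    case (mult f g)
    have D: "((\<lambda>x. f x * g x) has_derivative
        (\<lambda>v. f x * frechet_derivative g (at x) v + frechet_derivative f (at x) v * g x)) (at x)"
      if "x \<in> U" for x
      using mult.IH that by (intro has_derivative_mult) (auto simp: frechet_derivative_works)
    have "\<exists>h. smooth_algebra U G h \<and> (\<forall>x\<in>U. frechet_derivative (\<lambda>x. f x * g x) (at x) v = h x)" for v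
    proof -
      obtain f' g' where f': "smooth_algebra U G f'" "\<forall>x\<in>U. frechet_derivative f (at x) v = f' x"
        and g': "smooth_algebra U G g'" "\<forall>x\<in>U. frechet_derivative g (at x) v = g' x"
        using mult.IH by meson
      then show ?thesis
        by (intro exI[of _ "\<lambda>x. f x * g' x + f' x * g x"])
          (simp add: frechet_derivative_eqI[OF D] f' g' mult.hyps smooth_algebra.add smooth_algebra.mult)
    qed
    then show ?case
      using D unfolding differentiable_def by blast
  qed
qed

text \<open>Without generators the algebra consists of sums and products of smooth functions. The
  product rule stays inside it, which replaces a Leibniz formula for iterated derivatives.\<close>

lemma smooth_on_mult:
  fixes f g :: "_ \<Rightarrow> 'f::real_normed_algebra"
  assumes "open U" "smooth_on U f" "smooth_on U g"
  shows "smooth_on U (\<lambda>x. f x * g x)"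
  by (rule smooth_on_algebra[where G = "\<lambda>_. False"])
    (auto intro: smooth_algebra.intros assms)

lemma smooth_on_const: "smooth_on U (\<lambda>x. c)"
proof -
  have "smooth_on UNIV (\<lambda>x. c)"
    by (rule smooth_on_coinduct[where P = "\<lambda>f. \<exists>c. f = (\<lambda>_. c)"]) auto
  then show ?thesis
    using smooth_on_subset by blast
qed

text \<open>The values lie in a normed space without a product, so the coinduction runs over sums of
  two smooth functions instead of over \<open>smooth_algebra\<close>.\<close>

lemma smooth_on_add:
  assumes "open U" "smooth_on U f" "smooth_on U g"
  shows "smooth_on U (\<lambda>x. f x + g x)"
proof -
  let ?P = "\<lambda>h. \<exists>f g. smooth_on U f \<and> smooth_on U g \<and> h = (\<lambda>x. f x + g x)"
  show ?thesis
  proof (rule smooth_on_coinduct[where P = ?P])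
    fix h :: "'a \<Rightarrow> 'b" assume "?P h"
    then obtain f g where fg: "smooth_on U f" "smooth_on U g" and h: "h = (\<lambda>x. f x + g x)" by blast
    show "(\<forall>x\<in>U. h differentiable (at x)) \<and>
        (\<forall>v. \<exists>k. ?P k \<and> (\<forall>x\<in>U. frechet_derivative h (at x) v = k x))"
    proof (rule derivative_stepI)
      show "(h has_derivative (\<lambda>v. frechet_derivative f (at x) v + frechet_derivative g (at x) v)) (at x)"
        if "x \<in> U" for x
        unfolding h using fg that by (intro has_derivative_add smooth_on_has_derivative)
      show "?P (\<lambda>x. frechet_derivative f (at x) v + frechet_derivative g (at x) v)" for v
        using fg smooth_on_deriv by blast
    qed
  qed (use assms in auto)
qed

lemma smooth_on_bounded_linear:
  assumes "open U" "smooth_on U f" "bounded_linear L"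
  shows "smooth_on U (\<lambda>x. L (f x))"
proof -
  let ?P = "\<lambda>h. \<exists>f. smooth_on U f \<and> h = (\<lambda>x. L (f x))"
  show ?thesis
  proof (rule smooth_on_coinduct[where P = ?P])
    fix h assume "?P h"
    then obtain f where f: "smooth_on U f" and h: "h = (\<lambda>x. L (f x))" by blast
    show "(\<forall>x\<in>U. h differentiable (at x)) \<and>
        (\<forall>v. \<exists>k. ?P k \<and> (\<forall>x\<in>U. frechet_derivative h (at x) v = k x))"
    proof (rule derivative_stepI)
      show "(h has_derivative (\<lambda>v. L (frechet_derivative f (at x) v))) (at x)" if "x \<in> U" for x
        unfolding h using f that
        by (intro bounded_linear.has_derivative[OF assms(3)] smooth_on_has_derivative)
      show "?P (\<lambda>x. L (frechet_derivative f (at x) v))" for v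
        using smooth_on_deriv[OF f] by blast
    qed
  qed (use assms in auto)
qed

lemma smooth_on_minus:
  assumes "open U" "smooth_on U f" "smooth_on U g"
  shows "smooth_on U (\<lambda>x. f x - g x)"
  using smooth_on_add[OF assms(1,2) smooth_on_bounded_linear[OF assms(1,3) bounded_linear_minus[OF bounded_linear_ident]]]
  by simp

text \<open>Inner products of vector-valued smooth functions serve as generators: the derivative of
  one is a sum of two of them.\<close>

lemma smooth_on_inner:
  fixes f g :: "_ \<Rightarrow> 'f::real_inner"
  assumes "open U" "smooth_on U f" "smooth_on U g"
  shows "smooth_on U (\<lambda>x. inner (f x) (g x))"
proof -
  let ?G = "\<lambda>h. \<exists>f g. smooth_on U f \<and> smooth_on U g \<and> h = (\<lambda>x. inner (f x) (g x :: 'f))"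
  show ?thesis
  proof (rule smooth_on_algebra[where G = ?G])
    fix h assume "?G h"
    then obtain f g where fg: "smooth_on U f" "smooth_on U g" and h: "h = (\<lambda>x. inner (f x) (g x :: 'f))"
      by blast
    let ?h' = "\<lambda>v x. inner (f x) (frechet_derivative g (at x) v)
        + inner (frechet_derivative f (at x) v) (g x)"
    have D: "(h has_derivative (\<lambda>v. ?h' v x)) (at x)" if "x \<in> U" for x
      unfolding h using fg that by (intro has_derivative_inner smooth_on_has_derivative)
    have A: "smooth_algebra U ?G (?h' v)" for v
      by (intro smooth_algebra.add smooth_algebra.base) (use fg smooth_on_deriv in blast)+
    show "(\<forall>x\<in>U. h differentiable (at x)) \<and>
      (\<forall>v. \<exists>k. smooth_algebra U ?G k \<and> (\<forall>x\<in>U. frechet_derivative h (at x) v = k x))"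
      by (rule derivative_stepI[where h' = ?h' and P = "smooth_algebra U ?G", OF D A])
  qed (use assms in \<open>auto intro: smooth_algebra.base\<close>)
qed

text \<open>The single generator 1/f suffices: its derivative is a product of two copies of itself,
  a derivative of f and the constant -1.\<close>

lemma smooth_on_inverse:
  fixes f :: "_ \<Rightarrow> 'f::real_normed_field"
  assumes "open U" "smooth_on U f" "\<And>x. x \<in> U \<Longrightarrow> f x \<noteq> 0"
  shows "smooth_on U (\<lambda>x. inverse (f x))"
proof -
  let ?G = "\<lambda>h. h = (\<lambda>x. inverse (f x))"
  show ?thesis
  proof (rule smooth_on_algebra[where G = ?G])
    fix h assume "?G h"
    \<comment> \<open>The sign is a constant factor because \<open>smooth_algebra\<close> has a rule
      for products but none for negation.\<close>
    let ?h' = "\<lambda>v x. - 1 * (inverse (f x) * frechet_derivative f (at x) v * inverse (f x))"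
    have D: "(h has_derivative (\<lambda>v. ?h' v x)) (at x)" if "x \<in> U" for x
      unfolding \<open>?G h\<close> mult_minus1 using assms that
      by (intro Deriv.has_derivative_inverse smooth_on_has_derivative)
    have A: "smooth_algebra U ?G (?h' v)" for v
      by (intro smooth_algebra.mult smooth_algebra.smooth[OF smooth_on_const]
          smooth_algebra.smooth[OF smooth_on_deriv] assms) (rule smooth_algebra.base, rule refl)+
    show "(\<forall>x\<in>U. h differentiable (at x)) \<and>
      (\<forall>v. \<exists>k. smooth_algebra U ?G k \<and> (\<forall>x\<in>U. frechet_derivative h (at x) v = k x))"
      by (rule derivative_stepI[where h' = ?h' and P = "smooth_algebra U ?G", OF D A])
  qed (use assms in \<open>auto intro: smooth_algebra.base\<close>)
qed


subsection \<open>Bump functions\<close>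

text \<open>The powers of 1/t are carried along because differentiating exp(-1/t) produces them; the
  family is closed under derivatives up to linear combinations (\<open>DERIV_flat\<close>).\<close>

definition flat :: "nat \<Rightarrow> real \<Rightarrow> real"
  where "flat n t = (if t > 0 then exp (- inverse t) * inverse t ^ n else 0)"

text \<open>Substituting s = 1/t turns this into the decay of s^n exp(-s) at infinity. It is what
  makes the extension by 0 differentiable at 0.\<close>

lemma flat_tendsto_0: "(flat n \<longlongrightarrow> 0) (at_right 0)"
proof -
  have "((\<lambda>t. inverse t ^ n / exp (inverse t)) \<longlongrightarrow> (0::real)) (at_right 0)"
    using filterlim_compose[OF tendsto_power_div_exp_0 filterlim_inverse_at_top_right] .
  then show ?thesis
  proof (rule Lim_transform_eventually)
    show "\<forall>\<^sub>F x in at_right 0. inverse x ^ n / exp (inverse x) = flat n x"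
      unfolding eventually_at_right_field
      by (rule exI[of _ 1]) (simp add: flat_def exp_minus field_simps)
  qed
qed

lemma DERIV_flat:
  "(flat n has_real_derivative - real n * flat (Suc n) t + flat (n + 2) t) (at t)"
proof -
  consider "t > 0" | "t < 0" | "t = 0" by linarith
  then show ?thesis
  proof cases
    case 1
    have "((\<lambda>t. exp (- inverse t) * inverse t ^ n) has_real_derivative
        (exp (- inverse t) * (inverse t * inverse t)) * inverse t ^ n
          + exp (- inverse t) * (real n * inverse t ^ (n - 1) * - (inverse t * inverse t))) (at t)"
      using 1 by (auto intro!: derivative_eq_intros)
    then have D: "((\<lambda>t. exp (- inverse t) * inverse t ^ n) has_real_derivative
        - real n * flat (Suc n) t + flat (n + 2) t) (at t)"
      using 1 by (cases n) (simp_all add: flat_def algebra_simps)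
    show ?thesis
      by (rule has_field_derivative_transform_within_open[OF D open_greaterThan[of 0]])
        (use 1 in \<open>auto simp: flat_def\<close>)
  next
    case 2
    have D: "((\<lambda>t. 0) has_real_derivative - real n * flat (Suc n) t + flat (n + 2) t) (at t)"
      using 2 by (simp add: flat_def)
    show ?thesis
      by (rule has_field_derivative_transform_within_open[OF D open_lessThan[of 0]])
        (use 2 in \<open>auto simp: flat_def\<close>)
  next
    case 3
    \<comment> \<open>From the right, the difference quotient of \<open>flat n\<close> at 0 is
      \<open>flat (Suc n)\<close>; from the left it is 0.\<close>
    have "((\<lambda>h. (flat n (0 + h) - flat n 0) / h) \<longlongrightarrow> 0) (at_right 0)"
      using flat_tendsto_0[of "Suc n"]
      by (rule Lim_transform_eventually)
        (auto simp: flat_def field_simps eventually_at_right_field intro!: exI[of _ 1])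
    moreover have "((\<lambda>h. (flat n (0 + h) - flat n 0) / h) \<longlongrightarrow> 0) (at_left 0)"
      by (rule Lim_transform_eventually[OF tendsto_const])
        (auto simp: flat_def eventually_at_left_field intro!: exI[of _ "-1"])
    ultimately have "((\<lambda>h. (flat n (0 + h) - flat n 0) / h) \<longlongrightarrow> 0) (at 0)"
      by (simp add: filterlim_split_at)
    then show ?thesis
      unfolding 3 DERIV_def by (simp add: flat_def)
  qed
qed

lemma smooth_on_flat:
  assumes "open U" "smooth_on U q"
  shows "smooth_on U (\<lambda>x. flat n (q x))"
proof -
  let ?G = "\<lambda>h. \<exists>n. h = (\<lambda>x. flat n (q x))"
  show ?thesis
  proof (rule smooth_on_algebra[where G = ?G])
    fix h assume "?G h"
    then obtain n where h: "h = (\<lambda>x. flat n (q x))" by blast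
    let ?h' = "\<lambda>v x. (- real n * flat (Suc n) (q x) + flat (n + 2) (q x)) * frechet_derivative q (at x) v"
    have D: "(h has_derivative (\<lambda>v. ?h' v x)) (at x)" if "x \<in> U" for x
      unfolding h using has_derivative_compose[OF smooth_on_has_derivative[OF assms(2) that]
        DERIV_flat[unfolded has_field_derivative_def]] by simp
    have A: "smooth_algebra U ?G (?h' v)" for v
      using assms smooth_on_deriv smooth_on_const
      by (intro smooth_algebra.mult smooth_algebra.add) (blast intro: smooth_algebra.intros)+
    show "(\<forall>x\<in>U. h differentiable (at x)) \<and>
      (\<forall>v. \<exists>k. smooth_algebra U ?G k \<and> (\<forall>x\<in>U. frechet_derivative h (at x) v = k x))"
      by (rule derivative_stepI[where h' = ?h' and P = "smooth_algebra U ?G", OF D A])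
  qed (use assms in \<open>auto intro: smooth_algebra.base\<close>)
qed

text \<open>The usual smooth step, falling from 1 to 0 between 1/2 and 1. The denominator never
  vanishes, since at every t one of \<open>1 - t\<close> and \<open>t - 1/2\<close> is
  positive.\<close>

definition bump :: "real \<Rightarrow> real"
  where "bump t = flat 0 (1 - t) * inverse (flat 0 (1 - t) + flat 0 (t - 1/2))"

lemma bump_eq_1: "t \<le> 1/2 \<Longrightarrow> bump t = 1"
  by (simp add: bump_def flat_def)

lemma bump_eq_0: "t \<ge> 1 \<Longrightarrow> bump t = 0"
  by (simp add: bump_def flat_def)

lemma smooth_on_bump:
  assumes "open U" "smooth_on U q"
  shows "smooth_on U (\<lambda>x. bump (q x))"
proof -
  have "flat 0 (1 - t) + flat 0 (t - 1/2) \<noteq> 0" for t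
  proof -
    have "flat 0 (1 - t) > 0 \<or> flat 0 (t - 1/2) > 0"
      by (auto simp: flat_def)
    moreover have "flat 0 s \<ge> 0" for s
      by (simp add: flat_def)
    ultimately show ?thesis
      by (smt (verit))
  qed
  then show ?thesis
    unfolding bump_def using assms
    by (intro smooth_on_mult smooth_on_inverse smooth_on_add smooth_on_flat smooth_on_minus
        smooth_on_const) auto
qed


subsection \<open>Families of functions with bounded derivatives\<close>

text \<open>Boundedness in spaces of smooth functions, phrased by seminorms; \<open>D\<close> will
  be the image in a chart of a compact set.\<close>

definition bounded_jets :: "'e set \<Rightarrow> ('e::real_normed_vector \<Rightarrow> 'f::real_normed_vector) set \<Rightarrow> bool"
  where "bounded_jets D H \<longleftrightarrow> (\<forall>vs. \<exists>K. \<forall>f\<in>H. \<forall>y\<in>D. norm (iter_deriv vs f y) \<le> K)"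

lemma iter_deriv_add:
  assumes "open U" "smooth_on U f" "smooth_on U g" "x \<in> U"
  shows "iter_deriv vs (\<lambda>x. f x + g x) x = iter_deriv vs f x + iter_deriv vs g x"
  using assms(2-4)
proof (induction vs arbitrary: f g x)
  case (Cons v vs)
  have "frechet_derivative (\<lambda>x. f x + g x) (at y) v
      = frechet_derivative f (at y) v + frechet_derivative g (at y) v" if "y \<in> U" for y
    using Cons.prems that
    by (intro frechet_derivative_eqI has_derivative_add smooth_on_has_derivative)
  then have "iter_deriv vs (\<lambda>y. frechet_derivative (\<lambda>x. f x + g x) (at y) v) x
      = iter_deriv vs (\<lambda>y. frechet_derivative f (at y) v + frechet_derivative g (at y) v) x"
    by (intro iter_deriv_cong_open[OF assms(1)] Cons.prems(3))
  then show ?case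
    using Cons.IH[OF smooth_on_deriv smooth_on_deriv] Cons.prems by simp
qed simp

lemma iter_deriv_cmult:
  fixes f :: "_ \<Rightarrow> 'f::real_normed_algebra"
  assumes "open U" "smooth_on U f" "x \<in> U"
  shows "iter_deriv vs (\<lambda>x. c * f x) x = c * iter_deriv vs f x"
  using assms(2,3)
proof (induction vs arbitrary: f x)
  case (Cons v vs)
  have "frechet_derivative (\<lambda>x. c * f x) (at y) v = c * frechet_derivative f (at y) v" if "y \<in> U" for y
    using Cons.prems that
    by (intro frechet_derivative_eqI has_derivative_mult_right smooth_on_has_derivative)
  then have "iter_deriv vs (\<lambda>y. frechet_derivative (\<lambda>x. c * f x) (at y) v) x
      = iter_deriv vs (\<lambda>y. c * frechet_derivative f (at y) v) x"
    by (intro iter_deriv_cong_open[OF assms(1)] Cons.prems(2))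
  then show ?case
    using Cons.IH[OF smooth_on_deriv] Cons.prems by simp
qed simp

lemma iter_deriv_minus:
  fixes f g :: "_ \<Rightarrow> 'f::real_normed_algebra_1"
  assumes "open U" "smooth_on U f" "smooth_on U g" "x \<in> U"
  shows "iter_deriv vs (\<lambda>x. f x - g x) x = iter_deriv vs f x - iter_deriv vs g x"
proof -
  have "smooth_on U (\<lambda>x. (- 1) * g x)"
    using assms smooth_on_mult smooth_on_const by blast
  then show ?thesis
    using iter_deriv_add[of U f "\<lambda>x. (- 1) * g x" x vs] iter_deriv_cmult[of U g x vs "- 1"] assms
    by simp
qed

lemma iter_deriv_zero: "iter_deriv vs (\<lambda>x. 0) = (\<lambda>x. 0)"
  by (induction vs) simp_all

text \<open>One use of the product rule leads from the families \<open>H\<close>, \<open>K\<close>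
  to the pairs \<open>H\<close>, \<open>dir\<close> K\<open>and\<close>dir \<open>H\<close>,
  \<open>K\<close>. Their jets are bounded again, so the induction on the list of directions closes
  once the families are allowed to vary.\<close>

lemma bounded_jets_mult:
  fixes H K :: "('e::real_normed_vector \<Rightarrow> 'f::real_normed_algebra) set"
  assumes "open U" "D \<subseteq> U" "\<And>f. f \<in> H \<Longrightarrow> smooth_on U f" "\<And>f. f \<in> K \<Longrightarrow> smooth_on U f"
    and "bounded_jets D H" "bounded_jets D K"
  shows "bounded_jets D {\<lambda>x. f x * g x | f g. f \<in> H \<and> g \<in> K}"
proof -
  have "\<exists>B. \<forall>f\<in>H. \<forall>g\<in>K. \<forall>y\<in>D. norm (iter_deriv vs (\<lambda>x. f x * g x) y) \<le> B" for vs
    using assms(3-6)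
  proof (induction vs arbitrary: H K)
    case Nil
    obtain A where A: "\<forall>f\<in>H. \<forall>y\<in>D. norm (iter_deriv [] f y) \<le> A"
      using Nil.prems(3) unfolding bounded_jets_def by blast
    obtain B where B: "\<forall>f\<in>K. \<forall>y\<in>D. norm (iter_deriv [] f y) \<le> B"
      using Nil.prems(4) unfolding bounded_jets_def by blast
    have "norm (f y * g y) \<le> A * B" if "f \<in> H" "g \<in> K" "y \<in> D" for f g y
      using A B that norm_mult_ineq[of "f y" "g y"]
      by (intro order_trans[OF norm_mult_ineq] mult_mono) (auto intro: order_trans[OF norm_ge_zero])
    then show ?case by auto
  next
    case (Cons v vs)
    define dir where "dir = (\<lambda>(f :: 'e \<Rightarrow> 'f) x. frechet_derivative f (at x) v)"
    have jets: "bounded_jets D (dir ` Q)" if "bounded_jets D Q" for Q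
      unfolding bounded_jets_def
    proof
      fix ws
      obtain B where "\<forall>f\<in>Q. \<forall>y\<in>D. norm (iter_deriv (v # ws) f y) \<le> B"
        using \<open>bounded_jets D Q\<close> unfolding bounded_jets_def by blast
      then show "\<exists>B. \<forall>f\<in>dir ` Q. \<forall>y\<in>D. norm (iter_deriv ws f y) \<le> B"
        by (intro exI[of _ B]) (auto simp: dir_def)
    qed
    have sm: "smooth_on U (dir f)" if "smooth_on U f" for f
      using smooth_on_deriv[OF that] unfolding dir_def .
    obtain A where A: "\<forall>f\<in>H. \<forall>g\<in>dir ` K. \<forall>y\<in>D. norm (iter_deriv vs (\<lambda>x. f x * g x) y) \<le> A"
      using Cons.IH[of H "dir ` K"] Cons.prems jets sm by blast
    obtain B where B: "\<forall>f\<in>dir ` H. \<forall>g\<in>K. \<forall>y\<in>D. norm (iter_deriv vs (\<lambda>x. f x * g x) y) \<le> B"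
      using Cons.IH[of "dir ` H" K] Cons.prems jets sm by blast
    have "norm (iter_deriv (v # vs) (\<lambda>x. f x * g x) y) \<le> A + B" if "f \<in> H" "g \<in> K" "y \<in> D" for f g y
    proof -
      note fg = Cons.prems(1)[OF \<open>f \<in> H\<close>] Cons.prems(2)[OF \<open>g \<in> K\<close>]
      have y: "y \<in> U" using that assms(2) by blast
      have "frechet_derivative (\<lambda>x. f x * g x) (at z) v = f z * dir g z + dir f z * g z" if "z \<in> U" for z
        unfolding dir_def using fg that
        by (intro frechet_derivative_eqI has_derivative_mult smooth_on_has_derivative)
      then have "iter_deriv (v # vs) (\<lambda>x. f x * g x) y = iter_deriv vs (\<lambda>z. f z * dir g z + dir f z * g z) y"
        unfolding iter_deriv.simps by (intro iter_deriv_cong_open[OF assms(1) y])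
      also have "\<dots> = iter_deriv vs (\<lambda>z. f z * dir g z) y + iter_deriv vs (\<lambda>z. dir f z * g z) y"
        using fg sm y by (intro iter_deriv_add[OF assms(1)] smooth_on_mult[OF assms(1)]) auto
      finally have eq: "iter_deriv (v # vs) (\<lambda>x. f x * g x) y
          = iter_deriv vs (\<lambda>z. f z * dir g z) y + iter_deriv vs (\<lambda>z. dir f z * g z) y" .
      show ?thesis
        unfolding eq using A B that by (intro norm_triangle_mono) blast+
    qed
    then show ?case by blast
  qed
  then show ?thesis
    unfolding bounded_jets_def by (smt (verit) mem_Collect_eq)
qed

lemma bounded_jets_singleton:
  assumes "compact D" "D \<subseteq> U" "smooth_on U f"
  shows "bounded_jets D {f}"
  unfolding bounded_jets_def
proof
  fix vs
  have "continuous_on D (iter_deriv vs f)"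
    using assms(2,3) unfolding smooth_on_def
    by (meson continuous_at_imp_continuous_on differentiable_imp_continuous_within subsetD)
  then have "bounded (iter_deriv vs f ` D)"
    using assms(1) compact_continuous_image compact_imp_bounded by blast
  then show "\<exists>K. \<forall>f\<in>{f}. \<forall>y\<in>D. norm (iter_deriv vs f y) \<le> K"
    unfolding bounded_iff by auto
qed


section \<open>Linear algebra\<close>

lemma ring_of_type_algebra_simps [simp]:
  "carrier ring_of_type_algebra = UNIV"
  "x \<oplus>\<^bsub>ring_of_type_algebra\<^esub> y = x + y"
  "x \<otimes>\<^bsub>ring_of_type_algebra\<^esub> y = x * y"
  "\<zero>\<^bsub>ring_of_type_algebra\<^esub> = 0"
  "\<one>\<^bsub>ring_of_type_algebra\<^esub> = 1"
  by (simp_all add: ring_of_type_algebra_def)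

lemma cring_of_type: "cring (ring_of_type_algebra :: 'k::field ring)"
  by (rule cring_from_type_algebra)

text \<open>Restates the module axioms with the operations of the scalar type, so that the record
  \<open>ring_of_type_algebra\<close> stays out of later calculations.\<close>

locale vec_space = Module.module "ring_of_type_algebra :: 'k ring" V
  for V :: "('k::field, 'v, 'z) module_scheme" (structure)
begin

lemma scale_closed [simp, intro]: "x \<in> carrier V \<Longrightarrow> c \<odot> x \<in> carrier V"
  using smult_closed by simp

lemma scale_distrib: "x \<in> carrier V \<Longrightarrow> y \<in> carrier V \<Longrightarrow> c \<odot> (x \<oplus> y) = c \<odot> x \<oplus> c \<odot> y"
  using smult_r_distr by simp

lemma scale_add: "x \<in> carrier V \<Longrightarrow> (c + d) \<odot> x = c \<odot> x \<oplus> d \<odot> x"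
  using smult_l_distr[of c d x] by simp

lemma scale_scale: "x \<in> carrier V \<Longrightarrow> c \<odot> (d \<odot> x) = (c * d) \<odot> x"
  using smult_assoc1[of c d x] by simp

lemma scale_one [simp]: "x \<in> carrier V \<Longrightarrow> 1 \<odot> x = x"
  using smult_one by simp

lemma scale_0_left [simp]: "x \<in> carrier V \<Longrightarrow> 0 \<odot> x = \<zero>"
  using smult_l_null by simp

lemma scale_0_right [simp]: "c \<odot> \<zero> = \<zero>"
  using smult_r_null by simp

lemma scale_minus_1: "x \<in> carrier V \<Longrightarrow> (- 1) \<odot> x = \<ominus> x"
  using scale_add[of x 1 "- 1"] M.minus_equality[of "(- 1) \<odot> x" x] M.add.m_comm[of x "(- 1) \<odot> x"]
  by simp

lemma scale_inverse:
  "c \<noteq> 0 \<Longrightarrow> x \<in> carrier V \<Longrightarrow> c \<odot> (inverse c \<odot> x) = x"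
  "c \<noteq> 0 \<Longrightarrow> x \<in> carrier V \<Longrightarrow> inverse c \<odot> (c \<odot> x) = x"
  by (simp_all add: scale_scale)

end

lemma vec_space_iff: "vec_space V \<longleftrightarrow> vector_space_over_type V"
  by (simp add: vec_space_def)

text \<open>Additive inverses come from scaling: (-1) x + x = (-1 + 1) x = 0. The concrete spaces
  below are therefore described by zero, addition and scaling alone.\<close>

lemma vec_spaceI:
  fixes V :: "('k::field, 'v, 'z) module_scheme" (structure)
  assumes "\<zero> \<in> carrier V"
    and "\<And>x y. x \<in> carrier V \<Longrightarrow> y \<in> carrier V \<Longrightarrow> x \<oplus> y \<in> carrier V"
    and "\<And>c x. x \<in> carrier V \<Longrightarrow> c \<odot> x \<in> carrier V"
    and "\<And>x y z. x \<in> carrier V \<Longrightarrow> y \<in> carrier V \<Longrightarrow> z \<in> carrier V \<Longrightarrow> (x \<oplus> y) \<oplus> z = x \<oplus> (y \<oplus> z)"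
    and "\<And>x y. x \<in> carrier V \<Longrightarrow> y \<in> carrier V \<Longrightarrow> x \<oplus> y = y \<oplus> x"
    and "\<And>x. x \<in> carrier V \<Longrightarrow> \<zero> \<oplus> x = x"
    and "\<And>x. x \<in> carrier V \<Longrightarrow> 0 \<odot> x = \<zero>"
    and "\<And>c d x. x \<in> carrier V \<Longrightarrow> (c + d) \<odot> x = c \<odot> x \<oplus> d \<odot> x"
    and "\<And>c x y. x \<in> carrier V \<Longrightarrow> y \<in> carrier V \<Longrightarrow> c \<odot> (x \<oplus> y) = c \<odot> x \<oplus> c \<odot> y"
    and "\<And>c d x. x \<in> carrier V \<Longrightarrow> (c * d) \<odot> x = c \<odot> (d \<odot> x)"
    and "\<And>x. x \<in> carrier V \<Longrightarrow> 1 \<odot> x = x"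
  shows "vec_space V"
proof -
  have inv: "\<exists>y\<in>carrier V. y \<oplus> x = \<zero>" if x: "x \<in> carrier V" for x
  proof -
    have "(- 1) \<odot> x \<oplus> x = \<zero>"
      using assms(7,8,11) x by (metis add.left_inverse)
    then show ?thesis using assms(3) x by blast
  qed
  have "abelian_group V"
    by (rule abelian_groupI) (use assms inv in auto)
  then show ?thesis
    unfolding vec_space_iff using cring_of_type assms by (intro moduleI) auto
qed

section \<open>Linear maps, subspaces and spans\<close>

definition linear_maps ::
  "('k, 'v, 'y) module_scheme \<Rightarrow> ('k, 'w, 'z) module_scheme \<Rightarrow> ('v \<Rightarrow> 'w) set"
  where "linear_maps V W = {f \<in> carrier V \<rightarrow> carrier W.
    (\<forall>x\<in>carrier V. \<forall>y\<in>carrier V. f (x \<oplus>\<^bsub>V\<^esub> y) = f x \<oplus>\<^bsub>W\<^esub> f y) \<and>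
    (\<forall>c. \<forall>x\<in>carrier V. f (c \<odot>\<^bsub>V\<^esub> x) = c \<odot>\<^bsub>W\<^esub> f x)}"

lemma linear_mapsD:
  assumes "f \<in> linear_maps V W"
  shows "x \<in> carrier V \<Longrightarrow> f x \<in> carrier W"
    and "x \<in> carrier V \<Longrightarrow> y \<in> carrier V \<Longrightarrow> f (x \<oplus>\<^bsub>V\<^esub> y) = f x \<oplus>\<^bsub>W\<^esub> f y"
    and "x \<in> carrier V \<Longrightarrow> f (c \<odot>\<^bsub>V\<^esub> x) = c \<odot>\<^bsub>W\<^esub> f x"
  using assms unfolding linear_maps_def by auto

lemma linear_maps_zero:
  assumes "vec_space V" "vec_space W" "f \<in> linear_maps V W"
  shows "f \<zero>\<^bsub>V\<^esub> = \<zero>\<^bsub>W\<^esub>"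
proof -
  interpret V: vec_space V by fact
  interpret W: vec_space W by fact
  have "f (0 \<odot>\<^bsub>V\<^esub> \<zero>\<^bsub>V\<^esub>) = 0 \<odot>\<^bsub>W\<^esub> f \<zero>\<^bsub>V\<^esub>"
    using linear_mapsD[OF assms(3)] by blast
  then show ?thesis
    using linear_mapsD(1)[OF assms(3) V.M.zero_closed] by simp
qed

lemma linear_maps_finsum:
  assumes "vec_space V" "vec_space W" "f \<in> linear_maps V W" "finite A" "g \<in> A \<rightarrow> carrier V"
  shows "f (finsum V g A) = finsum W (\<lambda>i. f (g i)) A"
proof -
  interpret V: vec_space V by fact
  interpret W: vec_space W by fact
  show ?thesis
    using assms(4,5)
  proof (induction A rule: finite_induct)
    case empty
    then show ?case using linear_maps_zero[OF assms(1-3)] by simp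
  next
    case (insert a A)
    then have "g \<in> A \<rightarrow> carrier V" "g a \<in> carrier V" by auto
    then show ?case
      using insert linear_mapsD[OF assms(3)] by (simp add: V.M.finsum_insert W.M.finsum_insert Pi_def)
  qed
qed

lemma linear_maps_finsum_fun:
  assumes "vec_space V" "vec_space W" "finite A" "\<And>i. i \<in> A \<Longrightarrow> f i \<in> linear_maps V W"
  shows "(\<lambda>x. finsum W (\<lambda>i. f i x) A) \<in> linear_maps V W"
proof -
  interpret V: vec_space V by fact
  interpret W: vec_space W by fact
  have sm: "finsum W (\<lambda>i. c \<odot>\<^bsub>W\<^esub> g i) A = c \<odot>\<^bsub>W\<^esub> finsum W g A" if "g \<in> A \<rightarrow> carrier W" for c g
    using linear_maps_finsum[of W W "\<lambda>x. c \<odot>\<^bsub>W\<^esub> x" A g] that assms(2,3)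
    by (auto simp: linear_maps_def W.scale_distrib W.scale_scale mult.commute)
  have [simp]: "f i x \<in> carrier W" if "i \<in> A" "x \<in> carrier V" for i x
    using linear_mapsD(1)[OF assms(4)] that by blast
  show ?thesis
    unfolding linear_maps_def
  proof (intro CollectI conjI ballI allI)
    show "(\<lambda>x. finsum W (\<lambda>i. f i x) A) \<in> carrier V \<rightarrow> carrier W"
      by (auto intro!: W.M.finsum_closed)
  next
    fix x y assume xy: "x \<in> carrier V" "y \<in> carrier V"
    have "finsum W (\<lambda>i. f i (x \<oplus>\<^bsub>V\<^esub> y)) A = finsum W (\<lambda>i. f i x \<oplus>\<^bsub>W\<^esub> f i y) A"
      using xy linear_mapsD(2)[OF assms(4)] by (intro W.M.finsum_cong') auto
    then show "finsum W (\<lambda>i. f i (x \<oplus>\<^bsub>V\<^esub> y)) A = finsum W (\<lambda>i. f i x) A \<oplus>\<^bsub>W\<^esub> finsum W (\<lambda>i. f i y) A"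
      using xy by (simp add: W.M.finsum_addf)
  next
    fix c x assume x: "x \<in> carrier V"
    have "finsum W (\<lambda>i. f i (c \<odot>\<^bsub>V\<^esub> x)) A = finsum W (\<lambda>i. c \<odot>\<^bsub>W\<^esub> f i x) A"
      using x linear_mapsD(3)[OF assms(4)] by (intro W.M.finsum_cong') auto
    then show "finsum W (\<lambda>i. f i (c \<odot>\<^bsub>V\<^esub> x)) A = c \<odot>\<^bsub>W\<^esub> finsum W (\<lambda>i. f i x) A"
      using x sm by simp
  qed
qed

lemma linear_maps_comp:
  "f \<in> linear_maps U V \<Longrightarrow> g \<in> linear_maps V W \<Longrightarrow> (\<lambda>x. g (f x)) \<in> linear_maps U W"
  unfolding linear_maps_def by (simp add: Pi_iff)

abbreviation subspace_of :: "'v set \<Rightarrow> ('k::field, 'v, 'z) module_scheme \<Rightarrow> bool"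
  where "subspace_of H V \<equiv> submodule H (ring_of_type_algebra :: 'k ring) V"

lemma subspace_ofI:
  assumes "vec_space V" "H \<subseteq> carrier V" "\<zero>\<^bsub>V\<^esub> \<in> H"
    and add: "\<And>x y. x \<in> H \<Longrightarrow> y \<in> H \<Longrightarrow> x \<oplus>\<^bsub>V\<^esub> y \<in> H"
    and scale: "\<And>c x. x \<in> H \<Longrightarrow> c \<odot>\<^bsub>V\<^esub> x \<in> H"
  shows "subspace_of H V"
proof -
  interpret V: vec_space V by fact
  have "\<ominus>\<^bsub>V\<^esub> x \<in> H" if "x \<in> H" for x
    using scale[OF that, of "- 1"] that assms(2) V.scale_minus_1 by auto
  then show ?thesis
    unfolding submodule_def submodule_axioms_def
    using assms(2,3) add scale
    by (auto intro!: subgroup.intro simp: a_inv_def)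
qed

lemma subspace_ofD:
  assumes "subspace_of H (V :: ('k::field, 'v, 'z) module_scheme)"
  shows "H \<subseteq> carrier V" "\<zero>\<^bsub>V\<^esub> \<in> H" "x \<in> H \<Longrightarrow> y \<in> H \<Longrightarrow> x \<oplus>\<^bsub>V\<^esub> y \<in> H" "x \<in> H \<Longrightarrow> c \<odot>\<^bsub>V\<^esub> x \<in> H"
proof -
  interpret submodule H "ring_of_type_algebra :: 'k ring" V by fact
  show "H \<subseteq> carrier V" "\<zero>\<^bsub>V\<^esub> \<in> H" "x \<in> H \<Longrightarrow> y \<in> H \<Longrightarrow> x \<oplus>\<^bsub>V\<^esub> y \<in> H" "x \<in> H \<Longrightarrow> c \<odot>\<^bsub>V\<^esub> x \<in> H"
    using subset m_closed one_closed smult_closed by (auto simp: subset_iff)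
qed

text \<open>The span is the intersection of all subspaces containing \<open>S\<close>. The
  assumption on \<open>S\<close> makes the whole space one of them, so the intersection is taken
  over a nonempty family and stays in the carrier.\<close>

lemma subspace_lin_span:
  assumes "vec_space V" "S \<subseteq> carrier V"
  shows "subspace_of (lin_span V S) V"
proof -
  interpret V: vec_space V by fact
  have "subspace_of (carrier V) V"
    by (rule subspace_ofI) (use assms in auto)
  then have *: "lin_span V S \<subseteq> carrier V"
    using assms(2) unfolding lin_span_def by (simp add: hull_minimal)
  show ?thesis
    by (rule subspace_ofI[OF assms(1) *])
      (auto simp: lin_span_def hull_def subspace_ofD)
qed

lemma lin_span_minimal: "S \<subseteq> H \<Longrightarrow> subspace_of H V \<Longrightarrow> lin_span V S \<subseteq> H"
  unfolding lin_span_def by (rule hull_minimal)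

lemma lin_span_superset: "S \<subseteq> lin_span V S"
  unfolding lin_span_def by (rule hull_subset)

lemma subspace_kernel:
  assumes "vec_space V" "vec_space W" "f \<in> linear_maps V W"
  shows "subspace_of {x \<in> carrier V. f x = \<zero>\<^bsub>W\<^esub>} V"
proof -
  interpret V: vec_space V by fact
  interpret W: vec_space W by fact
  show ?thesis
    by (rule subspace_ofI[OF assms(1)]) (auto simp: linear_mapsD[OF assms(3)] linear_maps_zero[OF assms])
qed


subsection \<open>Quotients\<close>

lemma mk_module_simps [simp]:
  "carrier (mk_module C z pl sm) = C" "zero (mk_module C z pl sm) = z"
  "add (mk_module C z pl sm) = pl" "smult (mk_module C z pl sm) = sm"
  by (simp_all add: mk_module_def)

lemma quot_module_simps:
  "carrier (quot_module V J) = a_rcosets\<^bsub>V\<^esub> J" "zero (quot_module V J) = J"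
  "add (quot_module V J) = set_add V" "smult (quot_module V J) c = quot_op V J (smult V c)"
  by (simp_all add: quot_module_def)

locale vec_quotient = vec_space V for V :: "('k::field, 'v, 'z) module_scheme" (structure) +
  fixes J
  assumes subspace_J: "subspace_of J V"
begin

sublocale J: abelian_subgroup J V
proof -
  interpret submodule J "ring_of_type_algebra :: 'k ring" V by (rule subspace_J)
  show "abelian_subgroup J V"
    by (intro abelian_subgroupI3) unfold_locales
qed

lemma quot_carrierE:
  assumes "Y \<in> carrier (quot_module V J)"
  obtains x where "x \<in> carrier V" "Y = J +> x"
  using assms unfolding quot_module_simps A_RCOSETS_def' by auto

lemma coset_in_quot [simp, intro]: "x \<in> carrier V \<Longrightarrow> J +> x \<in> carrier (quot_module V J)"
  unfolding quot_module_simps A_RCOSETS_def' by auto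

lemma quot_add [simp]:
  "x \<in> carrier V \<Longrightarrow> y \<in> carrier V \<Longrightarrow> (J +> x) \<oplus>\<^bsub>quot_module V J\<^esub> (J +> y) = J +> (x \<oplus> y)"
  unfolding quot_module_simps by (rule J.a_rcos_sum)


lemma coset_eq_iff:
  assumes "x \<in> carrier V" "y \<in> carrier V"
  shows "J +> x = J +> y \<longleftrightarrow> x \<ominus> y \<in> J"
proof -
  have "J +> x = J +> y \<longleftrightarrow> x \<in> J +> y"
    using assms J.a_rcos_self J.a_repr_independence' by blast
  then show ?thesis
    using assms J.a_rcos_module[of y x] by (simp add: M.minus_eq)
qed

lemma coset_zero: "J +> \<zero> = J"
  using subspace_ofD(1)[OF subspace_J] by simp

text \<open>The image of a coset need not be a coset: scaling by 0 leaves a single point. Adding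
  \<open>J\<close> fills it up, and invariance of \<open>J\<close> under \<open>f\<close> keeps the
  result inside the coset of \<open>f x\<close>.\<close>

lemma quot_op_coset:
  assumes f: "\<And>x y. x \<in> carrier V \<Longrightarrow> y \<in> carrier V \<Longrightarrow> f (x \<oplus> y) = f x \<oplus> f y"
    and c: "f \<in> carrier V \<rightarrow> carrier V" and J: "\<And>x. x \<in> J \<Longrightarrow> f x \<in> J"
    and x: "x \<in> carrier V"
  shows "quot_op V J f (J +> x) = J +> f x"
proof -
  note JD = subspace_ofD[OF subspace_J]
  have "f ` (J +> x) \<subseteq> J +> f x"
  proof
    fix y assume "y \<in> f ` (J +> x)"
    then obtain h where h: "h \<in> J" "y = f (h \<oplus> x)"
      by (auto simp: a_r_coset_def')
    then show "y \<in> J +> f x"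
      using f[of h x] x J JD(1) by (auto simp: a_r_coset_def')
  qed
  then have "J <+>\<^bsub>V\<^esub> f ` (J +> x) \<subseteq> J <+>\<^bsub>V\<^esub> (J +> f x)"
    by (auto simp: set_add_def')
  also have "J <+>\<^bsub>V\<^esub> (J +> f x) = J +> f x"
    using J.a_rcos_sum[of \<zero> "f x"] c x coset_zero by (auto simp: Pi_iff)
  finally have 1: "J <+>\<^bsub>V\<^esub> f ` (J +> x) \<subseteq> J +> f x" .
  have "J +> f x \<subseteq> J <+>\<^bsub>V\<^esub> f ` (J +> x)"
  proof
    fix z assume "z \<in> J +> f x"
    then obtain h where "h \<in> J" "z = h \<oplus> f x"
      unfolding a_r_coset_def' by blast
    then show "z \<in> J <+>\<^bsub>V\<^esub> f ` (J +> x)"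
      using J.a_rcos_self[OF x] unfolding set_add_def' by blast
  qed
  then show ?thesis
    using 1 unfolding quot_op_def by blast
qed

lemma quot_scale [simp]:
  assumes "x \<in> carrier V"
  shows "c \<odot>\<^bsub>quot_module V J\<^esub> (J +> x) = J +> (c \<odot> x)"
  unfolding quot_module_simps
  by (rule quot_op_coset) (use assms subspace_ofD[OF subspace_J] in \<open>auto simp: scale_distrib\<close>)

lemma vec_space_quot: "vec_space (quot_module V J)"
proof (rule vec_spaceI)
  show "\<zero>\<^bsub>quot_module V J\<^esub> \<in> carrier (quot_module V J)"
    using coset_in_quot[OF M.zero_closed] by (simp add: coset_zero quot_module_simps(2))
  show "0 \<odot>\<^bsub>quot_module V J\<^esub> x = \<zero>\<^bsub>quot_module V J\<^esub>" if "x \<in> carrier (quot_module V J)" for x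
    using that by (elim quot_carrierE) (simp add: coset_zero quot_module_simps(2))
  show "\<zero>\<^bsub>quot_module V J\<^esub> \<oplus>\<^bsub>quot_module V J\<^esub> x = x" if "x \<in> carrier (quot_module V J)" for x
    using that quot_add[OF M.zero_closed] by (elim quot_carrierE) (simp add: coset_zero quot_module_simps(2))
  show "x \<oplus>\<^bsub>quot_module V J\<^esub> y = y \<oplus>\<^bsub>quot_module V J\<^esub> x"
    if "x \<in> carrier (quot_module V J)" "y \<in> carrier (quot_module V J)" for x y
    using that by (elim quot_carrierE) (simp add: M.a_comm)
qed (auto elim!: quot_carrierE simp: M.a_assoc scale_distrib scale_add scale_scale)

lemma linear_maps_coset: "(\<lambda>x. J +> x) \<in> linear_maps V (quot_module V J)"
  unfolding linear_maps_def by auto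

end

text \<open>The common value of \<open>f\<close> on a coset, with no representative chosen; it is
  meaningful only where \<open>f\<close> is constant on \<open>Y\<close>. \<open>tensor_triv\<close>
  is encoded in the same way, so the two can be identified in \<open>tensor_triv_eq\<close>.\<close>

definition induced_map :: "('v \<Rightarrow> 'w) \<Rightarrow> 'v set \<Rightarrow> 'w"
  where "induced_map f Y = the_elem (f ` Y)"

lemma induced_map_eqI: "Y \<noteq> {} \<Longrightarrow> (\<And>y. y \<in> Y \<Longrightarrow> f y = z) \<Longrightarrow> induced_map f Y = z"
  unfolding induced_map_def by (metis (no_types, lifting) the_elem_image_unique ex_in_conv)

context vec_quotient
begin

lemma induced_map_image:
  assumes "vec_space W" "f \<in> linear_maps V W" "\<And>x. x \<in> J \<Longrightarrow> f x = \<zero>\<^bsub>W\<^esub>" "x \<in> carrier V" "y \<in> J +> x"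
  shows "f y = f x"
proof -
  interpret W: vec_space W by fact
  obtain h where "h \<in> J" "y = h \<oplus> x"
    using assms(5) by (auto simp: a_r_coset_def')
  then show ?thesis
    using linear_mapsD[OF assms(2)] assms(3,4) subspace_ofD(1)[OF subspace_J] by auto
qed

lemma induced_map_coset:
  assumes "vec_space W" "f \<in> linear_maps V W" "\<And>x. x \<in> J \<Longrightarrow> f x = \<zero>\<^bsub>W\<^esub>" "x \<in> carrier V"
  shows "induced_map f (J +> x) = f x"
proof (rule induced_map_eqI)
  show "J +> x \<noteq> {}"
    using J.a_rcos_self[OF assms(4)] by blast
  show "f y = f x" if "y \<in> J +> x" for y
    by (rule induced_map_image[OF assms that])
qed

lemma induced_map_linear:
  assumes "vec_space W" "f \<in> linear_maps V W" "\<And>x. x \<in> J \<Longrightarrow> f x = \<zero>\<^bsub>W\<^esub>"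
  shows "induced_map f \<in> linear_maps (quot_module V J) W"
  unfolding linear_maps_def
  by (auto elim!: quot_carrierE simp: induced_map_coset[OF assms] linear_mapsD[OF assms(2)])

end


subsection \<open>Tensor products\<close>

lemma lookup_map_times [simp]:
  "Poly_Mapping.lookup (Poly_Mapping.map ((*) (c :: 'k::field)) u) k = c * Poly_Mapping.lookup u k"
  by (transfer) (simp add: when_def)

lemma keys_map_times_subset: "Poly_Mapping.keys (Poly_Mapping.map ((*) (c :: 'k::field)) u) \<subseteq> Poly_Mapping.keys u"
  by (auto simp: in_keys_iff)

lemma free_module_simps [simp]:
  "carrier (free_module S) = {u. Poly_Mapping.keys u \<subseteq> S}" "zero (free_module S) = 0"
  "add (free_module S) = (+)" "smult (free_module S) c = Poly_Mapping.map ((*) c)"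
  by (simp_all add: free_module_def)

lemma vec_space_free: "vec_space (free_module S :: ('k::field, 'x \<Rightarrow>\<^sub>0 'k) module)"
proof (rule vec_spaceI)
  show "x \<oplus>\<^bsub>free_module S\<^esub> y \<in> carrier (free_module S)"
    if "x \<in> carrier (free_module S)" "y \<in> carrier (free_module S)" for x y :: "'x \<Rightarrow>\<^sub>0 'k"
    using that Poly_Mapping.keys_add[of x y] by auto
  show "c \<odot>\<^bsub>free_module S\<^esub> x \<in> carrier (free_module S)" if "x \<in> carrier (free_module S)" for c and x :: "'x \<Rightarrow>\<^sub>0 'k"
    using that keys_map_times_subset[of c x] by auto
qed (auto intro!: poly_mapping_eqI simp: lookup_add algebra_simps)

definition lin_ext :: "('k::field, 'w, 'z) module_scheme \<Rightarrow> ('x \<Rightarrow> 'w) \<Rightarrow> ('x \<Rightarrow>\<^sub>0 'k) \<Rightarrow> 'w"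
  where "lin_ext W b u = finsum W (\<lambda>k. Poly_Mapping.lookup u k \<odot>\<^bsub>W\<^esub> b k) (Poly_Mapping.keys u)"

context
  fixes W :: "('k::field, 'w, 'z) module_scheme" and S :: "'x set" and b
  assumes W: "vec_space W" and b: "b \<in> S \<rightarrow> carrier W"
begin

interpretation W: vec_space W by (rule W)

text \<open>Enlarging the index set by zero terms allows the sums for two elements and for their sum
  to run over one common set, which gives additivity.\<close>

lemma lin_ext_superset:
  assumes "finite A" "Poly_Mapping.keys u \<subseteq> A" "A \<subseteq> S"
  shows "lin_ext W b u = finsum W (\<lambda>k. Poly_Mapping.lookup u k \<odot>\<^bsub>W\<^esub> b k) A"
  unfolding lin_ext_def
  using assms b by (intro W.M.add.finprod_mono_neutral_cong_left) (auto simp: in_keys_iff Pi_iff)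

lemma lin_ext_linear: "lin_ext W b \<in> linear_maps (free_module S) W"
  unfolding linear_maps_def
proof (intro CollectI conjI ballI allI)
  show "lin_ext W b \<in> carrier (free_module S) \<rightarrow> carrier W"
    using b by (auto simp: lin_ext_def subset_iff Pi_iff intro!: W.M.finsum_closed W.scale_closed)
next
  fix u v :: "'x \<Rightarrow>\<^sub>0 'k" assume uv: "u \<in> carrier (free_module S)" "v \<in> carrier (free_module S)"
  let ?A = "Poly_Mapping.keys u \<union> Poly_Mapping.keys v"
  have A: "finite ?A" "?A \<subseteq> S" using uv by auto
  have bA: "b k \<in> carrier W" if "k \<in> ?A" for k using that A(2) b by auto
  have "lin_ext W b (u + v) = finsum W (\<lambda>k. Poly_Mapping.lookup (u + v) k \<odot>\<^bsub>W\<^esub> b k) ?A"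
    using A Poly_Mapping.keys_add[of u v] by (intro lin_ext_superset) auto
  also have "\<dots> = finsum W (\<lambda>k. Poly_Mapping.lookup u k \<odot>\<^bsub>W\<^esub> b k \<oplus>\<^bsub>W\<^esub> Poly_Mapping.lookup v k \<odot>\<^bsub>W\<^esub> b k) ?A"
    using bA by (intro W.M.finsum_cong') (auto simp: lookup_add W.scale_add)
  also have "\<dots> = lin_ext W b u \<oplus>\<^bsub>W\<^esub> lin_ext W b v"
    using A bA by (subst W.M.finsum_addf) (auto simp: lin_ext_superset[of ?A])
  finally show "lin_ext W b (u \<oplus>\<^bsub>free_module S\<^esub> v) = lin_ext W b u \<oplus>\<^bsub>W\<^esub> lin_ext W b v" by simp
next
  fix c and u :: "'x \<Rightarrow>\<^sub>0 'k" assume u: "u \<in> carrier (free_module S)"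
  have bu: "b k \<in> carrier W" if "k \<in> Poly_Mapping.keys u" for k using that u b by auto
  have "lin_ext W b (Poly_Mapping.map ((*) c) u)
      = finsum W (\<lambda>k. Poly_Mapping.lookup (Poly_Mapping.map ((*) c) u) k \<odot>\<^bsub>W\<^esub> b k) (Poly_Mapping.keys u)"
    using u keys_map_times_subset[of c u] by (intro lin_ext_superset) auto
  also have "\<dots> = finsum W (\<lambda>k. c \<odot>\<^bsub>W\<^esub> (Poly_Mapping.lookup u k \<odot>\<^bsub>W\<^esub> b k)) (Poly_Mapping.keys u)"
    using bu by (intro W.M.finsum_cong') (auto simp: W.scale_scale)
  also have "\<dots> = c \<odot>\<^bsub>W\<^esub> lin_ext W b u"
    unfolding lin_ext_def using bu
    by (intro linear_maps_finsum[OF W W, symmetric])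
      (auto simp: linear_maps_def W.scale_distrib W.scale_scale mult.commute)
  finally show "lin_ext W b (c \<odot>\<^bsub>free_module S\<^esub> u) = c \<odot>\<^bsub>W\<^esub> lin_ext W b u" by simp
qed

lemma lin_ext_single: "k \<in> S \<Longrightarrow> lin_ext W b (Poly_Mapping.single k c) = c \<odot>\<^bsub>W\<^esub> b k"
  using b by (subst lin_ext_superset[of "{k}"]) (auto simp: Pi_iff)

end

lemma keys_diff_subset: "Poly_Mapping.keys (u - v :: 'x \<Rightarrow>\<^sub>0 'k::field) \<subseteq> Poly_Mapping.keys u \<union> Poly_Mapping.keys v"
  by (auto simp: in_keys_iff lookup_minus)

lemma free_module_minus: "u - v = u \<oplus>\<^bsub>free_module S\<^esub> ((- 1) \<odot>\<^bsub>free_module S\<^esub> v)"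
  by (rule poly_mapping_eqI) (simp add: lookup_add lookup_minus)

section \<open>Bilinearity of pure tensors and induction over them\<close>

locale tensor_spaces = P: vec_space P + Q: vec_space Q
  for P :: "('k::field, 'v, 'y) module_scheme" and Q :: "('k, 'w, 'z) module_scheme"
begin

abbreviation "Fr \<equiv> free_module (carrier P \<times> carrier Q) :: ('k, ('v \<times> 'w) \<Rightarrow>\<^sub>0 'k) module"

lemma tensor_relators_subset: "tensor_relators P Q \<subseteq> carrier Fr"
proof -
  have D: "u - v \<in> carrier Fr" if "u \<in> carrier Fr" "v \<in> carrier Fr" for u v
    using that keys_diff_subset[of u v] by auto
  have S: "Poly_Mapping.single (p, q) c \<in> carrier Fr" if "p \<in> carrier P" "q \<in> carrier Q" for p q c
    using that by simp
  show ?thesis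
    unfolding tensor_relators_def by (auto simp del: free_module_simps intro!: D S)
qed

sublocale T: vec_quotient Fr "tensor_ker P Q"
  unfolding vec_quotient_def vec_quotient_axioms_def tensor_ker_def
  using vec_space_free subspace_lin_span[OF vec_space_free tensor_relators_subset] by blast

lemma vec_space_tensor: "vec_space (tensor_module P Q)"
  unfolding tensor_module_def by (rule T.vec_space_quot)

lemma free_minus:
  assumes "u \<in> carrier Fr" "v \<in> carrier Fr"
  shows "u \<ominus>\<^bsub>Fr\<^esub> v = u - v"
  using T.scale_minus_1[OF assms(2)] assms free_module_minus[of u v "carrier P \<times> carrier Q"]
  by (simp add: a_minus_def)

lemma single_in_free: "p \<in> carrier P \<Longrightarrow> q \<in> carrier Q \<Longrightarrow> Poly_Mapping.single (p, q) c \<in> carrier Fr"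
  by simp

lemma pure_in [simp, intro]: "p \<in> carrier P \<Longrightarrow> q \<in> carrier Q \<Longrightarrow> pure_tensor P Q p q \<in> carrier (tensor_module P Q)"
  unfolding pure_tensor_def tensor_module_def by (intro T.coset_in_quot single_in_free)

lemma coset_eqI:
  assumes "u \<in> carrier Fr" "v \<in> carrier Fr" "u - v \<in> tensor_relators P Q"
  shows "tensor_ker P Q +>\<^bsub>Fr\<^esub> u = tensor_ker P Q +>\<^bsub>Fr\<^esub> v"
  unfolding T.coset_eq_iff[OF assms(1,2)] free_minus[OF assms(1,2)]
  using subsetD[OF lin_span_superset assms(3)] by (simp add: tensor_ker_def)

lemma scale_pure_coset:
  assumes "p \<in> carrier P" "q \<in> carrier Q"
  shows "c \<odot>\<^bsub>tensor_module P Q\<^esub> pure_tensor P Q p q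
    = tensor_ker P Q +>\<^bsub>Fr\<^esub> Poly_Mapping.single (p, q) c"
proof -
  have "Poly_Mapping.map ((*) c) (Poly_Mapping.single (p, q) 1) = Poly_Mapping.single (p, q) c"
    by (rule poly_mapping_eqI) (simp add: lookup_single when_def)
  then show ?thesis
    unfolding tensor_module_def pure_tensor_def using assms
    by (subst T.quot_scale) auto
qed

lemma pure_add_left:
  assumes "p \<in> carrier P" "p' \<in> carrier P" "q \<in> carrier Q"
  shows "pure_tensor P Q (p \<oplus>\<^bsub>P\<^esub> p') q = pure_tensor P Q p q \<oplus>\<^bsub>tensor_module P Q\<^esub> pure_tensor P Q p' q"
proof -
  let ?s = "\<lambda>p. Poly_Mapping.single (p, q) (1 :: 'k)"
  have "tensor_ker P Q +>\<^bsub>Fr\<^esub> ?s (p \<oplus>\<^bsub>P\<^esub> p') = tensor_ker P Q +>\<^bsub>Fr\<^esub> (?s p \<oplus>\<^bsub>Fr\<^esub> ?s p')"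
  proof (rule coset_eqI)
    show "?s p \<oplus>\<^bsub>Fr\<^esub> ?s p' \<in> carrier Fr"
      by (intro T.M.a_closed single_in_free assms)
    show "?s (p \<oplus>\<^bsub>P\<^esub> p') - (?s p \<oplus>\<^bsub>Fr\<^esub> ?s p') \<in> tensor_relators P Q"
      unfolding tensor_relators_def using assms by (auto simp: diff_diff_eq[symmetric])
  qed (use assms in auto)
  also have "\<dots> = (tensor_ker P Q +>\<^bsub>Fr\<^esub> ?s p) \<oplus>\<^bsub>tensor_module P Q\<^esub> (tensor_ker P Q +>\<^bsub>Fr\<^esub> ?s p')"
    unfolding tensor_module_def by (intro T.quot_add[symmetric] single_in_free assms)
  finally show ?thesis unfolding pure_tensor_def .
qed

lemma pure_add_right:
  assumes "p \<in> carrier P" "q \<in> carrier Q" "q' \<in> carrier Q"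
  shows "pure_tensor P Q p (q \<oplus>\<^bsub>Q\<^esub> q') = pure_tensor P Q p q \<oplus>\<^bsub>tensor_module P Q\<^esub> pure_tensor P Q p q'"
proof -
  let ?s = "\<lambda>q. Poly_Mapping.single (p, q) (1 :: 'k)"
  have "tensor_ker P Q +>\<^bsub>Fr\<^esub> ?s (q \<oplus>\<^bsub>Q\<^esub> q') = tensor_ker P Q +>\<^bsub>Fr\<^esub> (?s q \<oplus>\<^bsub>Fr\<^esub> ?s q')"
  proof (rule coset_eqI)
    show "?s q \<oplus>\<^bsub>Fr\<^esub> ?s q' \<in> carrier Fr"
      by (intro T.M.a_closed single_in_free assms)
    show "?s (q \<oplus>\<^bsub>Q\<^esub> q') - (?s q \<oplus>\<^bsub>Fr\<^esub> ?s q') \<in> tensor_relators P Q"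
      unfolding tensor_relators_def using assms by (auto simp: diff_diff_eq[symmetric])
  qed (use assms in auto)
  also have "\<dots> = (tensor_ker P Q +>\<^bsub>Fr\<^esub> ?s q) \<oplus>\<^bsub>tensor_module P Q\<^esub> (tensor_ker P Q +>\<^bsub>Fr\<^esub> ?s q')"
    unfolding tensor_module_def by (intro T.quot_add[symmetric] single_in_free assms)
  finally show ?thesis unfolding pure_tensor_def .
qed

lemma pure_scale_left:
  assumes "p \<in> carrier P" "q \<in> carrier Q"
  shows "pure_tensor P Q (c \<odot>\<^bsub>P\<^esub> p) q = c \<odot>\<^bsub>tensor_module P Q\<^esub> pure_tensor P Q p q"
  unfolding scale_pure_coset[OF assms] unfolding pure_tensor_def
  by (rule coset_eqI) (use assms in \<open>auto simp: tensor_relators_def\<close>)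

lemma pure_scale_right:
  assumes "p \<in> carrier P" "q \<in> carrier Q"
  shows "pure_tensor P Q p (c \<odot>\<^bsub>Q\<^esub> q) = c \<odot>\<^bsub>tensor_module P Q\<^esub> pure_tensor P Q p q"
  unfolding scale_pure_coset[OF assms] unfolding pure_tensor_def
  by (rule coset_eqI) (use assms in \<open>auto simp: tensor_relators_def\<close>)

text \<open>Sums of pure tensors exhaust the tensor product, because a scalar can be absorbed into
  the left factor; hence there is no case for scaling. The proof removes one key of a representative
  at a time.\<close>

lemma tensor_induct [consumes 1, case_names pure add]:
  assumes z: "z \<in> carrier (tensor_module P Q)"
    and pure: "\<And>p q. p \<in> carrier P \<Longrightarrow> q \<in> carrier Q \<Longrightarrow> A (pure_tensor P Q p q)"
    and add: "\<And>x y. x \<in> carrier (tensor_module P Q) \<Longrightarrow> y \<in> carrier (tensor_module P Q) \<Longrightarrow>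
      A x \<Longrightarrow> A y \<Longrightarrow> A (x \<oplus>\<^bsub>tensor_module P Q\<^esub> y)"
  shows "A z"
proof -
  let ?c = "\<lambda>u. tensor_ker P Q +>\<^bsub>Fr\<^esub> u"
  have single: "A (?c (Poly_Mapping.single (p, q) c))" if "p \<in> carrier P" "q \<in> carrier Q" for p q c
    using pure[of "c \<odot>\<^bsub>P\<^esub> p" q] that
    by (simp add: pure_scale_left scale_pure_coset)
  have "A (?c u)" if "u \<in> carrier Fr" for u
    using that
  proof (induction "card (Poly_Mapping.keys u)" arbitrary: u)
    case 0
    \<comment> \<open>The empty combination is written as a multiple of the zero pair, so that this
      case is also one of a pure tensor.\<close>
    then have "u = Poly_Mapping.single (\<zero>\<^bsub>P\<^esub>, \<zero>\<^bsub>Q\<^esub>) 0" by simp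
    then show ?case using single[of "\<zero>\<^bsub>P\<^esub>" "\<zero>\<^bsub>Q\<^esub>" 0] by simp
  next
    case (Suc n)
    then obtain p q where k: "(p, q) \<in> Poly_Mapping.keys u"
      by (metis card.empty ex_in_conv nat.distinct(1) old.prod.exhaust)
    then have pq: "p \<in> carrier P" "q \<in> carrier Q" using Suc.prems by auto
    define s where "s = Poly_Mapping.single (p, q) (Poly_Mapping.lookup u (p, q))"
    have keys: "Poly_Mapping.keys (u - s) = Poly_Mapping.keys u - {(p, q)}"
      by (auto simp: s_def in_keys_iff lookup_minus lookup_single when_def split: if_splits)
    have in_F: "u - s \<in> carrier Fr" "s \<in> carrier Fr"
      using keys Suc.prems pq by (auto simp: s_def)
    have "A (?c (u - s))"
      using Suc.hyps(1)[of "u - s"] Suc.hyps(2) in_F k by (simp add: keys)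
    then have "A (?c (u - s) \<oplus>\<^bsub>tensor_module P Q\<^esub> ?c s)"
      using in_F single[OF pq] by (intro add) (auto simp: tensor_module_def s_def)
    moreover have "?c (u - s) \<oplus>\<^bsub>tensor_module P Q\<^esub> ?c s = ?c u"
      unfolding tensor_module_def using T.quot_add[OF in_F] by simp
    ultimately show ?case by simp
  qed
  then show ?thesis
    using z T.quot_carrierE unfolding tensor_module_def by metis
qed

end

section \<open>The universal property of the tensor product\<close>

definition tensor_lift :: "('k::field, 'u, 'z) module_scheme \<Rightarrow> ('v \<Rightarrow> 'w \<Rightarrow> 'u)
    \<Rightarrow> (('v \<times> 'w) \<Rightarrow>\<^sub>0 'k) set \<Rightarrow> 'u"
  where "tensor_lift W b = induced_map (lin_ext W (case_prod b))"

locale bilinear_map = tensor_spaces P Q + W: vec_space W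
  for P :: "('k::field, 'v, 'y) module_scheme" and Q :: "('k, 'w, 'z) module_scheme"
    and W :: "('k, 'u, 'x) module_scheme" +
  fixes b
  assumes b_closed: "p \<in> carrier P \<Longrightarrow> q \<in> carrier Q \<Longrightarrow> b p q \<in> carrier W"
    and b_add_left: "p \<in> carrier P \<Longrightarrow> p' \<in> carrier P \<Longrightarrow> q \<in> carrier Q \<Longrightarrow>
      b (p \<oplus>\<^bsub>P\<^esub> p') q = b p q \<oplus>\<^bsub>W\<^esub> b p' q"
    and b_add_right: "p \<in> carrier P \<Longrightarrow> q \<in> carrier Q \<Longrightarrow> q' \<in> carrier Q \<Longrightarrow>
      b p (q \<oplus>\<^bsub>Q\<^esub> q') = b p q \<oplus>\<^bsub>W\<^esub> b p q'"
    and b_scale_left: "p \<in> carrier P \<Longrightarrow> q \<in> carrier Q \<Longrightarrow> b (c \<odot>\<^bsub>P\<^esub> p) q = c \<odot>\<^bsub>W\<^esub> b p q"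
    and b_scale_right: "p \<in> carrier P \<Longrightarrow> q \<in> carrier Q \<Longrightarrow> b p (c \<odot>\<^bsub>Q\<^esub> q) = c \<odot>\<^bsub>W\<^esub> b p q"
begin

abbreviation "ext \<equiv> lin_ext W (case_prod b)"

lemma b_Pi: "case_prod b \<in> carrier P \<times> carrier Q \<rightarrow> carrier W"
  using b_closed by auto

lemma ext_linear: "ext \<in> linear_maps Fr W"
  using lin_ext_linear[OF W.vec_space_axioms b_Pi] .

lemma ext_single: "p \<in> carrier P \<Longrightarrow> q \<in> carrier Q \<Longrightarrow> ext (Poly_Mapping.single (p, q) c) = c \<odot>\<^bsub>W\<^esub> b p q"
  using lin_ext_single[OF W.vec_space_axioms b_Pi, of "(p, q)" c] by simp

lemma ext_minus:
  assumes "u \<in> carrier Fr" "v \<in> carrier Fr"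
  shows "ext (u - v) = ext u \<ominus>\<^bsub>W\<^esub> ext v"
proof -
  have "ext (u - v) = ext u \<oplus>\<^bsub>W\<^esub> (- 1) \<odot>\<^bsub>W\<^esub> ext v"
    unfolding free_module_minus[of u v "carrier P \<times> carrier Q"]
    using linear_mapsD(2,3)[OF ext_linear] assms T.scale_closed by metis
  then show ?thesis
    using W.scale_minus_1 linear_mapsD(1)[OF ext_linear] assms by (simp add: a_minus_def)
qed

lemma ext_ker:
  assumes "u \<in> tensor_ker P Q"
  shows "ext u = \<zero>\<^bsub>W\<^esub>"
proof -
  have D: "u - v \<in> carrier Fr" if "u \<in> carrier Fr" "v \<in> carrier Fr" for u v
    using that keys_diff_subset[of u v] by auto
  \<comment> \<open>This is the normal form that the two additivity relators take after
    \<open>ext\<close> has been applied and the terms have been reassociated.\<close>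
  have cancel: "x \<oplus>\<^bsub>W\<^esub> (y \<oplus>\<^bsub>W\<^esub> (\<ominus>\<^bsub>W\<^esub> x \<oplus>\<^bsub>W\<^esub> \<ominus>\<^bsub>W\<^esub> y)) = \<zero>\<^bsub>W\<^esub>"
    if "x \<in> carrier W" "y \<in> carrier W" for x y
    using that W.M.r_neg[of "x \<oplus>\<^bsub>W\<^esub> y"] W.M.a_assoc[of x y "\<ominus>\<^bsub>W\<^esub> (x \<oplus>\<^bsub>W\<^esub> y)"] W.M.minus_add[of x y]
    by simp
  have "ext u = \<zero>\<^bsub>W\<^esub>" if "u \<in> tensor_relators P Q" for u
    using that unfolding tensor_relators_def
    by (auto simp: ext_minus single_in_free ext_single D b_closed b_add_left b_add_right b_scale_left
        b_scale_right W.M.minus_eq W.M.a_assoc W.M.r_neg cancel simp del: free_module_simps)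
  then have "tensor_relators P Q \<subseteq> {u \<in> carrier Fr. ext u = \<zero>\<^bsub>W\<^esub>}"
    using tensor_relators_subset by blast
  then have "tensor_ker P Q \<subseteq> {u \<in> carrier Fr. ext u = \<zero>\<^bsub>W\<^esub>}"
    unfolding tensor_ker_def
    by (rule lin_span_minimal) (rule subspace_kernel[OF vec_space_free W.vec_space_axioms ext_linear])
  then show ?thesis using assms by blast
qed

lemma lift_linear: "tensor_lift W b \<in> linear_maps (tensor_module P Q) W"
  unfolding tensor_lift_def tensor_module_def
  by (rule T.induced_map_linear[OF W.vec_space_axioms ext_linear ext_ker])

lemma lift_pure: "p \<in> carrier P \<Longrightarrow> q \<in> carrier Q \<Longrightarrow> tensor_lift W b (pure_tensor P Q p q) = b p q"
  unfolding tensor_lift_def pure_tensor_def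
  using T.induced_map_coset[OF W.vec_space_axioms ext_linear ext_ker single_in_free] ext_single
  by (simp add: b_closed)

lemma ext_eq_lift:
  assumes "Z \<in> carrier (tensor_module P Q)" "u \<in> Z"
  shows "ext u = tensor_lift W b Z"
  using assms(1) unfolding tensor_module_def tensor_lift_def
proof (rule T.quot_carrierE)
  fix v assume "v \<in> carrier Fr" "Z = tensor_ker P Q +>\<^bsub>Fr\<^esub> v"
  then show "ext u = induced_map ext Z"
    using T.induced_map_image[OF W.vec_space_axioms ext_linear ext_ker, of v u]
      T.induced_map_coset[OF W.vec_space_axioms ext_linear ext_ker, of v] assms(2) by simp
qed

lemma carrier_nonempty: "Z \<in> carrier (tensor_module P Q) \<Longrightarrow> Z \<noteq> {} \<and> Z \<subseteq> carrier Fr"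
  unfolding tensor_module_def
  using T.J.a_rcos_self T.J.a_elemrcos_carrier by (elim T.quot_carrierE) blast

text \<open>As \<open>f\<close> is only assumed to map the carrier of \<open>P\<close> into itself,
  \<open>tensor_op P Q f Z\<close> is not known to be a coset here. It is described instead as a
  nonempty set of representatives on which \<open>ext\<close> takes one value, which suffices to
  evaluate a lift.\<close>

lemma ext_tensor_op:
  assumes Z: "Z \<in> carrier (tensor_module P Q)"
    and f: "\<And>p. p \<in> carrier P \<Longrightarrow> f p \<in> carrier P"
    and g: "g \<in> linear_maps W W"
    and fg: "\<And>p q. p \<in> carrier P \<Longrightarrow> q \<in> carrier Q \<Longrightarrow> b (f p) q = g (b p q)"
  shows "tensor_op P Q f Z \<noteq> {}" "tensor_op P Q f Z \<subseteq> carrier Fr"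
    and "v \<in> tensor_op P Q f Z \<Longrightarrow> ext v = g (tensor_lift W b Z)"
proof -
  let ?op = "\<lambda>u. \<Sum>(p, q)\<in>Poly_Mapping.keys u. Poly_Mapping.single (f p, q) (Poly_Mapping.lookup u (p, q))"
  have op: "?op u \<in> carrier Fr \<and> ext (?op u) = g (ext u)" if u: "u \<in> carrier Fr" for u
  proof -
    have k: "p \<in> carrier P" "q \<in> carrier Q" if "(p, q) \<in> Poly_Mapping.keys u" for p q
      using that u by auto
    have sum: "(\<Sum>k\<in>A. h k) \<in> carrier Fr \<and> ext (\<Sum>k\<in>A. h k) = finsum W (\<lambda>k. ext (h k)) A"
      if "finite A" "\<And>k. k \<in> A \<Longrightarrow> h k \<in> carrier Fr" for A h
      using that
    proof (induction A rule: finite_induct)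
      case empty
      then show ?case
        using linear_maps_zero[OF vec_space_free W.vec_space_axioms ext_linear] by simp
    next
      case (insert a A)
      then have "h a \<in> carrier Fr" "(\<Sum>k\<in>A. h k) \<in> carrier Fr" by auto
      then show ?case
        using insert linear_mapsD(1,2)[OF ext_linear] T.M.a_closed[of "h a" "\<Sum>k\<in>A. h k"]
        by (simp add: W.M.finsum_insert Pi_def)
    qed
    let ?h = "\<lambda>(p, q). Poly_Mapping.single (f p, q) (Poly_Mapping.lookup u (p, q))"
    have "?op u \<in> carrier Fr \<and> ext (?op u) = finsum W (\<lambda>k. ext (?h k)) (Poly_Mapping.keys u)"
      by (rule sum) (auto intro!: single_in_free k f simp del: free_module_simps)
    moreover have "finsum W (\<lambda>k. ext (?h k)) (Poly_Mapping.keys u)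
        = finsum W (\<lambda>k. g (Poly_Mapping.lookup u k \<odot>\<^bsub>W\<^esub> case_prod b k)) (Poly_Mapping.keys u)"
      using k f fg linear_mapsD(1,3)[OF g] b_closed
      by (intro W.M.finsum_cong') (auto simp: ext_single)
    moreover have "\<dots> = g (ext u)"
      unfolding lin_ext_def using k b_closed
      by (intro linear_maps_finsum[OF W.vec_space_axioms W.vec_space_axioms g, symmetric]) auto
    ultimately show ?thesis by simp
  qed
  show "ext v = g (tensor_lift W b Z)" if v: "v \<in> tensor_op P Q f Z"
  proof -
    obtain h u where hu: "h \<in> tensor_ker P Q" "u \<in> Z" "v = h \<oplus>\<^bsub>Fr\<^esub> ?op u"
      using v unfolding tensor_op_def quot_op_def set_add_def' by blast
    then have uh: "u \<in> carrier Fr" "h \<in> carrier Fr"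
      using carrier_nonempty[OF Z] subspace_ofD(1)[OF T.subspace_J] by blast+
    have "ext v = ext h \<oplus>\<^bsub>W\<^esub> g (ext u)"
      unfolding hu(3) using linear_mapsD(2)[OF ext_linear uh(2) conjunct1[OF op[OF uh(1)]]] op[OF uh(1)]
      by (simp only:)
    then show ?thesis
      using ext_ker[OF hu(1)] ext_eq_lift[OF Z hu(2)] linear_mapsD(1)[OF g] linear_mapsD(1)[OF lift_linear Z]
      by simp
  qed
  show "tensor_op P Q f Z \<noteq> {}"
    using carrier_nonempty[OF Z] subspace_ofD(2)[OF T.subspace_J]
    unfolding tensor_op_def quot_op_def set_add_def' by blast
  show "tensor_op P Q f Z \<subseteq> carrier Fr"
  proof
    fix v assume "v \<in> tensor_op P Q f Z"
    then obtain h u where hu: "h \<in> tensor_ker P Q" "u \<in> Z" "v = h \<oplus>\<^bsub>Fr\<^esub> ?op u"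
      unfolding tensor_op_def quot_op_def set_add_def' by blast
    then have uh: "u \<in> carrier Fr" "h \<in> carrier Fr"
      using carrier_nonempty[OF Z] subspace_ofD(1)[OF T.subspace_J] by blast+
    show "v \<in> carrier Fr"
      unfolding hu(3) by (rule T.M.a_closed[OF uh(2) conjunct1[OF op[OF uh(1)]]])
  qed
qed

end


section \<open>Bounded sets in locally convex spaces\<close>

lemma mk_lc_module_simps [simp]:
  "carrier (mk_lc_module V T ac) = carrier V" "zero (mk_lc_module V T ac) = zero V"
  "add (mk_lc_module V T ac) = add V" "smult (mk_lc_module V T ac) = smult V"
  "topol (mk_lc_module V T ac) = T" "act (mk_lc_module V T ac) = ac"
  by (simp_all add: mk_lc_module_def module.defs lc_module.defs)

lemma (in vec_space) vec_space_transfer: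
  fixes U :: "('k, 'v, 'y) module_scheme"
  assumes "carrier U = carrier V" "zero U = zero V" "add U = add V" "smult U = smult V"
  shows "vec_space U"
  by (rule vec_spaceI) (auto simp: assms M.a_assoc scale_distrib scale_add scale_scale intro: M.a_comm)

lemma vec_space_mk_lc_module: "vec_space V \<Longrightarrow> vec_space (mk_lc_module V T ac)"
  by (rule vec_space.vec_space_transfer[of V]) simp_all

lemma von_neumann_bounded_mk_lc_module [simp]:
  "von_neumann_bounded (mk_lc_module V T ac) = von_neumann_bounded V"
  by (intro ext) (simp add: von_neumann_bounded_def)

text \<open>Shrinking \<open>B\<close> replaces enlarging \<open>U\<close>. The new form is
  compatible with linear maps and their preimages; the two agree because \<open>r > 0\<close>
  excludes the scalar 0.\<close>

lemma von_neumann_bounded_iff: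
  fixes V :: "('k::real_or_complex, 'v, 'z) module_scheme"
  assumes "vec_space V" "topspace T \<subseteq> carrier V"
  shows "von_neumann_bounded V T B \<longleftrightarrow> B \<subseteq> carrier V \<and>
    (\<forall>U. openin T U \<and> \<zero>\<^bsub>V\<^esub> \<in> U \<longrightarrow>
      (\<exists>r>0. \<forall>c. norm c \<ge> r \<longrightarrow> (\<forall>x\<in>B. inverse c \<odot>\<^bsub>V\<^esub> x \<in> U)))"
proof -
  interpret V: vec_space V by fact
  have *: "B \<subseteq> smult V c ` U \<longleftrightarrow> (\<forall>x\<in>B. inverse c \<odot>\<^bsub>V\<^esub> x \<in> U)"
    if c: "c \<noteq> 0" and B: "B \<subseteq> carrier V" and U: "U \<subseteq> carrier V" for c U
  proof
    assume L: "B \<subseteq> smult V c ` U"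
    show "\<forall>x\<in>B. inverse c \<odot>\<^bsub>V\<^esub> x \<in> U"
    proof
      fix x assume "x \<in> B"
      then obtain u where "u \<in> U" "x = c \<odot>\<^bsub>V\<^esub> u" using L by blast
      then show "inverse c \<odot>\<^bsub>V\<^esub> x \<in> U" using V.scale_inverse(2)[OF c, of u] U by auto
    qed
  next
    assume R: "\<forall>x\<in>B. inverse c \<odot>\<^bsub>V\<^esub> x \<in> U"
    show "B \<subseteq> smult V c ` U"
    proof
      fix x assume "x \<in> B"
      then show "x \<in> smult V c ` U"
        using R B V.scale_inverse(1)[OF c, of x] by (metis image_eqI subsetD)
    qed
  qed
  have "(\<exists>r>0. \<forall>c. norm c \<ge> r \<longrightarrow> B \<subseteq> smult V c ` U) \<longleftrightarrow>
      (\<exists>r>0. \<forall>c. norm c \<ge> r \<longrightarrow> (\<forall>x\<in>B. inverse c \<odot>\<^bsub>V\<^esub> x \<in> U))"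
    if BU: "B \<subseteq> carrier V" "openin T U" for U
  proof -
    have U: "U \<subseteq> carrier V"
      using openin_subset[OF BU(2)] assms(2) by blast
    have "B \<subseteq> smult V c ` U \<longleftrightarrow> (\<forall>x\<in>B. inverse c \<odot>\<^bsub>V\<^esub> x \<in> U)" if "norm c \<ge> r" "r > 0" for c r
    proof -
      have "c \<noteq> 0" using that by auto
      then show ?thesis by (rule *[OF _ BU(1) U])
    qed
    then show ?thesis by (simp cong: conj_cong imp_cong)
  qed
  then show ?thesis
    unfolding von_neumann_bounded_def by (simp cong: conj_cong imp_cong)
qed

lemma von_neumann_boundedE:
  fixes V :: "('k::real_or_complex, 'v, 'z) module_scheme"
  assumes "vec_space V" "topspace T \<subseteq> carrier V" "von_neumann_bounded V T B"
    and U: "openin T U" "\<zero>\<^bsub>V\<^esub> \<in> U"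
  obtains r where "r > 0" "\<And>c x. norm c \<ge> r \<Longrightarrow> x \<in> B \<Longrightarrow> inverse c \<odot>\<^bsub>V\<^esub> x \<in> U"
proof -
  have "\<exists>r>0. \<forall>c. norm c \<ge> r \<longrightarrow> (\<forall>x\<in>B. inverse c \<odot>\<^bsub>V\<^esub> x \<in> U)"
    using iffD1[OF von_neumann_bounded_iff[OF assms(1,2)] assms(3)] U by (elim conjE allE impE) simp_all
  then show thesis
    using that by (elim exE conjE) blast
qed

lemma locally_convex_topspace: "locally_convex_topology V T \<Longrightarrow> topspace T = carrier V"
  by (simp add: locally_convex_topology_def)

lemma locally_convexD:
  fixes V :: "('k::real_or_complex, 'v, 'z) module_scheme"
  assumes "locally_convex_topology V T"
  shows "continuous_map (prod_topology T T) T (\<lambda>(x, y). x \<oplus>\<^bsub>V\<^esub> y)"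
    and "continuous_map (prod_topology (euclidean :: 'k topology) T) T (\<lambda>(c, x). c \<odot>\<^bsub>V\<^esub> x)"
    and "openin T U \<Longrightarrow> \<zero>\<^bsub>V\<^esub> \<in> U \<Longrightarrow> (\<exists>G\<subseteq>U. openin T G \<and> \<zero>\<^bsub>V\<^esub> \<in> G \<and>
      (\<forall>x\<in>G. \<forall>y\<in>G. \<forall>t\<in>{0..1}. (of_real t \<odot>\<^bsub>V\<^esub> x) \<oplus>\<^bsub>V\<^esub> (of_real (1 - t) \<odot>\<^bsub>V\<^esub> y) \<in> G))"
  using assms unfolding locally_convex_topology_def by simp_all

section \<open>Boundedness in suprema of locally convex topologies\<close>

lemma topspace_finest_subset: "topspace (finest_locally_convex V Q) \<subseteq> carrier V"
  unfolding finest_locally_convex_def topology_generated_by_topspace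
  using locally_convex_topspace openin_subset by blast

lemma openin_finest:
  "locally_convex_topology V T \<Longrightarrow> Q T \<Longrightarrow> openin T U \<Longrightarrow> openin (finest_locally_convex V Q) U"
  unfolding finest_locally_convex_def by (intro topology_generated_by_Basis) blast

text \<open>Absorption of \<open>B\<close> passes from subbasic sets to finite intersections, by
  taking the larger radius, and to unions. So boundedness in the supremum can be tested in the
  members, whatever the property \<open>Q\<close> is.\<close>

lemma bounded_finest_iff:
  fixes V :: "('k::real_or_complex, 'v, 'z) module_scheme"
  assumes "vec_space V" "B \<subseteq> carrier V"
  shows "von_neumann_bounded V (finest_locally_convex V Q) B \<longleftrightarrow>
    (\<forall>T. locally_convex_topology V T \<and> Q T \<longrightarrow> von_neumann_bounded V T B)"
proof (intro iffI allI impI)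
  fix T assume "von_neumann_bounded V (finest_locally_convex V Q) B" "locally_convex_topology V T \<and> Q T"
  then show "von_neumann_bounded V T B"
    using openin_finest[of V T Q] unfolding von_neumann_bounded_def by blast
next
  assume A: "\<forall>T. locally_convex_topology V T \<and> Q T \<longrightarrow> von_neumann_bounded V T B"
  have "\<exists>r>0. \<forall>c. norm c \<ge> r \<longrightarrow> (\<forall>x\<in>B. inverse c \<odot>\<^bsub>V\<^esub> x \<in> U)"
    if "generate_topology_on {U. \<exists>T. locally_convex_topology V T \<and> Q T \<and> openin T U} U" "\<zero>\<^bsub>V\<^esub> \<in> U" for U
    using that
  proof induction
    case (Int U1 U2)
    then obtain r1 r2 where "r1 > 0" "\<forall>c. norm c \<ge> r1 \<longrightarrow> (\<forall>x\<in>B. inverse c \<odot>\<^bsub>V\<^esub> x \<in> U1)"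
      "r2 > 0" "\<forall>c. norm c \<ge> r2 \<longrightarrow> (\<forall>x\<in>B. inverse c \<odot>\<^bsub>V\<^esub> x \<in> U2)"
      by auto
    then show ?case
      by (intro exI[of _ "max r1 r2"]) auto
  next
    case (Basis U)
    then obtain T where "locally_convex_topology V T" "Q T" "openin T U" by blast
    then show ?case
      using A Basis von_neumann_bounded_iff[OF assms(1), of T B] locally_convex_topspace[of V T] by blast
  qed blast+
  then show "von_neumann_bounded V (finest_locally_convex V Q) B"
    using assms(2) von_neumann_bounded_iff[OF assms(1) topspace_finest_subset, of Q B]
    by (simp add: finest_locally_convex_def openin_topology_generated_by_iff)
qed

lemma bounded_subset: "von_neumann_bounded V T B \<Longrightarrow> C \<subseteq> B \<Longrightarrow> von_neumann_bounded V T C"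
  unfolding von_neumann_bounded_def by (meson order_trans)

lemma bounded_sum:
  fixes V :: "('k::real_or_complex, 'v, 'z) module_scheme"
  assumes "vec_space V" "locally_convex_topology V T"
    and "von_neumann_bounded V T B" "von_neumann_bounded V T C"
  shows "von_neumann_bounded V T {x \<oplus>\<^bsub>V\<^esub> y | x y. x \<in> B \<and> y \<in> C}"
proof -
  interpret V: vec_space V by fact
  note top = locally_convex_topspace[OF assms(2)]
  note iff = von_neumann_bounded_iff[OF assms(1), of T, unfolded top, OF order_refl]
  have BC: "B \<subseteq> carrier V" "C \<subseteq> carrier V"
    using assms(3,4) iff by auto
  have "\<exists>r>0. \<forall>c. norm c \<ge> r \<longrightarrow> (\<forall>z\<in>{x \<oplus>\<^bsub>V\<^esub> y | x y. x \<in> B \<and> y \<in> C}. inverse c \<odot>\<^bsub>V\<^esub> z \<in> U)"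
    if U: "openin T U" "\<zero>\<^bsub>V\<^esub> \<in> U" for U
  proof -
    define S where "S = {z \<in> topspace (prod_topology T T). (case z of (x, y) \<Rightarrow> x \<oplus>\<^bsub>V\<^esub> y) \<in> U}"
    have S: "openin (prod_topology T T) S"
      unfolding S_def by (rule openin_continuous_map_preimage[OF locally_convexD(1)[OF assms(2)] U(1)])
    have 0: "(\<zero>\<^bsub>V\<^esub>, \<zero>\<^bsub>V\<^esub>) \<in> S"
      using U(2) by (simp add: S_def top)
    obtain U1 U2 where W: "openin T U1" "openin T U2" "\<zero>\<^bsub>V\<^esub> \<in> U1" "\<zero>\<^bsub>V\<^esub> \<in> U2" "U1 \<times> U2 \<subseteq> S"
      using S[unfolded openin_prod_topology_alt, rule_format, OF 0] by blast
    obtain r1 where r1: "r1 > 0" "\<And>c x. norm c \<ge> r1 \<Longrightarrow> x \<in> B \<Longrightarrow> inverse c \<odot>\<^bsub>V\<^esub> x \<in> U1"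
      by (rule von_neumann_boundedE[OF assms(1) equalityD1[OF top] assms(3) W(1,3)]) (erule that)
    obtain r2 where r2: "r2 > 0" "\<And>c x. norm c \<ge> r2 \<Longrightarrow> x \<in> C \<Longrightarrow> inverse c \<odot>\<^bsub>V\<^esub> x \<in> U2"
      by (rule von_neumann_boundedE[OF assms(1) equalityD1[OF top] assms(4) W(2,4)]) (erule that)
    have "inverse c \<odot>\<^bsub>V\<^esub> (x \<oplus>\<^bsub>V\<^esub> y) \<in> U" if "norm c \<ge> max r1 r2" "x \<in> B" "y \<in> C" for c x y
    proof -
      have "(inverse c \<odot>\<^bsub>V\<^esub> x, inverse c \<odot>\<^bsub>V\<^esub> y) \<in> S"
        using r1(2)[of c x] r2(2)[of c y] that W(5) by auto
      then have "inverse c \<odot>\<^bsub>V\<^esub> x \<oplus>\<^bsub>V\<^esub> inverse c \<odot>\<^bsub>V\<^esub> y \<in> U"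
        by (simp add: S_def)
      then show ?thesis
        using that BC V.scale_distrib[of x y] by (simp add: subset_iff)
    qed
    then show ?thesis
      using r1(1) by (intro exI[of _ "max r1 r2"]) auto
  qed
  then show ?thesis
    unfolding iff using BC by auto
qed

lemma bounded_zero:
  assumes "vec_space V" "topspace T \<subseteq> carrier V"
  shows "von_neumann_bounded V T {\<zero>\<^bsub>V\<^esub>}"
proof -
  interpret V: vec_space V by fact
  show ?thesis
    unfolding von_neumann_bounded_iff[OF assms] by (auto intro!: exI[of _ 1])
qed

lemma bounded_finsum:
  fixes V :: "('k::real_or_complex, 'v, 'z) module_scheme"
  assumes "vec_space V" "locally_convex_topology V T" "finite I"
    and "\<And>i. i \<in> I \<Longrightarrow> von_neumann_bounded V T (g i ` D)"
  shows "von_neumann_bounded V T ((\<lambda>u. finsum V (\<lambda>i. g i u) I) ` D)"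
  using assms(3,4)
proof (induction I rule: finite_induct)
  case empty
  interpret V: vec_space V by fact
  have "von_neumann_bounded V T {\<zero>\<^bsub>V\<^esub>}"
    using bounded_zero assms(1,2) locally_convex_topspace by blast
  then show ?case
    by (rule bounded_subset) auto
next
  case (insert a I)
  interpret V: vec_space V by fact
  have g: "g i u \<in> carrier V" if "i \<in> insert a I" "u \<in> D" for i u
    using insert.prems[OF that(1)] that(2) unfolding von_neumann_bounded_def by blast
  have "(\<lambda>u. finsum V (\<lambda>i. g i u) (insert a I)) ` D
      \<subseteq> {x \<oplus>\<^bsub>V\<^esub> y | x y. x \<in> g a ` D \<and> y \<in> (\<lambda>u. finsum V (\<lambda>i. g i u) I) ` D}"
    using g insert.hyps by (auto simp: V.M.finsum_insert Pi_def)
  then show ?case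
    using bounded_subset[OF bounded_sum[OF assms(1,2)]] insert by blast
qed

text \<open>Supplies members of the family whose supremum is the tensor topology: topologies on the
  target are pulled back along the lift in \<open>openin_beta_pullback\<close>.\<close>

lemma continuous_locally_convex_pullback:
  fixes V :: "('k::real_or_complex, 'v, 'z) module_scheme"
  assumes "vec_space V" "vec_space W" "f \<in> linear_maps V W" "locally_convex_topology W T"
  shows "locally_convex_topology V (pullback_topology (carrier V) f T)"
proof -
  interpret V: vec_space V by fact
  interpret W: vec_space W by fact
  let ?S = "pullback_topology (carrier V) f T"
  note f = linear_mapsD[OF assms(3)]
  note T = locally_convexD[OF assms(4)]
  have top: "topspace ?S = carrier V"
    unfolding topspace_pullback_topology locally_convex_topspace[OF assms(4)] using f(1) by auto
  have cf: "continuous_map ?S T f"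
    using continuous_map_pullback[OF continuous_map_id, of "carrier V" f T] by (simp add: comp_def)
  have add: "continuous_map (prod_topology ?S ?S) ?S (\<lambda>(x, y). x \<oplus>\<^bsub>V\<^esub> y)"
  proof (rule continuous_map_pullback')
    have "continuous_map (prod_topology ?S ?S) (prod_topology T T) (\<lambda>(x, y). (f x, f y))"
      by (simp add: continuous_map_prod_top cf)
    then have "continuous_map (prod_topology ?S ?S) T ((\<lambda>(x, y). x \<oplus>\<^bsub>W\<^esub> y) \<circ> (\<lambda>(x, y). (f x, f y)))"
      by (rule continuous_map_compose) (rule T(1))
    then show "continuous_map (prod_topology ?S ?S) T (f \<circ> (\<lambda>(x, y). x \<oplus>\<^bsub>V\<^esub> y))"
      by (rule continuous_map_eq) (auto simp: top f(2))
  qed (auto simp: top)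
  have scale: "continuous_map (prod_topology (euclidean :: 'k topology) ?S) ?S (\<lambda>(c, x). c \<odot>\<^bsub>V\<^esub> x)"
  proof (rule continuous_map_pullback')
    have "continuous_map (prod_topology (euclidean :: 'k topology) ?S) (prod_topology euclidean T) (\<lambda>(c, x). (c, f x))"
      using cf continuous_map_prod_top[of euclidean ?S euclidean T "\<lambda>x. x" f] by simp
    then have "continuous_map (prod_topology (euclidean :: 'k topology) ?S) T
        ((\<lambda>(c, x). c \<odot>\<^bsub>W\<^esub> x) \<circ> (\<lambda>(c, x). (c, f x)))"
      by (rule continuous_map_compose) (rule T(2))
    then show "continuous_map (prod_topology (euclidean :: 'k topology) ?S) T (f \<circ> (\<lambda>(c, x). c \<odot>\<^bsub>V\<^esub> x))"
      by (rule continuous_map_eq) (auto simp: top f(3))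
  qed (auto simp: top)
  have convex: "\<exists>G\<subseteq>U. openin ?S G \<and> \<zero>\<^bsub>V\<^esub> \<in> G \<and>
      (\<forall>x\<in>G. \<forall>y\<in>G. \<forall>t\<in>{0..1}. (of_real t \<odot>\<^bsub>V\<^esub> x) \<oplus>\<^bsub>V\<^esub> (of_real (1 - t) \<odot>\<^bsub>V\<^esub> y) \<in> G)"
    if U: "openin ?S U" "\<zero>\<^bsub>V\<^esub> \<in> U" for U
  proof -
    obtain U' where U': "openin T U'" "U = f -` U' \<inter> carrier V"
      using U(1) unfolding openin_pullback_topology by blast
    then have "\<zero>\<^bsub>W\<^esub> \<in> U'"
      using U(2) linear_maps_zero[OF assms(1-3)] by simp
    then obtain G where G: "G \<subseteq> U'" "openin T G" "\<zero>\<^bsub>W\<^esub> \<in> G"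
      "\<forall>x\<in>G. \<forall>y\<in>G. \<forall>t\<in>{0..1}. (of_real t \<odot>\<^bsub>W\<^esub> x) \<oplus>\<^bsub>W\<^esub> (of_real (1 - t) \<odot>\<^bsub>W\<^esub> y) \<in> G"
      using T(3)[OF U'(1)] by blast
    show ?thesis
      by (rule exI[of _ "f -` G \<inter> carrier V"])
        (use G U'(2) f linear_maps_zero[OF assms(1-3)] in \<open>auto simp: openin_pullback_topology\<close>)
  qed
  show ?thesis
    unfolding locally_convex_topology_def using top add scale convex by blast
qed


subsection \<open>Seminorms\<close>

definition seminorm_on :: "('k::real_or_complex, 'v, 'z) module_scheme \<Rightarrow> ('v \<Rightarrow> real) \<Rightarrow> bool"
  where "seminorm_on V p \<longleftrightarrow>
    (\<forall>x\<in>carrier V. \<forall>y\<in>carrier V. p (x \<oplus>\<^bsub>V\<^esub> y) \<le> p x + p y) \<and>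
    (\<forall>c. \<forall>x\<in>carrier V. p (c \<odot>\<^bsub>V\<^esub> x) = norm c * p x)"

text \<open>One seminorm at a time is enough: a set bounded in a supremum is bounded in every
  member, so each estimate can be read off from a member given by a single seminorm.\<close>

definition seminorm_topology :: "('k::real_or_complex, 'v, 'z) module_scheme \<Rightarrow> ('v \<Rightarrow> real) \<Rightarrow> 'v topology"
  where "seminorm_topology V p = topology (\<lambda>U. U \<subseteq> carrier V \<and>
    (\<forall>x\<in>U. \<exists>\<epsilon>>0. \<forall>y\<in>carrier V. p (y \<ominus>\<^bsub>V\<^esub> x) < \<epsilon> \<longrightarrow> y \<in> U))"

lemma openin_seminorm_topology:
  "openin (seminorm_topology V p) U \<longleftrightarrow> U \<subseteq> carrier V \<and>
    (\<forall>x\<in>U. \<exists>\<epsilon>>0. \<forall>y\<in>carrier V. p (y \<ominus>\<^bsub>V\<^esub> x) < \<epsilon> \<longrightarrow> y \<in> U)"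
proof -
  let ?P = "\<lambda>U. U \<subseteq> carrier V \<and> (\<forall>x\<in>U. \<exists>\<epsilon>>0. \<forall>y\<in>carrier V. p (y \<ominus>\<^bsub>V\<^esub> x) < \<epsilon> \<longrightarrow> y \<in> U)"
  have "?P (S \<inter> S')" if "?P S" "?P S'" for S S'
  proof -
    have "\<exists>\<epsilon>>0. \<forall>y\<in>carrier V. p (y \<ominus>\<^bsub>V\<^esub> x) < \<epsilon> \<longrightarrow> y \<in> S \<inter> S'" if x: "x \<in> S \<inter> S'" for x
    proof -
      obtain e e' where "e > 0" "\<forall>y\<in>carrier V. p (y \<ominus>\<^bsub>V\<^esub> x) < e \<longrightarrow> y \<in> S"
        "e' > 0" "\<forall>y\<in>carrier V. p (y \<ominus>\<^bsub>V\<^esub> x) < e' \<longrightarrow> y \<in> S'"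
        using x \<open>?P S\<close> \<open>?P S'\<close> by blast
      then show ?thesis by (intro exI[of _ "min e e'"]) auto
    qed
    then show ?thesis using that by auto
  qed
  moreover have "?P (\<Union>\<K>)" if "\<forall>S\<in>\<K>. ?P S" for \<K>
    using that by (meson UnionE UnionI Union_least)
  ultimately have "istopology ?P"
    unfolding istopology_def by blast
  then show ?thesis
    unfolding seminorm_topology_def by (simp add: topology_inverse')
qed

context
  fixes V :: "('k::real_or_complex, 'v, 'z) module_scheme" and p
  assumes V: "vec_space V" and p: "seminorm_on V p"
begin

interpretation V: vec_space V by (rule V)

lemma seminormD:
  "x \<in> carrier V \<Longrightarrow> y \<in> carrier V \<Longrightarrow> p (x \<oplus>\<^bsub>V\<^esub> y) \<le> p x + p y"
  "x \<in> carrier V \<Longrightarrow> p (c \<odot>\<^bsub>V\<^esub> x) = norm c * p x"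
  using p unfolding seminorm_on_def by auto

lemma seminorm_zero [simp]: "p \<zero>\<^bsub>V\<^esub> = 0"
  using seminormD(2)[of "\<zero>\<^bsub>V\<^esub>" 0] by simp

lemma seminorm_neg: "x \<in> carrier V \<Longrightarrow> p (\<ominus>\<^bsub>V\<^esub> x) = p x"
  using seminormD(2)[of x "- 1"] V.scale_minus_1 by simp

lemma seminorm_nonneg: "x \<in> carrier V \<Longrightarrow> 0 \<le> p x"
  using seminormD(1)[of x "\<ominus>\<^bsub>V\<^esub> x"] seminorm_neg[of x] by (simp add: V.M.r_neg)

lemma seminorm_minus_commute: "x \<in> carrier V \<Longrightarrow> y \<in> carrier V \<Longrightarrow> p (x \<ominus>\<^bsub>V\<^esub> y) = p (y \<ominus>\<^bsub>V\<^esub> x)"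
  using seminorm_neg[of "y \<ominus>\<^bsub>V\<^esub> x"] by (simp add: V.M.minus_eq V.M.minus_add V.M.a_comm)

lemma seminorm_minus_triangle:
  assumes "x \<in> carrier V" "y \<in> carrier V" "z \<in> carrier V"
  shows "p (x \<ominus>\<^bsub>V\<^esub> z) \<le> p (x \<ominus>\<^bsub>V\<^esub> y) + p (y \<ominus>\<^bsub>V\<^esub> z)"
proof -
  have "(x \<ominus>\<^bsub>V\<^esub> y) \<oplus>\<^bsub>V\<^esub> (y \<ominus>\<^bsub>V\<^esub> z) = x \<ominus>\<^bsub>V\<^esub> z"
    using assms by (simp add: V.M.minus_eq V.M.a_assoc V.M.r_neg1)
  then show ?thesis
    using seminormD(1)[of "x \<ominus>\<^bsub>V\<^esub> y" "y \<ominus>\<^bsub>V\<^esub> z"] assms by simp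
qed

lemma seminorm_ball_open:
  assumes "x \<in> carrier V"
  shows "openin (seminorm_topology V p) {y \<in> carrier V. p (y \<ominus>\<^bsub>V\<^esub> x) < \<epsilon>}"
  unfolding openin_seminorm_topology
proof (intro conjI ballI)
  fix y assume y: "y \<in> {y \<in> carrier V. p (y \<ominus>\<^bsub>V\<^esub> x) < \<epsilon>}"
  have "p (z \<ominus>\<^bsub>V\<^esub> x) < \<epsilon>" if "z \<in> carrier V" "p (z \<ominus>\<^bsub>V\<^esub> y) < \<epsilon> - p (y \<ominus>\<^bsub>V\<^esub> x)" for z
    using seminorm_minus_triangle[of z y x] that y assms by simp
  then show "\<exists>\<delta>>0. \<forall>z\<in>carrier V. p (z \<ominus>\<^bsub>V\<^esub> y) < \<delta> \<longrightarrow> z \<in> {y \<in> carrier V. p (y \<ominus>\<^bsub>V\<^esub> x) < \<epsilon>}"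
    using y by (intro exI[of _ "\<epsilon> - p (y \<ominus>\<^bsub>V\<^esub> x)"]) auto
qed auto

lemma minus_zero_right: "x \<in> carrier V \<Longrightarrow> x \<ominus>\<^bsub>V\<^esub> \<zero>\<^bsub>V\<^esub> = x"
  using V.scale_minus_1[of "\<zero>\<^bsub>V\<^esub>"] by (simp add: V.M.minus_eq)

lemma minus_self: "x \<in> carrier V \<Longrightarrow> p (x \<ominus>\<^bsub>V\<^esub> x) = 0"
  by (simp add: V.M.minus_eq V.M.r_neg)

lemma topspace_seminorm [simp]: "topspace (seminorm_topology V p) = carrier V"
proof -
  have "openin (seminorm_topology V p) (carrier V)"
    unfolding openin_seminorm_topology by (auto intro!: exI[of _ 1])
  then show ?thesis
    by (metis openin_seminorm_topology openin_subset openin_topspace subset_antisym)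
qed

lemma locally_convex_seminorm: "locally_convex_topology V (seminorm_topology V p)"
proof -
  let ?T = "seminorm_topology V p"
  have add: "continuous_map (prod_topology ?T ?T) ?T (\<lambda>(x, y). x \<oplus>\<^bsub>V\<^esub> y)"
    unfolding continuous_map_def
  proof (intro conjI allI impI)
    fix U assume U: "openin ?T U"
    show "openin (prod_topology ?T ?T) {z \<in> topspace (prod_topology ?T ?T). (case z of (x, y) \<Rightarrow> x \<oplus>\<^bsub>V\<^esub> y) \<in> U}"
      unfolding openin_prod_topology_alt
    proof (intro allI impI)
      fix x y assume "(x, y) \<in> {z \<in> topspace (prod_topology ?T ?T). (case z of (x, y) \<Rightarrow> x \<oplus>\<^bsub>V\<^esub> y) \<in> U}"
      then have xy: "x \<in> carrier V" "y \<in> carrier V" "x \<oplus>\<^bsub>V\<^esub> y \<in> U" by auto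
      then obtain e where e: "e > 0" "\<And>z. z \<in> carrier V \<Longrightarrow> p (z \<ominus>\<^bsub>V\<^esub> (x \<oplus>\<^bsub>V\<^esub> y)) < e \<Longrightarrow> z \<in> U"
        using U unfolding openin_seminorm_topology by blast
      have "x' \<oplus>\<^bsub>V\<^esub> y' \<in> U" if "x' \<in> carrier V" "p (x' \<ominus>\<^bsub>V\<^esub> x) < e / 2" "y' \<in> carrier V" "p (y' \<ominus>\<^bsub>V\<^esub> y) < e / 2" for x' y'
      proof (rule e(2))
        have "(x' \<oplus>\<^bsub>V\<^esub> y') \<ominus>\<^bsub>V\<^esub> (x \<oplus>\<^bsub>V\<^esub> y) = (x' \<ominus>\<^bsub>V\<^esub> x) \<oplus>\<^bsub>V\<^esub> (y' \<ominus>\<^bsub>V\<^esub> y)"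
          using that xy by (simp add: V.M.minus_eq V.M.minus_add V.M.a_ac)
        then show "p ((x' \<oplus>\<^bsub>V\<^esub> y') \<ominus>\<^bsub>V\<^esub> (x \<oplus>\<^bsub>V\<^esub> y)) < e"
          using seminormD(1)[of "x' \<ominus>\<^bsub>V\<^esub> x" "y' \<ominus>\<^bsub>V\<^esub> y"] that xy by simp
      qed (use that in auto)
      then show "\<exists>U1 U2. openin ?T U1 \<and> openin ?T U2 \<and> x \<in> U1 \<and> y \<in> U2 \<and>
          U1 \<times> U2 \<subseteq> {z \<in> topspace (prod_topology ?T ?T). (case z of (x, y) \<Rightarrow> x \<oplus>\<^bsub>V\<^esub> y) \<in> U}"
        using xy e(1) seminorm_ball_open[of x "e / 2"] seminorm_ball_open[of y "e / 2"]
        by (intro exI[of _ "{x' \<in> carrier V. p (x' \<ominus>\<^bsub>V\<^esub> x) < e / 2}"] exI[of _ "{y' \<in> carrier V. p (y' \<ominus>\<^bsub>V\<^esub> y) < e / 2}"])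
          (auto simp: minus_self)
    qed
  qed auto
  have scale: "continuous_map (prod_topology (euclidean :: 'k topology) ?T) ?T (\<lambda>(c, x). c \<odot>\<^bsub>V\<^esub> x)"
    unfolding continuous_map_def
  proof (intro conjI allI impI)
    fix U assume U: "openin ?T U"
    let ?G = "{z \<in> topspace (prod_topology (euclidean :: 'k topology) ?T). (case z of (c, x) \<Rightarrow> c \<odot>\<^bsub>V\<^esub> x) \<in> U}"
    show "openin (prod_topology (euclidean :: 'k topology) ?T) ?G"
      unfolding openin_prod_topology_alt
    proof (intro allI impI)
      fix c x assume "(c, x) \<in> ?G"
      then have x: "x \<in> carrier V" "c \<odot>\<^bsub>V\<^esub> x \<in> U" by auto
      then obtain e where e: "e > 0" "\<And>z. z \<in> carrier V \<Longrightarrow> p (z \<ominus>\<^bsub>V\<^esub> (c \<odot>\<^bsub>V\<^esub> x)) < e \<Longrightarrow> z \<in> U"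
        using U unfolding openin_seminorm_topology by blast
      \<comment> \<open>The difference is split as c' x' - c x = c' (x' - x) + (c' - c) x, and each
        part gets e/2. The bound 1 on \<open>d\<close> gives |c'| <= |c| + 1, which fixes
        \<open>d'\<close>; adding 1 to \<open>p x\<close> avoids division by zero.\<close>
      define d where "d = min 1 (e / (2 * (p x + 1)))"
      define d' where "d' = e / (2 * (norm c + 1))"
      have px: "p x \<ge> 0" using seminorm_nonneg x(1) .
      have d: "d > 0" "d \<le> 1" "d * p x \<le> e / 2"
      proof -
        show "d > 0" "d \<le> 1" using px e(1) by (auto simp: d_def)
        have "d * p x \<le> e / (2 * (p x + 1)) * (p x + 1)"
          using px e(1) by (intro mult_mono) (auto simp: d_def)
        also have "\<dots> = e / 2" using px by (simp add: field_simps)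
        finally show "d * p x \<le> e / 2" .
      qed
      have d': "d' > 0" "(norm c + 1) * d' = e / 2"
        using e(1) by (auto simp: d'_def add_nonneg_pos divide_simps) (smt (verit) norm_ge_zero)+
      have "c' \<odot>\<^bsub>V\<^esub> x' \<in> U" if c': "c' \<in> ball c d" and x': "x' \<in> carrier V" "p (x' \<ominus>\<^bsub>V\<^esub> x) < d'" for c' x'
      proof (rule e(2))
        have "c' \<odot>\<^bsub>V\<^esub> x' \<ominus>\<^bsub>V\<^esub> c \<odot>\<^bsub>V\<^esub> x = c' \<odot>\<^bsub>V\<^esub> (x' \<ominus>\<^bsub>V\<^esub> x) \<oplus>\<^bsub>V\<^esub> (c' - c) \<odot>\<^bsub>V\<^esub> x"
        proof -
          have "c' \<odot>\<^bsub>V\<^esub> (x' \<ominus>\<^bsub>V\<^esub> x) = c' \<odot>\<^bsub>V\<^esub> x' \<oplus>\<^bsub>V\<^esub> (- c') \<odot>\<^bsub>V\<^esub> x"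
            using x x' by (simp add: V.M.minus_eq V.scale_minus_1[symmetric] V.scale_distrib V.scale_scale)
          moreover have "(- c') \<odot>\<^bsub>V\<^esub> x \<oplus>\<^bsub>V\<^esub> (c' - c) \<odot>\<^bsub>V\<^esub> x = (- c) \<odot>\<^bsub>V\<^esub> x"
            using V.scale_add[of x "- c'" "c' - c"] x by simp
          moreover have "c' \<odot>\<^bsub>V\<^esub> x' \<ominus>\<^bsub>V\<^esub> c \<odot>\<^bsub>V\<^esub> x = c' \<odot>\<^bsub>V\<^esub> x' \<oplus>\<^bsub>V\<^esub> (- c) \<odot>\<^bsub>V\<^esub> x"
            using x x' by (simp add: V.M.minus_eq V.scale_minus_1[symmetric] V.scale_scale)
          ultimately show ?thesis
            using x x' by (simp add: V.M.a_assoc)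
        qed
        then have "p (c' \<odot>\<^bsub>V\<^esub> x' \<ominus>\<^bsub>V\<^esub> c \<odot>\<^bsub>V\<^esub> x) \<le> norm c' * p (x' \<ominus>\<^bsub>V\<^esub> x) + norm (c' - c) * p x"
          using seminormD(1)[of "c' \<odot>\<^bsub>V\<^esub> (x' \<ominus>\<^bsub>V\<^esub> x)" "(c' - c) \<odot>\<^bsub>V\<^esub> x"] seminormD(2) x x' by simp
        moreover have "norm (c' - c) < d"
          using c' by (simp add: dist_norm norm_minus_commute)
        moreover have "norm c' \<le> norm c + 1"
          using \<open>norm (c' - c) < d\<close> d(2) norm_triangle_sub[of c' c] by linarith
        moreover have "norm c' * p (x' \<ominus>\<^bsub>V\<^esub> x) \<le> (norm c + 1) * p (x' \<ominus>\<^bsub>V\<^esub> x)"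
          using calculation(3) seminorm_nonneg x x' by (intro mult_right_mono) auto
        moreover have "(norm c + 1) * p (x' \<ominus>\<^bsub>V\<^esub> x) < (norm c + 1) * d'"
          using x'(2) by (intro mult_strict_left_mono) (auto intro: add_nonneg_pos)
        moreover have "norm (c' - c) * p x \<le> d * p x"
          using calculation(2) px by (intro mult_right_mono) auto
        ultimately show "p (c' \<odot>\<^bsub>V\<^esub> x' \<ominus>\<^bsub>V\<^esub> c \<odot>\<^bsub>V\<^esub> x) < e"
          using d(3) d'(2) by linarith
      qed (use x' in auto)
      then show "\<exists>U1 U2. openin euclidean U1 \<and> openin ?T U2 \<and> c \<in> U1 \<and> x \<in> U2 \<and> U1 \<times> U2 \<subseteq> ?G"
        using x d(1) d'(1) seminorm_ball_open[of x d']
        by (intro exI[of _ "ball c d"] exI[of _ "{x' \<in> carrier V. p (x' \<ominus>\<^bsub>V\<^esub> x) < d'}"])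
          (auto simp: minus_self simp del: mem_ball)
    qed
  qed auto
  have convex: "\<exists>G\<subseteq>U. openin ?T G \<and> \<zero>\<^bsub>V\<^esub> \<in> G \<and>
      (\<forall>x\<in>G. \<forall>y\<in>G. \<forall>t\<in>{0..1}. (of_real t \<odot>\<^bsub>V\<^esub> x) \<oplus>\<^bsub>V\<^esub> (of_real (1 - t) \<odot>\<^bsub>V\<^esub> y) \<in> G)"
    if U: "openin ?T U" "\<zero>\<^bsub>V\<^esub> \<in> U" for U
  proof -
    obtain e where e: "e > 0" "\<And>z. z \<in> carrier V \<Longrightarrow> p (z \<ominus>\<^bsub>V\<^esub> \<zero>\<^bsub>V\<^esub>) < e \<Longrightarrow> z \<in> U"
      using U unfolding openin_seminorm_topology by blast
    have eq: "{y \<in> carrier V. p (y \<ominus>\<^bsub>V\<^esub> \<zero>\<^bsub>V\<^esub>) < e} = {y \<in> carrier V. p y < e}"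
      by (auto simp: minus_zero_right)
    have "p ((of_real t \<odot>\<^bsub>V\<^esub> x) \<oplus>\<^bsub>V\<^esub> (of_real (1 - t) \<odot>\<^bsub>V\<^esub> y)) < e"
      if "x \<in> carrier V" "p x < e" "y \<in> carrier V" "p y < e" "0 \<le> t" "t \<le> 1" for x y and t :: real
    proof -
      have "p ((of_real t \<odot>\<^bsub>V\<^esub> x) \<oplus>\<^bsub>V\<^esub> (of_real (1 - t) \<odot>\<^bsub>V\<^esub> y)) \<le> t * p x + (1 - t) * p y"
        using seminormD(1)[of "of_real t \<odot>\<^bsub>V\<^esub> x" "of_real (1 - t) \<odot>\<^bsub>V\<^esub> y"] that
        by (simp add: seminormD(2) del: of_real_diff)
      also have "\<dots> < e"
        using that by (intro convex_bound_lt) auto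
      finally show ?thesis .
    qed
    then show ?thesis
      using seminorm_ball_open[of "\<zero>\<^bsub>V\<^esub>" e] e
      by (intro exI[of _ "{y \<in> carrier V. p y < e}"]) (auto simp: eq minus_zero_right)
  qed
  show ?thesis
    unfolding locally_convex_topology_def using add scale convex topspace_seminorm by blast
qed

lemma bounded_seminorm:
  assumes "von_neumann_bounded V (seminorm_topology V p) B"
  shows "\<exists>K. \<forall>x\<in>B. p x \<le> K"
proof -
  let ?U = "{y \<in> carrier V. p (y \<ominus>\<^bsub>V\<^esub> \<zero>\<^bsub>V\<^esub>) < 1}"
  have B: "B \<subseteq> carrier V"
    using assms unfolding von_neumann_bounded_def by blast
  have "openin (seminorm_topology V p) ?U" "\<zero>\<^bsub>V\<^esub> \<in> ?U"
    using seminorm_ball_open minus_self by auto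
  then obtain r where r: "r > 0" "\<And>c x. norm c \<ge> r \<Longrightarrow> x \<in> B \<Longrightarrow> inverse c \<odot>\<^bsub>V\<^esub> x \<in> ?U"
    using von_neumann_boundedE[OF V equalityD1[OF topspace_seminorm] assms, of ?U] by (metis (no_types, lifting))
  have "p x \<le> r" if "x \<in> B" for x
  proof -
    have "p (inverse (of_real r) \<odot>\<^bsub>V\<^esub> x \<ominus>\<^bsub>V\<^esub> \<zero>\<^bsub>V\<^esub>) < 1"
      using r(1) r(2)[of "of_real r" x] that by simp
    then have "inverse r * p x < 1"
      using that B r(1) by (auto simp: minus_zero_right seminormD(2) norm_inverse subset_iff)
    then show ?thesis
      using r(1) by (simp add: field_simps)
  qed
  then show ?thesis by blast
qed

end


section \<open>An isomorphism criterion for bornological tensor products\<close>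

text \<open>The functional-analytic half of the proof, with abstract modules in place of sections.
  The topology of \<open>W\<close> enters only as the supremum of the topologies with property
  \<open>PW\<close>; \<open>separated\<close> is Hausdorffness in a form that fits this description,
  and \<open>kernel\<close> is purely algebraic, with a span and no closure.\<close>

locale bornological_tensor_iso =
  bilinear_map P Q W b
  for P :: "('a, 'k::real_or_complex, 'v) lc_module" and Q :: "('a, 'k, 'w) lc_module"
    and W :: "('a, 'k, 'u) lc_module" and b +
  fixes A :: "('a, 'r) ring_scheme" and PW
  assumes topol_W: "topol W = finest_locally_convex W PW"
    and bounded_b: "bounded_in P B \<Longrightarrow> bounded_in Q C \<Longrightarrow> bounded_in W {b x y | x y. x \<in> B \<and> y \<in> C}"
    and separated: "w \<in> carrier W \<Longrightarrow> w \<noteq> \<zero>\<^bsub>W\<^esub> \<Longrightarrow>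
      \<exists>T U. locally_convex_topology W T \<and> PW T \<and> openin T U \<and> w \<in> U \<and> \<zero>\<^bsub>W\<^esub> \<notin> U"
    and act_W: "a \<in> carrier A \<Longrightarrow> act W a \<in> linear_maps W W"
    and act_P: "a \<in> carrier A \<Longrightarrow> p \<in> carrier P \<Longrightarrow> act P a p \<in> carrier P"
    and act_Q: "a \<in> carrier A \<Longrightarrow> q \<in> carrier Q \<Longrightarrow> act Q a q \<in> carrier Q"
    and b_act_left: "a \<in> carrier A \<Longrightarrow> p \<in> carrier P \<Longrightarrow> q \<in> carrier Q \<Longrightarrow> b (act P a p) q = act W a (b p q)"
    and b_act_right: "a \<in> carrier A \<Longrightarrow> p \<in> carrier P \<Longrightarrow> q \<in> carrier Q \<Longrightarrow> b p (act Q a q) = act W a (b p q)"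
    and surjective: "w \<in> carrier W \<Longrightarrow> \<exists>z\<in>carrier (tensor_module P Q). tensor_lift W b z = w"
    and kernel: "z \<in> carrier (tensor_module P Q) \<Longrightarrow> tensor_lift W b z = \<zero>\<^bsub>W\<^esub> \<Longrightarrow>
      z \<in> lin_span (tensor_module P Q)
        {pure_tensor P Q (act P a p) q \<ominus>\<^bsub>tensor_module P Q\<^esub> pure_tensor P Q p (act Q a q)
          | a p q. a \<in> carrier A \<and> p \<in> carrier P \<and> q \<in> carrier Q}"
    and bounded_section: "bounded_in W D \<Longrightarrow> \<exists>R. (\<forall>u\<in>D. R u \<in> carrier (tensor_module P Q) \<and>
      tensor_lift W b (R u) = u) \<and> von_neumann_bounded (tensor_module P Q) (beta_topology P Q) (R ` D)"
begin

abbreviation "PQ \<equiv> tensor_module P Q"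
abbreviation "lift \<equiv> tensor_lift W b"
abbreviation "beta \<equiv> beta_topology P Q"

section \<open>Continuity of the lift and the closure of the relators\<close>

definition "J = {z \<in> carrier PQ. lift z = \<zero>\<^bsub>W\<^esub>}"

lemma J_iff: "z \<in> J \<longleftrightarrow> z \<in> carrier PQ \<and> lift z = \<zero>\<^bsub>W\<^esub>"
  by (simp add: J_def)

definition balanced_relators :: "(('v \<times> 'w) \<Rightarrow>\<^sub>0 'k) set set"
  where "balanced_relators = {pure_tensor P Q (act P a p) q \<ominus>\<^bsub>PQ\<^esub> pure_tensor P Q p (act Q a q)
    | a p q. a \<in> carrier A \<and> p \<in> carrier P \<and> q \<in> carrier Q}"

sublocale PQ: vec_quotient PQ J
  unfolding vec_quotient_def vec_quotient_axioms_def J_def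
  using vec_space_tensor subspace_kernel[OF vec_space_tensor W.vec_space_axioms lift_linear] by blast

text \<open>A topology generated by sets covers only their union, so at least one member of the
  family has to be exhibited for the points to be all of the tensor product.\<close>

lemma topspace_beta: "topspace beta = carrier PQ"
proof
  show "topspace beta \<subseteq> carrier PQ"
    unfolding beta_topology_def by (rule topspace_finest_subset)
  \<comment> \<open>The zero seminorm induces the indiscrete topology, in which every subset is
    bounded.\<close>
  have p: "seminorm_on PQ (\<lambda>_. 0)"
    by (simp add: seminorm_on_def)
  have "von_neumann_bounded PQ (seminorm_topology PQ (\<lambda>_. 0)) B" if B: "B \<subseteq> carrier PQ" for B
  proof -
    have U: "U = carrier PQ" if "openin (seminorm_topology PQ (\<lambda>_. 0)) U" "\<zero>\<^bsub>PQ\<^esub> \<in> U" for U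
      using that unfolding openin_seminorm_topology by auto
    show ?thesis
      using B PQ.scale_closed
      unfolding von_neumann_bounded_iff[OF vec_space_tensor equalityD1[OF topspace_seminorm[OF vec_space_tensor p]]]
      by (auto dest!: U intro!: exI[of _ 1])
  qed
  moreover have "{pure_tensor P Q x y | x y. x \<in> B \<and> y \<in> C} \<subseteq> carrier PQ"
    if BC: "bounded_in P B" "bounded_in Q C" for B C
  proof -
    have "B \<subseteq> carrier P" "C \<subseteq> carrier Q"
      using BC unfolding von_neumann_bounded_def by simp_all
    then show ?thesis by blast
  qed
  ultimately have bd: "\<forall>B C. bounded_in P B \<and> bounded_in Q C \<longrightarrow> von_neumann_bounded PQ
      (seminorm_topology PQ (\<lambda>_. 0)) {pure_tensor P Q x y | x y. x \<in> B \<and> y \<in> C}"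
    by simp
  have op: "openin (seminorm_topology PQ (\<lambda>_. 0)) (carrier PQ)"
    using openin_topspace[of "seminorm_topology PQ (\<lambda>_. 0)"] topspace_seminorm[OF vec_space_tensor p]
    by (simp only:)
  have "openin beta (carrier PQ)"
    unfolding beta_topology_def
    by (rule openin_finest[OF locally_convex_seminorm[OF vec_space_tensor p] _ op]) (rule bd)
  then show "carrier PQ \<subseteq> topspace beta"
    by (rule openin_subset)
qed

text \<open>Boundedness of \<open>b\<close> says that the pulled-back topology makes the formation
  of pure tensors bounded, so it is one of the topologies whose supremum is \<open>beta\<close>.
  Thus the lift is continuous into each member of the family defining
  \<open>topol W\<close>.\<close>

lemma openin_beta_pullback:
  assumes T: "locally_convex_topology W T" "PW T" and U: "openin T U"
  shows "openin beta (lift -` U \<inter> carrier PQ)"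
proof -
  let ?S = "pullback_topology (carrier PQ) lift T"
  have lc: "locally_convex_topology PQ ?S"
    by (rule continuous_locally_convex_pullback[OF vec_space_tensor W.vec_space_axioms lift_linear T(1)])
  have "von_neumann_bounded PQ ?S {pure_tensor P Q x y | x y. x \<in> B \<and> y \<in> C}"
    if BC: "bounded_in P B" "bounded_in Q C" for B C
  proof -
    have sub: "B \<subseteq> carrier P" "C \<subseteq> carrier Q"
      using BC unfolding von_neumann_bounded_def by auto
    have "{b x y | x y. x \<in> B \<and> y \<in> C} \<subseteq> carrier W"
      using sub b_closed by blast
    then have bd: "von_neumann_bounded W T {b x y | x y. x \<in> B \<and> y \<in> C}"
      using bounded_b[OF BC] T unfolding topol_W
      by (subst (asm) bounded_finest_iff[OF W.vec_space_axioms]) auto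
    show ?thesis
      unfolding von_neumann_bounded_iff[OF vec_space_tensor equalityD1[OF locally_convex_topspace[OF lc]]]
    proof (intro conjI allI impI)
      show "{pure_tensor P Q x y | x y. x \<in> B \<and> y \<in> C} \<subseteq> carrier PQ"
        using sub by blast
      fix U' assume "openin ?S U' \<and> \<zero>\<^bsub>PQ\<^esub> \<in> U'"
      then obtain U where U: "openin T U" "U' = lift -` U \<inter> carrier PQ" "\<zero>\<^bsub>W\<^esub> \<in> U"
        using linear_maps_zero[OF vec_space_tensor W.vec_space_axioms lift_linear]
        unfolding openin_pullback_topology by auto
      obtain r where r: "r > 0" "\<And>c x. norm c \<ge> r \<Longrightarrow> x \<in> {b x y | x y. x \<in> B \<and> y \<in> C} \<Longrightarrow>
          inverse c \<odot>\<^bsub>W\<^esub> x \<in> U"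
        by (rule von_neumann_boundedE[OF W.vec_space_axioms equalityD1[OF locally_convex_topspace[OF T(1)]] bd U(1,3)])
          (erule that)
      have "inverse c \<odot>\<^bsub>PQ\<^esub> pure_tensor P Q x y \<in> U'" if "norm c \<ge> r" "x \<in> B" "y \<in> C" for c x y
      proof -
        have xy: "x \<in> carrier P" "y \<in> carrier Q" using that sub by auto
        have "inverse c \<odot>\<^bsub>W\<^esub> b x y \<in> U"
          using r(2)[OF that(1)] that(2,3) by blast
        then show ?thesis
          using xy linear_mapsD(3)[OF lift_linear] lift_pure by (simp add: U(2))
      qed
      then show "\<exists>r>0. \<forall>c. norm c \<ge> r \<longrightarrow>
          (\<forall>x\<in>{pure_tensor P Q x y | x y. x \<in> B \<and> y \<in> C}. inverse c \<odot>\<^bsub>PQ\<^esub> x \<in> U')"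
        using r(1) by (intro exI[of _ r]) auto
    qed
  qed
  then show ?thesis
    unfolding beta_topology_def using U
    by (intro openin_finest[OF lc]) (auto simp: openin_pullback_topology)
qed

lemma balanced_relators_subset: "balanced_relators \<subseteq> J"
proof
  fix z assume "z \<in> balanced_relators"
  then obtain a p q where z: "z = pure_tensor P Q (act P a p) q \<ominus>\<^bsub>PQ\<^esub> pure_tensor P Q p (act Q a q)"
    and apq: "a \<in> carrier A" "p \<in> carrier P" "q \<in> carrier Q"
    unfolding balanced_relators_def by blast
  have c: "pure_tensor P Q (act P a p) q \<in> carrier PQ" "pure_tensor P Q p (act Q a q) \<in> carrier PQ"
    using apq act_P act_Q by auto
  have "lift z = lift (pure_tensor P Q (act P a p) q) \<oplus>\<^bsub>W\<^esub> (- 1) \<odot>\<^bsub>W\<^esub> lift (pure_tensor P Q p (act Q a q))"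
    unfolding z a_minus_def PQ.scale_minus_1[OF c(2), symmetric]
    using c linear_mapsD[OF lift_linear] by simp
  also have "\<dots> = \<zero>\<^bsub>W\<^esub>"
    using apq act_P act_Q linear_mapsD(1)[OF act_W] b_closed
    by (simp add: lift_pure b_act_left b_act_right W.scale_minus_1 W.M.r_neg)
  finally show "z \<in> J"
    using c by (simp add: z J_iff)
qed

lemma balanced_ker_eq: "balanced_ker A P Q = J"
proof
  let ?S = "lin_span PQ balanced_relators"
  have "?S \<subseteq> J"
    by (rule lin_span_minimal[OF balanced_relators_subset PQ.subspace_J])
  show "balanced_ker A P Q \<subseteq> J"
  proof
    fix z assume z: "z \<in> balanced_ker A P Q"
    then have zc: "z \<in> beta closure_of ?S"
      unfolding balanced_ker_def balanced_relators_def .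
    then have "z \<in> carrier PQ"
      using closure_of_subset_topspace[of beta ?S] topspace_beta by blast
    moreover have "lift z = \<zero>\<^bsub>W\<^esub>"
    proof (rule ccontr)
      assume "lift z \<noteq> \<zero>\<^bsub>W\<^esub>"
      obtain T U where "locally_convex_topology W T \<and> PW T \<and> openin T U \<and> lift z \<in> U \<and> \<zero>\<^bsub>W\<^esub> \<notin> U"
        using separated[OF linear_mapsD(1)[OF lift_linear \<open>z \<in> carrier PQ\<close>] \<open>lift z \<noteq> \<zero>\<^bsub>W\<^esub>\<close>]
        by (elim exE) (rule that)
      then have TU: "locally_convex_topology W T" "PW T" "openin T U" "lift z \<in> U" "\<zero>\<^bsub>W\<^esub> \<notin> U"
        by simp_all
      \<comment> \<open>This neighbourhood of \<open>z\<close> must meet the span, on which the lift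
        vanishes, although \<open>U\<close> omits zero.\<close>
      have "z \<in> lift -` U \<inter> carrier PQ"
        using TU(4) \<open>z \<in> carrier PQ\<close> by simp
      then obtain y where "y \<in> ?S" "y \<in> lift -` U \<inter> carrier PQ"
        using conjunct2[OF iffD1[OF in_closure_of zc]] openin_beta_pullback[OF TU(1-3)] by meson
      then show False
        using \<open>?S \<subseteq> J\<close> TU(5) by (auto simp: J_iff)
    qed
    ultimately show "z \<in> J" by (simp add: J_iff)
  qed
  show "J \<subseteq> balanced_ker A P Q"
  proof -
    have "J \<subseteq> ?S"
      using kernel unfolding balanced_relators_def J_iff subset_iff by blast
    moreover have "?S \<subseteq> beta closure_of ?S"
      using \<open>?S \<subseteq> J\<close> topspace_beta by (intro closure_of_subset) (auto simp: J_iff)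
    ultimately show ?thesis
      unfolding balanced_ker_def balanced_relators_def by blast
  qed
qed

section \<open>The induced map on the quotient\<close>

abbreviation "tiso \<equiv> induced_map lift"
abbreviation "PQA \<equiv> quot_module PQ J"

lemma lift_J: "z \<in> J \<Longrightarrow> lift z = \<zero>\<^bsub>W\<^esub>"
  by (simp add: J_iff)

lemma iso_coset: "z \<in> carrier PQ \<Longrightarrow> tiso (J +>\<^bsub>PQ\<^esub> z) = lift z"
  by (rule PQ.induced_map_coset[OF W.vec_space_axioms lift_linear lift_J])

lemma iso_linear: "tiso \<in> linear_maps PQA W"
  by (rule PQ.induced_map_linear[OF W.vec_space_axioms lift_linear lift_J])

lemma iso_bij: "bij_betw tiso (carrier PQA) (carrier W)"
  unfolding bij_betw_def
proof
  show "inj_on tiso (carrier PQA)"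
  proof (rule inj_onI)
    fix Y Y' assume "Y \<in> carrier PQA" "Y' \<in> carrier PQA" and eq: "tiso Y = tiso Y'"
    then obtain z z' where z: "z \<in> carrier PQ" "Y = J +>\<^bsub>PQ\<^esub> z" "z' \<in> carrier PQ" "Y' = J +>\<^bsub>PQ\<^esub> z'"
      by (metis (no_types, lifting) PQ.quot_carrierE)
    then have "lift z = lift z'"
      using eq iso_coset by simp
    then have "lift (z \<ominus>\<^bsub>PQ\<^esub> z') = \<zero>\<^bsub>W\<^esub>"
      unfolding a_minus_def PQ.scale_minus_1[OF z(3), symmetric]
      using z linear_mapsD[OF lift_linear] by (simp add: W.scale_minus_1 W.M.r_neg)
    then show "Y = Y'"
      using z PQ.coset_eq_iff[OF z(1,3)] by (simp add: J_iff)
  qed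
  show "tiso ` carrier PQA = carrier W"
  proof
    show "tiso ` carrier PQA \<subseteq> carrier W"
      using linear_mapsD(1)[OF iso_linear] by blast
    show "carrier W \<subseteq> tiso ` carrier PQA"
    proof
      fix w assume "w \<in> carrier W"
      then obtain z where "z \<in> carrier PQ" "lift z = w"
        using surjective by blast
      then show "w \<in> tiso ` carrier PQA"
        using iso_coset[of z] PQ.coset_in_quot[of z] by (metis (no_types, lifting) image_eqI)
    qed
  qed
qed

lemma tensor_eq: "bornological_tensor A P Q = mk_lc_module PQA (quot_topology PQ J beta)
    (\<lambda>a. quot_op PQ J (tensor_op P Q (act P a)))"
  unfolding bornological_tensor_def balanced_ker_eq ..

text \<open>The action on the quotient nests two set-level operators, one for each quotient. It is
  evaluated from outside: the lift is constant on the set produced by the outer operator because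
  \<open>ext\<close> is constant on each set produced by the inner one.\<close>

lemma iso_act:
  assumes a: "a \<in> carrier A" and Y: "Y \<in> carrier PQA"
  shows "tiso (quot_op PQ J (tensor_op P Q (act P a)) Y) = act W a (tiso Y)"
proof -
  obtain z where z: "z \<in> carrier PQ" "Y = J +>\<^bsub>PQ\<^esub> z"
    using Y by (rule PQ.quot_carrierE)
  have op: "tensor_op P Q (act P a) y \<noteq> {}" "tensor_op P Q (act P a) y \<subseteq> carrier Fr"
    "\<And>v. v \<in> tensor_op P Q (act P a) y \<Longrightarrow> ext v = act W a (lift z)" if y: "y \<in> Y" for y
  proof -
    have yc: "y \<in> carrier PQ"
      using y PQ.J.a_elemrcos_carrier[OF z(1)] unfolding z(2) by blast
    have "lift y = lift z"
      using PQ.induced_map_image[OF W.vec_space_axioms lift_linear lift_J z(1)] y z(2) by simp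
    then show "tensor_op P Q (act P a) y \<noteq> {}" "tensor_op P Q (act P a) y \<subseteq> carrier Fr"
      "\<And>v. v \<in> tensor_op P Q (act P a) y \<Longrightarrow> ext v = act W a (lift z)"
      using ext_tensor_op[OF yc act_P[OF a] act_W[OF a] b_act_left[OF a]] by simp_all
  qed
  let ?w = "act W a (lift z)"
  have w: "?w \<in> carrier W"
    using linear_mapsD(1)[OF act_W[OF a]] linear_mapsD(1)[OF lift_linear z(1)] by blast
  \<comment> \<open>The argument is a sum of two sets of representatives and need not be presented
    as a coset. Since the lift is an \<open>induced_map\<close>, a nonempty set with constant value
    of \<open>ext\<close> is all that is required.\<close>
  have lift_add: "lift (h \<oplus>\<^bsub>PQ\<^esub> tensor_op P Q (act P a) y) = ?w" if h: "h \<in> J" and y: "y \<in> Y" for h y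
  proof -
    have hP: "h \<in> carrier PQ" using h by (simp add: J_iff)
    note k = op[OF y]
    let ?k = "tensor_op P Q (act P a) y"
    have "ext v = ?w" if v: "v \<in> h \<oplus>\<^bsub>PQ\<^esub> ?k" for v
    proof -
      obtain x y where xy: "x \<in> h" "y \<in> ?k" "v = x \<oplus>\<^bsub>Fr\<^esub> y"
        using v unfolding tensor_module_def quot_module_simps set_add_def' by blast
      have xF: "x \<in> carrier Fr" "y \<in> carrier Fr"
        using xy carrier_nonempty[OF hP] k(2) by blast+
      have "ext x = \<zero>\<^bsub>W\<^esub>"
        using ext_eq_lift[OF hP xy(1)] h by (simp add: J_iff)
      then show ?thesis
        unfolding xy(3) using linear_mapsD(2)[OF ext_linear xF] k(3)[OF xy(2)] w by simp
    qed
    moreover have "h \<oplus>\<^bsub>PQ\<^esub> ?k \<noteq> {}"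
      using carrier_nonempty[OF hP] k(1)
      unfolding tensor_module_def quot_module_simps set_add_def' by blast
    ultimately have "induced_map ext (h \<oplus>\<^bsub>PQ\<^esub> ?k) = ?w"
      by (intro induced_map_eqI)
    then show ?thesis
      by (simp only: tensor_lift_def)
  qed
  have "tiso (quot_op PQ J (tensor_op P Q (act P a)) Y) = ?w"
  proof (rule induced_map_eqI)
    have "z \<in> Y" "\<zero>\<^bsub>PQ\<^esub> \<in> J"
      unfolding z(2) using PQ.J.a_rcos_self[OF z(1)] subspace_ofD(2)[OF PQ.subspace_J] by blast+
    then show "quot_op PQ J (tensor_op P Q (act P a)) Y \<noteq> {}"
      unfolding quot_op_def set_add_def' by blast
    fix v assume "v \<in> quot_op PQ J (tensor_op P Q (act P a)) Y"
    then obtain h y where "h \<in> J" "y \<in> Y" "v = h \<oplus>\<^bsub>PQ\<^esub> tensor_op P Q (act P a) y"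
      unfolding quot_op_def set_add_def' by blast
    then show "lift v = ?w"
      using lift_add by simp
  qed
  then show ?thesis
    unfolding z(2) iso_coset[OF z(1)] .
qed

abbreviation "quot_top \<equiv> quot_topology PQ J beta"

lemma topspace_quot: "topspace quot_top \<subseteq> carrier PQA"
  using openin_topspace[of quot_top] unfolding openin_quot_topology quot_module_simps by simp

lemma bounded_iso:
  assumes B: "von_neumann_bounded PQA quot_top B"
  shows "bounded_in W (tiso ` B)"
proof -
  have Bc: "B \<subseteq> carrier PQA"
    using B unfolding von_neumann_bounded_def by blast
  then have im: "tiso ` B \<subseteq> carrier W"
    using linear_mapsD(1)[OF iso_linear] by blast
  have "von_neumann_bounded W T (tiso ` B)" if T: "locally_convex_topology W T" "PW T" for T
    unfolding von_neumann_bounded_iff[OF W.vec_space_axioms equalityD1[OF locally_convex_topspace[OF T(1)]]]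
  proof (intro conjI allI impI im)
    fix U assume U: "openin T U \<and> \<zero>\<^bsub>W\<^esub> \<in> U"
    let ?U = "{Y \<in> carrier PQA. tiso Y \<in> U}"
    have "{x \<in> topspace beta. J +>\<^bsub>PQ\<^esub> x \<in> ?U} = lift -` U \<inter> carrier PQ"
      using iso_coset by (auto simp: topspace_beta)
    then have o: "openin quot_top ?U"
      using openin_beta_pullback[OF T] U unfolding openin_quot_topology quot_module_simps by auto
    have z: "\<zero>\<^bsub>PQA\<^esub> \<in> ?U"
      using U linear_maps_zero[OF PQ.vec_space_quot W.vec_space_axioms iso_linear] PQ.coset_in_quot[OF PQ.M.zero_closed]
      by (simp add: PQ.coset_zero quot_module_simps(2))
    obtain r where r: "r > 0" "\<And>c x. norm c \<ge> r \<Longrightarrow> x \<in> B \<Longrightarrow> inverse c \<odot>\<^bsub>PQA\<^esub> x \<in> ?U"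
      by (rule von_neumann_boundedE[OF PQ.vec_space_quot topspace_quot B o z]) (erule that)
    have "inverse c \<odot>\<^bsub>W\<^esub> tiso x \<in> U" if "norm c \<ge> r" "x \<in> B" for c x
      using r(2)[OF that] linear_mapsD(3)[OF iso_linear, of x "inverse c"] that(2) Bc by auto
    then show "\<exists>r>0. \<forall>c. norm c \<ge> r \<longrightarrow> (\<forall>x\<in>tiso ` B. inverse c \<odot>\<^bsub>W\<^esub> x \<in> U)"
      using r(1) by (intro exI[of _ r]) auto
  qed
  then show ?thesis
    unfolding topol_W bounded_finest_iff[OF W.vec_space_axioms im] by blast
qed

lemma bounded_coset:
  assumes B: "von_neumann_bounded PQ beta B"
  shows "von_neumann_bounded PQA quot_top ((\<lambda>z. J +>\<^bsub>PQ\<^esub> z) ` B)"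
  unfolding von_neumann_bounded_iff[OF PQ.vec_space_quot topspace_quot]
proof (intro conjI allI impI)
  have Bc: "B \<subseteq> carrier PQ"
    using B unfolding von_neumann_bounded_def by blast
  then show "(\<lambda>z. J +>\<^bsub>PQ\<^esub> z) ` B \<subseteq> carrier PQA"
    by blast
  fix U assume "openin quot_top U \<and> \<zero>\<^bsub>PQA\<^esub> \<in> U"
  then have o: "openin beta {x \<in> topspace beta. J +>\<^bsub>PQ\<^esub> x \<in> U}" and "J \<in> U"
    unfolding openin_quot_topology quot_module_simps by blast+
  have z: "\<zero>\<^bsub>PQ\<^esub> \<in> {x \<in> topspace beta. J +>\<^bsub>PQ\<^esub> x \<in> U}"
    using \<open>J \<in> U\<close> topspace_beta PQ.coset_zero by simp
  obtain r where r: "r > 0" "\<And>c x. norm c \<ge> r \<Longrightarrow> x \<in> B \<Longrightarrow>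
      inverse c \<odot>\<^bsub>PQ\<^esub> x \<in> {x \<in> topspace beta. J +>\<^bsub>PQ\<^esub> x \<in> U}"
    by (rule von_neumann_boundedE[OF vec_space_tensor equalityD1[OF topspace_beta] B o z]) (erule that)
  have "inverse c \<odot>\<^bsub>PQA\<^esub> (J +>\<^bsub>PQ\<^esub> x) \<in> U" if "norm c \<ge> r" "x \<in> B" for c x
  proof -
    have "x \<in> carrier PQ" using that(2) Bc by blast
    then show ?thesis
      using r(2)[OF that] PQ.quot_scale[of x "inverse c"] by simp
  qed
  then show "\<exists>r>0. \<forall>c. norm c \<ge> r \<longrightarrow> (\<forall>x\<in>(\<lambda>z. J +>\<^bsub>PQ\<^esub> z) ` B. inverse c \<odot>\<^bsub>PQA\<^esub> x \<in> U)"
    using r(1) by (intro exI[of _ r]) auto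
qed

theorem bornological_iso: "tiso \<in> bornological_module_iso A (bornological_tensor A P Q) W"
proof -
  have inv: "inv_into (carrier PQA) tiso w = J +>\<^bsub>PQ\<^esub> z" if "z \<in> carrier PQ" "lift z = w" for z w
    using inv_into_f_f[OF bij_betw_imp_inj_on[OF iso_bij] PQ.coset_in_quot[OF that(1)]]
      iso_coset[OF that(1)] that(2) by simp
  \<comment> \<open>On \<open>B\<close> the inverse is the coset map after \<open>R\<close>, and the
    coset map preserves boundedness. \<open>R\<close> may depend on \<open>B\<close>.\<close>
  have "von_neumann_bounded PQA quot_top (inv_into (carrier PQA) tiso ` B)" if B: "bounded_in W B" for B
  proof -
    obtain R where R: "\<And>u. u \<in> B \<Longrightarrow> R u \<in> carrier PQ \<and> lift (R u) = u" "von_neumann_bounded PQ beta (R ` B)"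
      using bounded_section[OF B] by blast
    have "inv_into (carrier PQA) tiso ` B = (\<lambda>z. J +>\<^bsub>PQ\<^esub> z) ` R ` B"
      unfolding image_image by (rule image_cong[OF refl]) (use R(1) inv in blast)
    then show ?thesis
      using bounded_coset[OF R(2)] by (simp only:)
  qed
  then show ?thesis
    unfolding bornological_module_iso_def linear_iso_def tensor_eq mk_lc_module_simps
      von_neumann_bounded_mk_lc_module
    using iso_bij iso_act bounded_iso linear_mapsD(2,3)[OF iso_linear] by blast
qed

end


section \<open>Smooth functions on manifolds\<close>

locale smooth_mfd =
  fixes M :: "('m, 'e::real_inner) manifold"
  assumes smooth_manifold: "smooth_manifold M"
begin

abbreviation "opn \<equiv> openin (mtop M)"

lemma hausdorff: "Hausdorff_space (mtop M)"
  using smooth_manifold unfolding smooth_manifold_def by blast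

lemma chart:
  assumes "(U, c) \<in> atlas M"
  shows chart_open: "opn U" and chart_image_open: "open (c ` U)"
    and chart_homeo: "homeomorphic_map (subtopology (mtop M) U) (top_of_set (c ` U)) c"
proof -
  have "\<forall>(U, c)\<in>atlas M. opn U \<and> open (c ` U) \<and>
      homeomorphic_map (subtopology (mtop M) U) (top_of_set (c ` U)) c"
    using smooth_manifold unfolding smooth_manifold_def by (elim conjE)
  then show "opn U" "open (c ` U)" "homeomorphic_map (subtopology (mtop M) U) (top_of_set (c ` U)) c"
    using assms by auto
qed

lemma chart_cover:
  assumes "x \<in> points M"
  obtains U c where "(U, c) \<in> atlas M" "x \<in> U"
proof -
  have "(\<Union>(U, c)\<in>atlas M. U) = points M"
    using smooth_manifold unfolding smooth_manifold_def by (elim conjE)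
  then show thesis
    using assms that by blast
qed

lemma chart_transition:
  assumes "(U, c) \<in> atlas M" "(V, d) \<in> atlas M"
  shows "smooth_on (c ` (U \<inter> V)) (d \<circ> inv_into U c)"
proof -
  have "\<forall>(U, c)\<in>atlas M. \<forall>(V, d)\<in>atlas M. smooth_on (c ` (U \<inter> V)) (d \<circ> inv_into U c)"
    using smooth_manifold unfolding smooth_manifold_def by (elim conjE)
  then show ?thesis
    using assms by blast
qed

lemma chart_inj: "(U, c) \<in> atlas M \<Longrightarrow> inj_on c U"
  using chart_homeo[of U c] chart_open[of U c] openin_subset[of "mtop M" U]
  by (auto simp: homeomorphic_map_def bijective_open_imp_homeomorphic_map dest!: homeomorphic_imp_injective_map
      simp: Int_absorb1)

lemma chart_inv [simp]: "(U, c) \<in> atlas M \<Longrightarrow> x \<in> U \<Longrightarrow> inv_into U c (c x) = x"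
  by (rule inv_into_f_f[OF chart_inj])

lemma chart_open_image:
  assumes "(U, c) \<in> atlas M" "opn W"
  shows "open (c ` (U \<inter> W))"
proof -
  have "openin (subtopology (mtop M) U) (U \<inter> W)"
    using assms(2) by (rule openin_subtopology_Int2)
  then have "openin (top_of_set (c ` U)) (c ` (U \<inter> W))"
    using homeomorphic_imp_open_map[OF chart_homeo[OF assms(1)]] unfolding open_map_def by blast
  then show ?thesis
    using openin_open_eq[OF chart_image_open[OF assms(1)]] by blast
qed

lemma chart_compact_image:
  assumes "(U, c) \<in> atlas M" "compactin (mtop M) C" "C \<subseteq> U"
  shows "compact (c ` C)"
proof -
  have "compactin (subtopology (mtop M) U) C"
    using assms(2,3) by (simp add: compactin_subtopology)
  then have "compactin (top_of_set (c ` U)) (c ` C)"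
    using image_compactin homeomorphic_imp_continuous_map[OF chart_homeo[OF assms(1)]] by blast
  then show ?thesis
    by (simp add: compactin_subtopology)
qed

lemma chart_preimage_open:
  assumes "(U, c) \<in> atlas M" "open S"
  shows "opn {x \<in> U. c x \<in> S}"
proof -
  have U: "topspace (subtopology (mtop M) U) = U"
    using openin_subset[OF chart_open[OF assms(1)]] by auto
  have "openin (top_of_set (c ` U)) (c ` U \<inter> S)"
    using assms(2) by (simp add: openin_open_Int)
  then have "openin (subtopology (mtop M) U) {x \<in> topspace (subtopology (mtop M) U). c x \<in> c ` U \<inter> S}"
    by (rule openin_continuous_map_preimage[OF homeomorphic_imp_continuous_map[OF chart_homeo[OF assms(1)]]])
  then have "openin (subtopology (mtop M) U) {x \<in> U. c x \<in> S}"
    unfolding U by (rule back_subst[where P = "openin _"]) auto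
  then show ?thesis
    using openin_trans_full[OF _ chart_open[OF assms(1)]] by blast
qed

lemma smooth_fun_onD:
  "smooth_fun_on M W f \<Longrightarrow> (U, c) \<in> atlas M \<Longrightarrow> smooth_on (c ` (U \<inter> W)) (f \<circ> inv_into U c)"
  unfolding smooth_fun_on_def by blast

lemma smooth_fun_on_local:
  assumes "\<And>x. x \<in> W \<Longrightarrow> \<exists>W' g. opn W' \<and> x \<in> W' \<and> smooth_fun_on M W' g \<and> (\<forall>y\<in>W'. f y = g y)"
  shows "smooth_fun_on M W f"
  unfolding smooth_fun_on_def
proof (intro ballI, clarify)
  fix U c assume Uc: "(U, c) \<in> atlas M"
  show "smooth_on (c ` (U \<inter> W)) (f \<circ> inv_into U c)"
  proof (rule smooth_on_local)
    fix y assume "y \<in> c ` (U \<inter> W)"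
    then obtain x where x: "x \<in> U" "x \<in> W" "y = c x" by blast
    then obtain W' g where W': "opn W'" "x \<in> W'" "smooth_fun_on M W' g" "\<forall>y\<in>W'. f y = g y"
      using assms[OF x(2)] by blast
    have "\<forall>z\<in>c ` (U \<inter> W'). (f \<circ> inv_into U c) z = (g \<circ> inv_into U c) z"
      using W'(4) Uc by auto
    then show "\<exists>O' h. open O' \<and> y \<in> O' \<and> smooth_on O' h \<and> (\<forall>z\<in>O'. (f \<circ> inv_into U c) z = h z)"
      using chart_open_image[OF Uc W'(1)] smooth_fun_onD[OF W'(3) Uc] W'(2) x
      by (intro exI[of _ "c ` (U \<inter> W')"] exI[of _ "g \<circ> inv_into U c"]) auto
  qed
qed

lemma smooth_fun_on_subset: "smooth_fun_on M W f \<Longrightarrow> W' \<subseteq> W \<Longrightarrow> smooth_fun_on M W' f"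
  unfolding smooth_fun_on_def by (fast intro: smooth_on_subset)

lemma smooth_fun_on_cong:
  assumes "opn W" "smooth_fun_on M W f" "\<And>x. x \<in> W \<Longrightarrow> f x = g x"
  shows "smooth_fun_on M W g"
  by (rule smooth_fun_on_local) (use assms in \<open>metis\<close>)

lemma smooth_fun_on_const: "smooth_fun_on M W (\<lambda>x. k)"
  unfolding smooth_fun_on_def comp_def using smooth_on_const by blast

lemma smooth_fun_on_add:
  assumes "opn W" "smooth_fun_on M W f" "smooth_fun_on M W g"
  shows "smooth_fun_on M W (\<lambda>x. f x + g x)"
  unfolding smooth_fun_on_def comp_def
  using smooth_on_add[OF chart_open_image[OF _ assms(1)] smooth_fun_onD[OF assms(2)] smooth_fun_onD[OF assms(3)]]
  by (auto simp: comp_def)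

lemma smooth_fun_on_mult:
  fixes f g :: "'m \<Rightarrow> 'f::real_normed_algebra"
  assumes "opn W" "smooth_fun_on M W f" "smooth_fun_on M W g"
  shows "smooth_fun_on M W (\<lambda>x. f x * g x)"
  unfolding smooth_fun_on_def comp_def
  using smooth_on_mult[OF chart_open_image[OF _ assms(1)] smooth_fun_onD[OF assms(2)] smooth_fun_onD[OF assms(3)]]
  by (auto simp: comp_def)

end


section \<open>Spaces of sections\<close>

text \<open>
  What is needed of a vector bundle, apart from the smoothness of its transition maps. This is all
  that has to be verified for the tensor product bundle.
\<close>

locale smooth_bundle = smooth_mfd M
  for M :: "('m, 'e::real_inner) manifold" +
  fixes E :: "('k::real_or_complex, 'm, 'v) vec_bundle"
  assumes vec_space_fiber: "x \<in> points M \<Longrightarrow> vec_space (fiber E x)"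
    and triv_open: "(V, r, \<phi>) \<in> trivs E \<Longrightarrow> openin (mtop M) V"
    and triv_cover: "x \<in> points M \<Longrightarrow> \<exists>V r \<phi>. (V, r, \<phi>) \<in> trivs E \<and> x \<in> V"
    and triv_add: "(V, r, \<phi>) \<in> trivs E \<Longrightarrow> x \<in> V \<Longrightarrow> v \<in> carrier (fiber E x) \<Longrightarrow> w \<in> carrier (fiber E x) \<Longrightarrow>
      \<phi> x (v \<oplus>\<^bsub>fiber E x\<^esub> w) i = \<phi> x v i + \<phi> x w i"
    and triv_scale: "(V, r, \<phi>) \<in> trivs E \<Longrightarrow> x \<in> V \<Longrightarrow> v \<in> carrier (fiber E x) \<Longrightarrow>
      \<phi> x (k \<odot>\<^bsub>fiber E x\<^esub> v) i = k * \<phi> x v i"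
    and triv_inj: "(V, r, \<phi>) \<in> trivs E \<Longrightarrow> x \<in> V \<Longrightarrow> v \<in> carrier (fiber E x) \<Longrightarrow>
      (\<And>i. i < r \<Longrightarrow> \<phi> x v i = 0) \<Longrightarrow> v = \<zero>\<^bsub>fiber E x\<^esub>"
begin

abbreviation "Sec \<equiv> sections M E"
abbreviation "Csec \<equiv> compact_sections M E"
abbreviation "coord \<phi> i s \<equiv> \<lambda>x. \<phi> x (s x) i"

lemma triv_subset: "(V, r, \<phi>) \<in> trivs E \<Longrightarrow> V \<subseteq> points M"
  using openin_subset[OF triv_open] .

lemma triv_zero: "(V, r, \<phi>) \<in> trivs E \<Longrightarrow> x \<in> V \<Longrightarrow> \<phi> x \<zero>\<^bsub>fiber E x\<^esub> i = 0"
proof -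
  assume V: "(V, r, \<phi>) \<in> trivs E" "x \<in> V"
  then interpret F: vec_space "fiber E x"
    using vec_space_fiber triv_subset by blast
  show ?thesis
    using triv_scale[OF V F.M.zero_closed, of 0] by simp
qed

section \<open>Pointwise operations on sections\<close>

lemma sectionsI:
  assumes "\<And>x. x \<in> points M \<Longrightarrow> s x \<in> carrier (fiber E x)" "\<And>x. x \<notin> points M \<Longrightarrow> s x = undefined"
    and "\<And>V r \<phi> i. (V, r, \<phi>) \<in> trivs E \<Longrightarrow> i < r \<Longrightarrow> smooth_fun_on M V (coord \<phi> i s)"
  shows "s \<in> Sec"
  using assms unfolding sections_def by (auto simp: PiE_def extensional_def)

lemma sectionsD:
  assumes "s \<in> Sec"
  shows "x \<in> points M \<Longrightarrow> s x \<in> carrier (fiber E x)" "x \<notin> points M \<Longrightarrow> s x = undefined"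
    and "(V, r, \<phi>) \<in> trivs E \<Longrightarrow> i < r \<Longrightarrow> smooth_fun_on M V (coord \<phi> i s)"
  using assms unfolding sections_def by (auto simp: PiE_def extensional_def)

lemma section_module_simps [simp]:
  "carrier (section_module M E S) = S"
  "\<zero>\<^bsub>section_module M E S\<^esub> = (\<lambda>x\<in>points M. \<zero>\<^bsub>fiber E x\<^esub>)"
  "s \<oplus>\<^bsub>section_module M E S\<^esub> t = (\<lambda>x\<in>points M. s x \<oplus>\<^bsub>fiber E x\<^esub> t x)"
  "k \<odot>\<^bsub>section_module M E S\<^esub> s = (\<lambda>x\<in>points M. k \<odot>\<^bsub>fiber E x\<^esub> s x)"
  by (simp_all add: section_module_def)

lemma zero_section: "(\<lambda>x\<in>points M. \<zero>\<^bsub>fiber E x\<^esub>) \<in> Sec"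
proof (rule sectionsI)
  show "(\<lambda>x\<in>points M. \<zero>\<^bsub>fiber E x\<^esub>) x \<in> carrier (fiber E x)" if "x \<in> points M" for x
  proof -
    interpret F: vec_space "fiber E x" by (rule vec_space_fiber[OF that])
    show ?thesis using that by simp
  qed
  show "smooth_fun_on M V (coord \<phi> i (\<lambda>x\<in>points M. \<zero>\<^bsub>fiber E x\<^esub>))" if V: "(V, r, \<phi>) \<in> trivs E" for V r \<phi> i
    by (rule smooth_fun_on_cong[OF triv_open[OF V] smooth_fun_on_const[of _ 0]])
      (use triv_zero[OF V] triv_subset[OF V] in auto)
qed simp

lemma add_section:
  assumes "s \<in> Sec" "t \<in> Sec"
  shows "(\<lambda>x\<in>points M. s x \<oplus>\<^bsub>fiber E x\<^esub> t x) \<in> Sec"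
proof (rule sectionsI)
  show "(\<lambda>x\<in>points M. s x \<oplus>\<^bsub>fiber E x\<^esub> t x) x \<in> carrier (fiber E x)" if "x \<in> points M" for x
  proof -
    interpret F: vec_space "fiber E x" by (rule vec_space_fiber[OF that])
    show ?thesis using that assms sectionsD(1) by simp
  qed
  show "smooth_fun_on M V (coord \<phi> i (\<lambda>x\<in>points M. s x \<oplus>\<^bsub>fiber E x\<^esub> t x))"
    if V: "(V, r, \<phi>) \<in> trivs E" "i < r" for V r \<phi> i
    by (rule smooth_fun_on_cong[OF triv_open[OF V(1)]
          smooth_fun_on_add[OF triv_open[OF V(1)] sectionsD(3)[OF assms(1) V] sectionsD(3)[OF assms(2) V]]])
      (use triv_add[OF V(1)] triv_subset[OF V(1)] assms sectionsD(1) in \<open>auto simp: subset_iff\<close>)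
qed simp

lemma act_section:
  assumes "s \<in> Sec" "smooth_fun_on M (points M) a"
  shows "section_act M E a s \<in> Sec"
proof (rule sectionsI)
  show "section_act M E a s x \<in> carrier (fiber E x)" if "x \<in> points M" for x
  proof -
    interpret F: vec_space "fiber E x" by (rule vec_space_fiber[OF that])
    show ?thesis using that assms sectionsD(1) by (simp add: section_act_def)
  qed
  show "smooth_fun_on M V (coord \<phi> i (section_act M E a s))"
    if V: "(V, r, \<phi>) \<in> trivs E" "i < r" for V r \<phi> i
    by (rule smooth_fun_on_cong[OF triv_open[OF V(1)]
          smooth_fun_on_mult[OF triv_open[OF V(1)] smooth_fun_on_subset[OF assms(2) triv_subset[OF V(1)]]
            sectionsD(3)[OF assms(1) V]]])
      (use triv_scale[OF V(1)] triv_subset[OF V(1)] assms sectionsD(1) in \<open>auto simp: subset_iff section_act_def\<close>)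
qed (simp add: section_act_def)

lemma scale_section: "s \<in> Sec \<Longrightarrow> (\<lambda>x\<in>points M. k \<odot>\<^bsub>fiber E x\<^esub> s x) \<in> Sec"
  using act_section[OF _ smooth_fun_on_const, of s k] by (simp add: section_act_def)

lemma vec_space_section_module:
  assumes "S \<subseteq> Sec" "(\<lambda>x\<in>points M. \<zero>\<^bsub>fiber E x\<^esub>) \<in> S"
    and "\<And>s t. s \<in> S \<Longrightarrow> t \<in> S \<Longrightarrow> (\<lambda>x\<in>points M. s x \<oplus>\<^bsub>fiber E x\<^esub> t x) \<in> S"
    and "\<And>k s. s \<in> S \<Longrightarrow> (\<lambda>x\<in>points M. k \<odot>\<^bsub>fiber E x\<^esub> s x) \<in> S"
  shows "vec_space (section_module M E S)"
proof -
  have c: "s x \<in> carrier (fiber E x)" if "s \<in> S" "x \<in> points M" for s x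
    using that assms(1) sectionsD(1) by blast
  have u: "s x = undefined" if "s \<in> S" "x \<notin> points M" for s x
    using that assms(1) sectionsD(2) by blast
  note F = vec_space_fiber
  show ?thesis
  proof (rule vec_spaceI)
    fix s t u :: "'m \<Rightarrow> 'v" and k l :: 'k
    assume s: "s \<in> carrier (section_module M E S)"
    show "\<zero>\<^bsub>section_module M E S\<^esub> \<oplus>\<^bsub>section_module M E S\<^esub> s = s"
      "0 \<odot>\<^bsub>section_module M E S\<^esub> s = \<zero>\<^bsub>section_module M E S\<^esub>"
      "1 \<odot>\<^bsub>section_module M E S\<^esub> s = s"
      "(k + l) \<odot>\<^bsub>section_module M E S\<^esub> s = k \<odot>\<^bsub>section_module M E S\<^esub> s \<oplus>\<^bsub>section_module M E S\<^esub> l \<odot>\<^bsub>section_module M E S\<^esub> s"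
      "(k * l) \<odot>\<^bsub>section_module M E S\<^esub> s = k \<odot>\<^bsub>section_module M E S\<^esub> (l \<odot>\<^bsub>section_module M E S\<^esub> s)"
      using s c[of s] u[of s] vec_space.scale_add[OF F] vec_space.scale_scale[OF F]
        vec_space.scale_one[OF F] vec_space.scale_0_left[OF F]
        abelian_monoid.l_zero[OF abelian_group.axioms(1)[OF module.axioms(2)[OF F[unfolded vec_space_iff]]]]
      by (auto simp: fun_eq_iff restrict_def)
    assume t: "t \<in> carrier (section_module M E S)"
    show "s \<oplus>\<^bsub>section_module M E S\<^esub> t = t \<oplus>\<^bsub>section_module M E S\<^esub> s"
      "k \<odot>\<^bsub>section_module M E S\<^esub> (s \<oplus>\<^bsub>section_module M E S\<^esub> t) = k \<odot>\<^bsub>section_module M E S\<^esub> s \<oplus>\<^bsub>section_module M E S\<^esub> k \<odot>\<^bsub>section_module M E S\<^esub> t"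
      using s t c[of s] c[of t] vec_space.scale_distrib[OF F]
        abelian_monoid.a_comm[OF abelian_group.axioms(1)[OF module.axioms(2)[OF F[unfolded vec_space_iff]]]]
      by (auto simp: fun_eq_iff restrict_def)
    assume u: "u \<in> carrier (section_module M E S)"
    show "s \<oplus>\<^bsub>section_module M E S\<^esub> t \<oplus>\<^bsub>section_module M E S\<^esub> u = s \<oplus>\<^bsub>section_module M E S\<^esub> (t \<oplus>\<^bsub>section_module M E S\<^esub> u)"
      using s t u c[of s] c[of t] c[of u]
        abelian_monoid.a_assoc[OF abelian_group.axioms(1)[OF module.axioms(2)[OF F[unfolded vec_space_iff]]]]
      by (auto simp: fun_eq_iff restrict_def)
  qed (use assms in auto)
qed

lemma vec_space_sections: "vec_space (section_module M E Sec)"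
  using zero_section add_section scale_section by (intro vec_space_section_module) auto

section \<open>Supports and compactly supported sections\<close>

lemma compact_closed: "compactin (mtop M) K \<Longrightarrow> closedin (mtop M) K"
  using compactin_imp_closedin hausdorff by blast

text \<open>A closed set contains a closure as soon as it contains the set itself. From here on,
  supports are handled through vanishing off a compact set.\<close>

lemma supp_subset_iff:
  assumes "closedin (mtop M) K"
  shows "supp M E s \<subseteq> K \<longleftrightarrow> (\<forall>x\<in>points M - K. s x = \<zero>\<^bsub>fiber E x\<^esub>)"
proof -
  have "supp M E s \<subseteq> K \<longleftrightarrow> {x \<in> points M. s x \<noteq> \<zero>\<^bsub>fiber E x\<^esub>} \<subseteq> K"
    unfolding supp_def using closure_of_minimal_eq[OF _ assms] by auto
  then show ?thesis by blast
qed

lemma sections_supported_iff: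
  assumes "compactin (mtop M) K"
  shows "s \<in> sections_supported_in M E K \<longleftrightarrow> s \<in> Sec \<and> (\<forall>x\<in>points M - K. s x = \<zero>\<^bsub>fiber E x\<^esub>)"
  unfolding sections_supported_in_def using supp_subset_iff[OF compact_closed[OF assms]] by blast

lemma compact_sections_iff:
  "s \<in> Csec \<longleftrightarrow> (\<exists>K. compactin (mtop M) K \<and> s \<in> sections_supported_in M E K)"
proof
  assume "s \<in> Csec"
  then show "\<exists>K. compactin (mtop M) K \<and> s \<in> sections_supported_in M E K"
    unfolding compact_sections_def sections_supported_in_def by blast
next
  assume "\<exists>K. compactin (mtop M) K \<and> s \<in> sections_supported_in M E K"
  then obtain K where K: "compactin (mtop M) K" "s \<in> Sec" "supp M E s \<subseteq> K"
    unfolding sections_supported_in_def by blast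
  then have "compactin (mtop M) (supp M E s)"
    by (intro closed_compactin[OF K(1,3)]) (simp add: supp_def)
  then show "s \<in> Csec"
    using K(2) unfolding compact_sections_def by blast
qed

lemma compact_sections_subset: "Csec \<subseteq> Sec"
  unfolding compact_sections_def by blast

lemma vec_space_compact_sections: "vec_space (section_module M E Csec)"
proof (rule vec_space_section_module[OF compact_sections_subset])
  have "compactin (mtop M) {}" by simp
  then show "(\<lambda>x\<in>points M. \<zero>\<^bsub>fiber E x\<^esub>) \<in> Csec"
    unfolding compact_sections_iff using zero_section sections_supported_iff[of "{}"]
    by (intro exI[of _ "{}"]) auto
next
  fix s t assume "s \<in> Csec" "t \<in> Csec"
  then obtain K K' where K: "compactin (mtop M) K" "compactin (mtop M) K'"
    "s \<in> sections_supported_in M E K" "t \<in> sections_supported_in M E K'"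
    unfolding compact_sections_iff by blast
  then have "compactin (mtop M) (K \<union> K')"
    by (simp add: compactin_Un)
  moreover have "s x \<oplus>\<^bsub>fiber E x\<^esub> t x = \<zero>\<^bsub>fiber E x\<^esub>" if "x \<in> points M - (K \<union> K')" for x
  proof -
    interpret F: vec_space "fiber E x" using that vec_space_fiber by blast
    show ?thesis using that K by (simp add: sections_supported_iff)
  qed
  ultimately show "(\<lambda>x\<in>points M. s x \<oplus>\<^bsub>fiber E x\<^esub> t x) \<in> Csec"
    unfolding compact_sections_iff using K add_section[of s t]
    by (intro exI[of _ "K \<union> K'"]) (auto simp: sections_supported_iff)
next
  fix s k assume "s \<in> Csec"
  then obtain K where K: "compactin (mtop M) K" "s \<in> sections_supported_in M E K"
    unfolding compact_sections_iff by blast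
  moreover have "k \<odot>\<^bsub>fiber E x\<^esub> s x = \<zero>\<^bsub>fiber E x\<^esub>" if "x \<in> points M - K" for x
  proof -
    interpret F: vec_space "fiber E x" using that vec_space_fiber by blast
    show ?thesis using that K by (simp add: sections_supported_iff)
  qed
  ultimately show "(\<lambda>x\<in>points M. k \<odot>\<^bsub>fiber E x\<^esub> s x) \<in> Csec"
    unfolding compact_sections_iff using K scale_section[of s k]
    by (intro exI[of _ K]) (auto simp: sections_supported_iff)
qed

end


subsection \<open>Bounded sets of sections\<close>

text \<open>An inequality for scaling suffices: the reverse one results from applying it to the
  inverse scalar, and for the scalar 0 from nonnegativity.\<close>

lemma seminorm_onI:
  fixes V :: "('k::real_or_complex, 'v, 'z) module_scheme"
  assumes "vec_space V" "\<And>x. x \<in> carrier V \<Longrightarrow> 0 \<le> p x"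
    and "\<And>x y. x \<in> carrier V \<Longrightarrow> y \<in> carrier V \<Longrightarrow> p (x \<oplus>\<^bsub>V\<^esub> y) \<le> p x + p y"
    and scale: "\<And>c x. x \<in> carrier V \<Longrightarrow> p (c \<odot>\<^bsub>V\<^esub> x) \<le> norm c * p x"
  shows "seminorm_on V p"
  unfolding seminorm_on_def
proof (intro conjI ballI allI)
  interpret V: vec_space V by fact
  fix c x assume x: "x \<in> carrier V"
  have "norm c * p x \<le> p (c \<odot>\<^bsub>V\<^esub> x)"
  proof (cases "c = 0")
    case False
    have "p x \<le> inverse (norm c) * p (c \<odot>\<^bsub>V\<^esub> x)"
      using scale[of "c \<odot>\<^bsub>V\<^esub> x" "inverse c"] x False V.scale_inverse(2) by (simp add: norm_inverse)
    then have "norm c * p x \<le> norm c * (inverse (norm c) * p (c \<odot>\<^bsub>V\<^esub> x))"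
      by (rule mult_left_mono) simp
    then show ?thesis
      using False by (simp add: mult.assoc[symmetric])
  qed (use assms(2) x in auto)
  then show "p (c \<odot>\<^bsub>V\<^esub> x) = norm c * p x"
    using scale[OF x, of c] by simp
qed (use assms(3) in auto)

context smooth_bundle
begin

definition jet_domain :: "'m set \<Rightarrow> ('m \<Rightarrow> 'e) \<Rightarrow> 'm set \<Rightarrow> nat \<Rightarrow> ('m \<Rightarrow> 'v \<Rightarrow> nat \<Rightarrow> 'k) \<Rightarrow> nat \<Rightarrow> 'm set \<Rightarrow> bool"
  where "jet_domain U c V r \<phi> i C \<longleftrightarrow> (U, c) \<in> atlas M \<and> (V, r, \<phi>) \<in> trivs E \<and> i < r \<and>
    compactin (mtop M) C \<and> C \<subseteq> U \<inter> V"

text \<open>The concrete counterpart of von Neumann boundedness. It characterizes bounded sets of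
  sections (\<open>bounded_sections_iff\<close>) and, together with a common step, bounded sets of
  the inductive limit (\<open>lf_bounded_iff\<close>).\<close>

definition jets_bounded :: "('m \<Rightarrow> 'v) set \<Rightarrow> bool"
  where "jets_bounded B \<longleftrightarrow> (\<forall>U c V r \<phi> i C. jet_domain U c V r \<phi> i C \<longrightarrow>
    bounded_jets (c ` C) (local_rep U c \<phi> i ` B))"

definition jet_nbhd :: "'m set \<Rightarrow> ('m \<Rightarrow> 'e) \<Rightarrow> ('m \<Rightarrow> 'v \<Rightarrow> nat \<Rightarrow> 'k) \<Rightarrow> nat \<Rightarrow> 'm set \<Rightarrow> 'e list
    \<Rightarrow> ('m \<Rightarrow> 'v) \<Rightarrow> real \<Rightarrow> ('m \<Rightarrow> 'v) set"
  where "jet_nbhd U c \<phi> i C vs s \<epsilon> = {t \<in> Sec. \<forall>y\<in>c ` C.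
    norm (iter_deriv vs (\<lambda>z. local_rep U c \<phi> i t z - local_rep U c \<phi> i s z) y) < \<epsilon>}"

abbreviation "ST \<equiv> section_topology M E"

lemma section_topology_eq: "ST = topology_generated_by (insert Sec
    {jet_nbhd U c \<phi> i C vs s \<epsilon> | U c V r \<phi> i C vs s \<epsilon>. jet_domain U c V r \<phi> i C \<and> s \<in> Sec \<and> \<epsilon> > 0})"
  unfolding section_topology_def jet_nbhd_def jet_domain_def by (simp add: conj_assoc)

lemma topspace_section_topology [simp]: "topspace ST = Sec"
  unfolding section_topology_eq topology_generated_by_topspace by (auto simp: jet_nbhd_def)

lemma open_jet_nbhd: "jet_domain U c V r \<phi> i C \<Longrightarrow> s \<in> Sec \<Longrightarrow> \<epsilon> > 0 \<Longrightarrow> openin ST (jet_nbhd U c \<phi> i C vs s \<epsilon>)"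
  unfolding section_topology_eq by (rule topology_generated_by_Basis) blast

lemma module_minus:
  assumes "vec_space (section_module M E S)" "s \<in> S" "t \<in> S"
  shows "t \<ominus>\<^bsub>section_module M E S\<^esub> s = (\<lambda>x\<in>points M. t x \<oplus>\<^bsub>fiber E x\<^esub> (- 1) \<odot>\<^bsub>fiber E x\<^esub> s x)"
proof -
  interpret V: vec_space "section_module M E S" by fact
  have "\<ominus>\<^bsub>section_module M E S\<^esub> s = (\<lambda>x\<in>points M. (- 1) \<odot>\<^bsub>fiber E x\<^esub> s x)"
    using V.scale_minus_1[of s] assms(2) by simp
  then show ?thesis
    unfolding a_minus_def by (auto simp: fun_eq_iff)
qed

section \<open>Seminorms of one component over one compact set in a chart\<close>

context
  fixes U c V r \<phi> i C
  assumes jd: "jet_domain U c V r \<phi> i C"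
begin

lemma jdD: "(U, c) \<in> atlas M" "(V, r, \<phi>) \<in> trivs E" "i < r" "compactin (mtop M) C" "C \<subseteq> U" "C \<subseteq> V"
  using jd unfolding jet_domain_def by auto

abbreviation "rep \<equiv> local_rep U c \<phi> i"

lemma rep_apply: "x \<in> U \<Longrightarrow> rep s (c x) = \<phi> x (s x) i"
  using jdD(1) by (simp add: local_rep_def)

lemma rep_open: "open (c ` (U \<inter> V))"
  by (rule chart_open_image[OF jdD(1) triv_open[OF jdD(2)]])

lemma rep_compact: "compact (c ` C)"
  by (rule chart_compact_image[OF jdD(1,4,5)])

lemma rep_subset: "c ` C \<subseteq> c ` (U \<inter> V)"
  using jdD by blast

lemma rep_smooth: "s \<in> Sec \<Longrightarrow> smooth_on (c ` (U \<inter> V)) (rep s)"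
  unfolding local_rep_def by (rule smooth_fun_onD[OF sectionsD(3)[OF _ jdD(2,3)] jdD(1)])

lemma rep_cong: "y \<in> c ` C \<Longrightarrow> (\<And>x. x \<in> U \<inter> V \<Longrightarrow> rep s (c x) = f (c x)) \<Longrightarrow>
    iter_deriv vs (rep s) y = iter_deriv vs f y"
  using rep_subset by (intro iter_deriv_cong_open[OF rep_open]) auto

lemma rep_add:
  assumes "s \<in> Sec" "t \<in> Sec" "y \<in> c ` C"
  shows "iter_deriv vs (rep (\<lambda>x\<in>points M. s x \<oplus>\<^bsub>fiber E x\<^esub> t x)) y
    = iter_deriv vs (rep s) y + iter_deriv vs (rep t) y"
proof -
  have "iter_deriv vs (rep (\<lambda>x\<in>points M. s x \<oplus>\<^bsub>fiber E x\<^esub> t x)) y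
      = iter_deriv vs (\<lambda>z. rep s z + rep t z) y"
    using assms triv_add[OF jdD(2)] triv_subset[OF jdD(2)] sectionsD(1)
    by (intro rep_cong) (auto simp: rep_apply subset_iff)
  also have "\<dots> = iter_deriv vs (rep s) y + iter_deriv vs (rep t) y"
    using assms rep_smooth rep_subset by (intro iter_deriv_add[OF rep_open]) auto
  finally show ?thesis .
qed

lemma rep_scale:
  assumes "s \<in> Sec" "y \<in> c ` C"
  shows "iter_deriv vs (rep (\<lambda>x\<in>points M. k \<odot>\<^bsub>fiber E x\<^esub> s x)) y = k * iter_deriv vs (rep s) y"
proof -
  have "iter_deriv vs (rep (\<lambda>x\<in>points M. k \<odot>\<^bsub>fiber E x\<^esub> s x)) y = iter_deriv vs (\<lambda>z. k * rep s z) y"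
    using assms triv_scale[OF jdD(2)] triv_subset[OF jdD(2)] sectionsD(1)
    by (intro rep_cong) (auto simp: rep_apply subset_iff)
  also have "\<dots> = k * iter_deriv vs (rep s) y"
    using assms rep_smooth rep_subset by (intro iter_deriv_cmult[OF rep_open]) auto
  finally show ?thesis .
qed

lemma rep_diff:
  assumes "s \<in> Sec" "t \<in> Sec" "y \<in> c ` C"
  shows "iter_deriv vs (\<lambda>z. rep t z - rep s z) y = iter_deriv vs (rep t) y - iter_deriv vs (rep s) y"
  using assms rep_smooth rep_subset by (intro iter_deriv_minus[OF rep_open]) auto

lemma rep_minus:
  assumes "vec_space (section_module M E S)" "S \<subseteq> Sec" "s \<in> S" "t \<in> S" "y \<in> c ` C"
  shows "iter_deriv vs (rep (t \<ominus>\<^bsub>section_module M E S\<^esub> s)) y = iter_deriv vs (\<lambda>z. rep t z - rep s z) y"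
proof -
  have st: "s \<in> Sec" "t \<in> Sec" using assms by auto
  have eq: "t \<ominus>\<^bsub>section_module M E S\<^esub> s
      = (\<lambda>x\<in>points M. t x \<oplus>\<^bsub>fiber E x\<^esub> (\<lambda>x\<in>points M. (- 1) \<odot>\<^bsub>fiber E x\<^esub> s x) x)"
    unfolding module_minus[OF assms(1,3,4)] by auto
  show ?thesis
    unfolding eq rep_add[OF st(2) scale_section[OF st(1)] assms(5)] rep_scale[OF st(1) assms(5)]
      rep_diff[OF st assms(5)] by simp
qed

lemma rep_bounded: "s \<in> Sec \<Longrightarrow> \<exists>K. \<forall>y\<in>c ` C. norm (iter_deriv vs (rep s) y) \<le> K"
  using bounded_jets_singleton[OF rep_compact rep_subset rep_smooth] unfolding bounded_jets_def by blast

text \<open>The inserted 0 gives the supremum a value when \<open>C\<close> is empty.\<close>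

definition jet_norm :: "'e list \<Rightarrow> ('m \<Rightarrow> 'v) \<Rightarrow> real"
  where "jet_norm vs s = Sup (insert 0 ((\<lambda>y. norm (iter_deriv vs (rep s) y)) ` c ` C))"

lemma jet_norm_le:
  "0 \<le> K \<Longrightarrow> (\<And>y. y \<in> c ` C \<Longrightarrow> norm (iter_deriv vs (rep s) y) \<le> K) \<Longrightarrow> jet_norm vs s \<le> K"
  unfolding jet_norm_def by (rule cSup_least) auto

lemma jet_norm_bdd: "s \<in> Sec \<Longrightarrow> bdd_above (insert 0 ((\<lambda>y. norm (iter_deriv vs (rep s) y)) ` c ` C))"
  using rep_bounded[of s vs] unfolding bdd_above_insert by (auto simp: bdd_above_def)

lemma le_jet_norm: "s \<in> Sec \<Longrightarrow> y \<in> c ` C \<Longrightarrow> norm (iter_deriv vs (rep s) y) \<le> jet_norm vs s"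
  unfolding jet_norm_def by (rule cSup_upper) (use jet_norm_bdd in auto)

lemma jet_norm_nonneg: "s \<in> Sec \<Longrightarrow> 0 \<le> jet_norm vs s"
  unfolding jet_norm_def by (rule cSup_upper) (use jet_norm_bdd in auto)

lemma seminorm_jet_norm:
  assumes "vec_space (section_module M E S)" "S \<subseteq> Sec"
  shows "seminorm_on (section_module M E S) (jet_norm vs)"
proof (rule seminorm_onI[OF assms(1)])
  fix s t assume "s \<in> carrier (section_module M E S)" "t \<in> carrier (section_module M E S)"
  then have st: "s \<in> Sec" "t \<in> Sec" using assms(2) by auto
  show "jet_norm vs (s \<oplus>\<^bsub>section_module M E S\<^esub> t) \<le> jet_norm vs s + jet_norm vs t"
  proof (rule jet_norm_le)
    fix y assume y: "y \<in> c ` C"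
    have "norm (iter_deriv vs (rep s) y + iter_deriv vs (rep t) y) \<le> jet_norm vs s + jet_norm vs t"
      using le_jet_norm[OF st(1) y] le_jet_norm[OF st(2) y] by (rule norm_triangle_mono)
    then show "norm (iter_deriv vs (rep (s \<oplus>\<^bsub>section_module M E S\<^esub> t)) y) \<le> jet_norm vs s + jet_norm vs t"
      by (simp add: rep_add[OF st y])
  qed (use jet_norm_nonneg st in auto)
next
  fix k s assume "s \<in> carrier (section_module M E S)"
  then have s: "s \<in> Sec" using assms(2) by auto
  show "jet_norm vs (k \<odot>\<^bsub>section_module M E S\<^esub> s) \<le> norm k * jet_norm vs s"
    using jet_norm_nonneg[OF s] le_jet_norm[OF s]
    by (intro jet_norm_le) (auto simp: rep_scale[OF s] norm_mult intro!: mult_left_mono)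
qed (use assms(2) jet_norm_nonneg in auto)

lemma jet_norm_continuous:
  assumes "vec_space (section_module M E S)" "S \<subseteq> Sec" "s \<in> S" "\<epsilon> > 0"
  shows "\<exists>N. openin ST N \<and> s \<in> N \<and> (\<forall>t\<in>N \<inter> S. jet_norm vs (t \<ominus>\<^bsub>section_module M E S\<^esub> s) < \<epsilon>)"
proof (intro exI conjI ballI)
  have s: "s \<in> Sec" using assms by auto
  \<comment> \<open>A strict bound at every point yields only a weak bound for the supremum, hence
    half of \<epsilon>.\<close>
  show "openin ST (jet_nbhd U c \<phi> i C vs s (\<epsilon> / 2))"
    using open_jet_nbhd[OF jd s] assms(4) by simp
  show "s \<in> jet_nbhd U c \<phi> i C vs s (\<epsilon> / 2)"
    using s assms(4) by (simp add: jet_nbhd_def iter_deriv_zero)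
  fix t assume t: "t \<in> jet_nbhd U c \<phi> i C vs s (\<epsilon> / 2) \<inter> S"
  have "jet_norm vs (t \<ominus>\<^bsub>section_module M E S\<^esub> s) \<le> \<epsilon> / 2"
  proof (rule jet_norm_le)
    fix y assume y: "y \<in> c ` C"
    have "norm (iter_deriv vs (\<lambda>z. rep t z - rep s z) y) \<le> \<epsilon> / 2"
      using t y unfolding jet_nbhd_def by fastforce
    then show "norm (iter_deriv vs (rep (t \<ominus>\<^bsub>section_module M E S\<^esub> s)) y) \<le> \<epsilon> / 2"
      using rep_minus[OF assms(1,2,3) _ y] t by simp
  qed (use assms(4) in simp)
  then show "jet_norm vs (t \<ominus>\<^bsub>section_module M E S\<^esub> s) < \<epsilon>"
    using assms(4) by simp
qed

end

text \<open>The subbasic neighbourhoods are centred at arbitrary sections, so one that contains zero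
  need not contain a ball of its own radius about zero. Compactness provides a uniform margin, and
  scaling down \<open>B\<close> makes its derivatives smaller than that margin.\<close>

lemma jets_bounded_absorbed:
  assumes B: "jets_bounded B" "B \<subseteq> Sec" and N: "openin ST N" "(\<lambda>x\<in>points M. \<zero>\<^bsub>fiber E x\<^esub>) \<in> N"
  shows "\<exists>R>0. \<forall>k. norm k \<ge> R \<longrightarrow> (\<forall>s\<in>B. (\<lambda>x\<in>points M. inverse k \<odot>\<^bsub>fiber E x\<^esub> s x) \<in> N)"
proof -
  define sc where "sc k s = (\<lambda>x\<in>points M. inverse k \<odot>\<^bsub>fiber E x\<^esub> s x)" for k :: 'k and s
  let ?z = "\<lambda>x\<in>points M. \<zero>\<^bsub>fiber E x\<^esub>"
  have "generate_topology_on (insert Sec {jet_nbhd U c \<phi> i C vs s \<epsilon> | U c V r \<phi> i C vs s \<epsilon>.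
      jet_domain U c V r \<phi> i C \<and> s \<in> Sec \<and> \<epsilon> > 0}) N"
    using N(1) unfolding section_topology_eq openin_topology_generated_by_iff .
  then have "\<exists>R>0. \<forall>k. norm k \<ge> R \<longrightarrow> (\<forall>s\<in>B. sc k s \<in> N)"
    using N(2)
  proof induction
    case (Int N1 N2)
    then obtain r1 r2 where "r1 > 0" "\<forall>k. norm k \<ge> r1 \<longrightarrow> (\<forall>s\<in>B. sc k s \<in> N1)"
      "r2 > 0" "\<forall>k. norm k \<ge> r2 \<longrightarrow> (\<forall>s\<in>B. sc k s \<in> N2)"
      by blast
    then show ?case
      by (intro exI[of _ "max r1 r2"]) auto
  next
    case (UN K)
    then obtain N' R where "N' \<in> K" "R > 0" "\<forall>k. norm k \<ge> R \<longrightarrow> (\<forall>s\<in>B. sc k s \<in> N')"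
      by blast
    then show ?case
      by (intro exI[of _ R]) auto
  next
    case (Basis N)
    then consider "N = Sec" | U c V r \<phi> i C vs s \<epsilon> where "N = jet_nbhd U c \<phi> i C vs s \<epsilon>"
      "jet_domain U c V r \<phi> i C" "s \<in> Sec" "\<epsilon> > 0"
      by blast
    then show ?case
    proof cases
      case 1
      have "sc k s \<in> Sec" if "s \<in> B" for k s
        using scale_section that B(2) by (auto simp: sc_def)
      then show ?thesis
        unfolding 1 by (intro exI[of _ 1]) simp
    next
      case (2 U c V r \<phi> i C vs s0 \<epsilon>)
      note jd = 2(2)
      let ?rep = "local_rep U c \<phi> i"
      have "bounded_jets (c ` C) (?rep ` B)"
        using B(1) jd unfolding jets_bounded_def by blast
      then obtain K where "\<forall>f\<in>?rep ` B. \<forall>y\<in>c ` C. norm (iter_deriv vs f y) \<le> K"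
        unfolding bounded_jets_def by blast
      then have K: "\<And>s y. s \<in> B \<Longrightarrow> y \<in> c ` C \<Longrightarrow> norm (iter_deriv vs (?rep s) y) \<le> K"
        by blast
      have sm: "smooth_on (c ` (U \<inter> V)) (?rep s0)"
        by (rule rep_smooth[OF jd 2(3)])
      have cont: "continuous_on (c ` C) (iter_deriv vs (?rep s0))"
        using sm rep_subset[OF jd] unfolding smooth_on_def
        by (meson continuous_at_imp_continuous_on differentiable_imp_continuous_within subsetD)
      have z: "iter_deriv vs (?rep ?z) y = 0" if y: "y \<in> c ` C" for y
      proof -
        have "iter_deriv vs (?rep ?z) y = iter_deriv vs (\<lambda>_. 0) y"
          using jdD[OF jd] triv_zero triv_subset[OF jdD(2)[OF jd]]
          by (intro rep_cong[OF jd y]) (auto simp: rep_apply[OF jd] subset_iff)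
        then show ?thesis by (simp add: iter_deriv_zero)
      qed
      have lt: "norm (iter_deriv vs (?rep s0) y) < \<epsilon>" if y: "y \<in> c ` C" for y
      proof -
        have "norm (iter_deriv vs (\<lambda>w. ?rep ?z w - ?rep s0 w) y) < \<epsilon>"
          using Basis.prems y unfolding 2(1) jet_nbhd_def by blast
        then show ?thesis
          unfolding rep_diff[OF jd 2(3) zero_section y] z[OF y] by simp
      qed
      \<comment> \<open>The bound \<open>lt\<close> is strict at each point of a compact set where
        the derivative is continuous. Its maximum is attained, so it stays below \<epsilon>; for
        empty \<open>C\<close> any smaller number will do.\<close>
      obtain \<mu> where \<mu>: "\<mu> < \<epsilon>" "\<And>y. y \<in> c ` C \<Longrightarrow> norm (iter_deriv vs (?rep s0) y) \<le> \<mu>"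
      proof (cases "C = {}")
        case True
        then show ?thesis using that[of "\<epsilon> - 1"] by simp
      next
        case False
        then obtain y0 where "y0 \<in> c ` C" "\<forall>y\<in>c ` C. norm (iter_deriv vs (?rep s0) y) \<le> norm (iter_deriv vs (?rep s0) y0)"
          using continuous_attains_sup[OF rep_compact[OF jd] _ continuous_on_norm[OF cont]] by blast
        then show ?thesis
          using that[of "norm (iter_deriv vs (?rep s0) y0)"] lt by blast
      qed
      \<comment> \<open>The 1 in the maximum keeps \<open>k\<close> away from 0, the 1 added to |K|
        makes the resulting estimate strict, and the absolute value covers a negative
        \<open>K\<close>, possible if \<open>B\<close> or \<open>C\<close> is empty.\<close>
      define R where "R = max 1 ((\<bar>K\<bar> + 1) / (\<epsilon> - \<mu>))"
      have "sc k s \<in> N" if k: "norm k \<ge> R" and s: "s \<in> B" for k s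
        unfolding 2(1) jet_nbhd_def
      proof (intro CollectI conjI ballI)
        have sS: "s \<in> Sec" using s B(2) by blast
        show scS: "sc k s \<in> Sec" unfolding sc_def by (rule scale_section[OF sS])
        fix y assume y: "y \<in> c ` C"
        have k0: "norm k \<ge> 1" "norm k > 0" "norm k \<ge> (\<bar>K\<bar> + 1) / (\<epsilon> - \<mu>)" using k by (auto simp: R_def)
        have "\<bar>K\<bar> < norm k * (\<epsilon> - \<mu>)"
          using k0(3) \<mu>(1) by (simp add: divide_le_eq)
        then have "\<bar>K\<bar> / norm k < \<epsilon> - \<mu>"
          by (subst pos_divide_less_eq[OF k0(2)]) (simp only: mult.commute)
        then have "inverse (norm k) * \<bar>K\<bar> < \<epsilon> - \<mu>"
          by (simp only: divide_inverse mult.commute)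
        moreover have "norm (inverse k * iter_deriv vs (?rep s) y) \<le> inverse (norm k) * \<bar>K\<bar>"
          unfolding norm_mult norm_inverse using K[OF s y] by (intro mult_left_mono) auto
        moreover have "norm (inverse k * iter_deriv vs (?rep s) y - iter_deriv vs (?rep s0) y)
            \<le> norm (inverse k * iter_deriv vs (?rep s) y) + norm (iter_deriv vs (?rep s0) y)"
          by (rule norm_triangle_ineq4)
        ultimately have "norm (inverse k * iter_deriv vs (?rep s) y - iter_deriv vs (?rep s0) y) < \<epsilon>"
          using \<mu>(2)[OF y] by linarith
        then show "norm (iter_deriv vs (\<lambda>w. ?rep (sc k s) w - ?rep s0 w) y) < \<epsilon>"
          using rep_diff[OF jd 2(3) scS y, of vs] rep_scale[OF jd sS y, of vs "inverse k"]
          by (simp only: sc_def)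
      qed
      moreover have "R > 0" by (simp add: R_def)
      ultimately show ?thesis by blast
    qed
  qed blast
  then show ?thesis
    by (simp only: sc_def)
qed

lemma bounded_sections_iff:
  "von_neumann_bounded (section_module M E Sec) ST B \<longleftrightarrow> B \<subseteq> Sec \<and> jets_bounded B"
proof
  assume L: "von_neumann_bounded (section_module M E Sec) ST B"
  then have B: "B \<subseteq> Sec"
    unfolding von_neumann_bounded_def by simp
  have "bounded_jets (c ` C) (local_rep U c \<phi> i ` B)" if jd: "jet_domain U c V r \<phi> i C" for U c V r \<phi> i C
    unfolding bounded_jets_def
  proof
    fix vs
    let ?N = "jet_nbhd U c \<phi> i C vs (\<lambda>x\<in>points M. \<zero>\<^bsub>fiber E x\<^esub>) 1"
    have N: "openin ST ?N" "\<zero>\<^bsub>section_module M E Sec\<^esub> \<in> ?N"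
      using open_jet_nbhd[OF jd zero_section] zero_section by (auto simp: jet_nbhd_def iter_deriv_zero)
    obtain R where R: "R > 0" "\<And>k s. norm k \<ge> R \<Longrightarrow> s \<in> B \<Longrightarrow> inverse k \<odot>\<^bsub>section_module M E Sec\<^esub> s \<in> ?N"
      by (rule von_neumann_boundedE[OF vec_space_sections _ L N]) (simp, erule that)
    have "norm (iter_deriv vs (local_rep U c \<phi> i s) y) \<le> R" if s: "s \<in> B" and y: "y \<in> c ` C" for s y
    proof -
      have sS: "s \<in> Sec" using s B by blast
      let ?s = "\<lambda>x\<in>points M. inverse (of_real R) \<odot>\<^bsub>fiber E x\<^esub> s x"
      have "?s \<in> ?N"
        using R(2)[of "of_real R" s] R(1) s by simp
      then have "norm (iter_deriv vs (\<lambda>w. local_rep U c \<phi> i ?s w - local_rep U c \<phi> i (\<lambda>x\<in>points M. \<zero>\<^bsub>fiber E x\<^esub>) w) y) < 1"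
        using y unfolding jet_nbhd_def by blast
      moreover have "iter_deriv vs (\<lambda>w. local_rep U c \<phi> i ?s w - local_rep U c \<phi> i (\<lambda>x\<in>points M. \<zero>\<^bsub>fiber E x\<^esub>) w) y
          = iter_deriv vs (local_rep U c \<phi> i ?s) y"
        using jdD[OF jd] rep_subset[OF jd] y triv_zero triv_subset[OF jdD(2)[OF jd]]
        by (intro iter_deriv_cong_open[OF rep_open[OF jd]]) (auto simp: rep_apply[OF jd] subset_iff)
      ultimately have "norm (inverse (of_real R) * iter_deriv vs (local_rep U c \<phi> i s) y) < 1"
        unfolding rep_scale[OF jd sS y] by simp
      then show ?thesis
        using R(1) by (simp add: norm_mult norm_inverse norm_divide field_simps)
    qed
    then show "\<exists>K. \<forall>f\<in>local_rep U c \<phi> i ` B. \<forall>y\<in>c ` C. norm (iter_deriv vs f y) \<le> K"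
      by blast
  qed
  then show "B \<subseteq> Sec \<and> jets_bounded B"
    using B unfolding jets_bounded_def by blast
next
  assume R: "B \<subseteq> Sec \<and> jets_bounded B"
  have top: "topspace ST \<subseteq> carrier (section_module M E Sec)" by simp
  show "von_neumann_bounded (section_module M E Sec) ST B"
    unfolding von_neumann_bounded_iff[OF vec_space_sections top]
    using jets_bounded_absorbed[of B] R by simp
qed

lemma jets_bounded_singleton: "s \<in> Sec \<Longrightarrow> jets_bounded {s}"
  unfolding jets_bounded_def using bounded_jets_singleton[OF rep_compact rep_subset rep_smooth] by auto

text \<open>Evaluation at a point is the derivative along the empty list over the compact set
  consisting of that point, so it is controlled by a single subbasic neighbourhood.\<close>

lemma eval_nbhd:
  assumes V: "(V, r, \<phi>) \<in> trivs E" "i < r" "x \<in> V" and s: "s \<in> Sec" "\<epsilon> > 0"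
  shows "\<exists>N. openin ST N \<and> s \<in> N \<and> (\<forall>t\<in>N. t \<in> Sec \<and> norm (\<phi> x (t x) i - \<phi> x (s x) i) < \<epsilon>)"
proof -
  have x: "x \<in> points M" using V triv_subset by blast
  obtain U c where U: "(U, c) \<in> atlas M" "x \<in> U"
    using chart_cover[OF x] by blast
  have jd: "jet_domain U c V r \<phi> i {x}"
    unfolding jet_domain_def using U V x by simp
  show ?thesis
  proof (intro exI conjI ballI)
    show "openin ST (jet_nbhd U c \<phi> i {x} [] s \<epsilon>)"
      by (rule open_jet_nbhd[OF jd s])
    show "s \<in> jet_nbhd U c \<phi> i {x} [] s \<epsilon>"
      using s by (simp add: jet_nbhd_def)
    fix t assume "t \<in> jet_nbhd U c \<phi> i {x} [] s \<epsilon>"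
    then show "t \<in> Sec" "norm (\<phi> x (t x) i - \<phi> x (s x) i) < \<epsilon>"
      unfolding jet_nbhd_def using rep_apply[OF jd U(2)] by auto
  qed
qed

end


subsection \<open>Bounded sets of compactly supported sections\<close>

locale exhausted_mfd = smooth_mfd M for M :: "('m, 'e::real_inner) manifold" +
  fixes L :: "nat \<Rightarrow> 'm set"
  assumes exhaustion: "compact_exhaustion (mtop M) L"
begin

lemma L_compact: "compactin (mtop M) (L n)"
  and L_interior: "L n \<subseteq> mtop M interior_of L (Suc n)"
  and L_cover: "(\<Union>n. L n) = points M"
  using exhaustion unfolding compact_exhaustion_def by auto

lemma L_mono: "n \<le> m \<Longrightarrow> L n \<subseteq> L m"
  using subset_trans[OF L_interior interior_of_subset] by (rule lift_Suc_mono_le)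

lemma compact_subset_L:
  assumes "compactin (mtop M) K"
  shows "\<exists>n. K \<subseteq> L n"
proof -
  have "K \<subseteq> \<Union> (range (\<lambda>n. mtop M interior_of L (Suc n)))"
    using compactin_subset_topspace[OF assms] L_cover L_interior by blast
  then obtain \<F> where F: "finite \<F>" "\<F> \<subseteq> range (\<lambda>n. mtop M interior_of L (Suc n))" "K \<subseteq> \<Union>\<F>"
    using compactinD[OF assms] by (metis (no_types, lifting) imageE openin_interior_of)
  then obtain I where I: "finite I" "\<F> = (\<lambda>n. mtop M interior_of L (Suc n)) ` I"
    by (metis finite_subset_image)
  show ?thesis
  proof (cases "I = {}")
    case True
    then show ?thesis using F(3) I(2) by auto
  next
    case False
    have "mtop M interior_of L (Suc n) \<subseteq> L (Suc (Max I))" if "n \<in> I" for n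
      using subset_trans[OF interior_of_subset L_mono[of "Suc n" "Suc (Max I)"]] Max_ge[OF I(1) that] by simp
    then have "K \<subseteq> L (Suc (Max I))"
      using F(3) I(2) by blast
    then show ?thesis by blast
  qed
qed

end

locale exhausted_bundle = exhausted_mfd M L + smooth_bundle M E
  for M :: "('m, 'e::real_inner) manifold" and L :: "nat \<Rightarrow> 'm set"
    and E :: "('k::real_or_complex, 'm, 'v) vec_bundle"
begin

abbreviation "Cm \<equiv> section_module M E Csec"
abbreviation "Lsec n \<equiv> sections_supported_in M E (L n)"

definition lf_compatible :: "('m \<Rightarrow> 'v) topology \<Rightarrow> bool"
  where "lf_compatible T \<longleftrightarrow> (\<forall>n. continuous_map (subtopology ST (Lsec n)) T (\<lambda>s. s))"

lemma lf_topology_eq: "lf_topology M L E = finest_locally_convex Cm lf_compatible"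
  unfolding lf_topology_def lf_compatible_def ..

lemma Lsec_iff: "s \<in> Lsec n \<longleftrightarrow> s \<in> Sec \<and> (\<forall>x\<in>points M - L n. s x = \<zero>\<^bsub>fiber E x\<^esub>)"
  by (rule sections_supported_iff[OF L_compact])

lemma Lsec_subset: "Lsec n \<subseteq> Csec"
  using compact_sections_iff L_compact by blast

lemma Csec_Lsec:
  assumes "s \<in> Csec"
  shows "\<exists>n. s \<in> Lsec n"
proof -
  obtain K where K: "compactin (mtop M) K" "s \<in> sections_supported_in M E K"
    using assms unfolding compact_sections_iff by blast
  obtain n where "K \<subseteq> L n"
    using compact_subset_L[OF K(1)] by blast
  then have "s \<in> Lsec n"
    using K by (auto simp: Lsec_iff sections_supported_iff)
  then show ?thesis by blast
qed

lemma Lsec_mono: "n \<le> m \<Longrightarrow> s \<in> Lsec n \<Longrightarrow> s \<in> Lsec m"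
  using L_mono[of n m] by (auto simp: Lsec_iff)

text \<open>Continuity is required on each step separately, with a neighbourhood that may depend on
  \<open>n\<close>. Seminorms built from infinitely many points escaping to infinity qualify,
  although they need not be continuous for the section topology as a whole.\<close>

definition lf_seminorm :: "(('m \<Rightarrow> 'v) \<Rightarrow> real) \<Rightarrow> bool"
  where "lf_seminorm q \<longleftrightarrow> seminorm_on Cm q \<and> (\<forall>n. \<forall>s\<in>Lsec n. \<forall>\<epsilon>>0.
    \<exists>N. openin ST N \<and> s \<in> N \<and> (\<forall>t\<in>N \<inter> Lsec n. q (t \<ominus>\<^bsub>Cm\<^esub> s) < \<epsilon>))"

lemma lf_compatible_seminorm:
  assumes q: "lf_seminorm q"
  shows "lf_compatible (seminorm_topology Cm q)"
  unfolding lf_compatible_def continuous_map_def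
proof (intro allI conjI impI)
  have sn: "seminorm_on Cm q" using q unfolding lf_seminorm_def by blast
  have LS: "Lsec n \<subseteq> Sec" for n by (auto simp: Lsec_iff)
  fix n
  show "(\<lambda>s. s) \<in> topspace (subtopology ST (Lsec n)) \<rightarrow> topspace (seminorm_topology Cm q)"
    using Lsec_subset topspace_seminorm[OF vec_space_compact_sections sn] by auto
  fix U assume U: "openin (seminorm_topology Cm q) U"
  show "openin (subtopology ST (Lsec n)) {x \<in> topspace (subtopology ST (Lsec n)). x \<in> U}"
  proof (subst openin_subopen, intro ballI)
    fix s assume "s \<in> {x \<in> topspace (subtopology ST (Lsec n)). x \<in> U}"
    then have s: "s \<in> Lsec n" "s \<in> U" by auto
    then obtain \<epsilon> where e: "\<epsilon> > 0" "\<forall>t\<in>Csec. q (t \<ominus>\<^bsub>Cm\<^esub> s) < \<epsilon> \<longrightarrow> t \<in> U"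
      using U unfolding openin_seminorm_topology by auto
    then obtain N where N: "openin ST N" "s \<in> N" "\<forall>t\<in>N \<inter> Lsec n. q (t \<ominus>\<^bsub>Cm\<^esub> s) < \<epsilon>"
      using q s(1) unfolding lf_seminorm_def by meson
    have "openin (subtopology ST (Lsec n)) (N \<inter> Lsec n)"
      using N(1) by (auto simp: openin_subtopology)
    moreover have "N \<inter> Lsec n \<subseteq> {x \<in> topspace (subtopology ST (Lsec n)). x \<in> U}"
      using N(3) e(2) Lsec_subset[of n] LS[of n] by auto
    ultimately show "\<exists>T. openin (subtopology ST (Lsec n)) T \<and> s \<in> T \<and> T \<subseteq> {x \<in> topspace (subtopology ST (Lsec n)). x \<in> U}"
      using N(2) s(1) by blast
  qed
qed

lemma lf_bounded_seminorm:
  assumes B: "von_neumann_bounded Cm (lf_topology M L E) B" and q: "lf_seminorm q"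
  shows "\<exists>K. \<forall>s\<in>B. q s \<le> K"
proof (rule bounded_seminorm[OF vec_space_compact_sections])
  show sn: "seminorm_on Cm q" using q unfolding lf_seminorm_def by blast
  have "B \<subseteq> carrier Cm" using B unfolding von_neumann_bounded_def by blast
  then show "von_neumann_bounded Cm (seminorm_topology Cm q) B"
    using B locally_convex_seminorm[OF vec_space_compact_sections sn] lf_compatible_seminorm[OF q]
    unfolding lf_topology_eq by (simp add: bounded_finest_iff[OF vec_space_compact_sections])
qed

lemma lf_seminorm_jet_norm:
  assumes jd: "jet_domain U c V r \<phi> i C"
  shows "lf_seminorm (jet_norm U c \<phi> i C vs)"
  unfolding lf_seminorm_def
proof (intro conjI allI ballI impI)
  show "seminorm_on Cm (jet_norm U c \<phi> i C vs)"
    by (rule seminorm_jet_norm[OF jd vec_space_compact_sections compact_sections_subset])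
  fix n s and \<epsilon> :: real assume "s \<in> Lsec n" "\<epsilon> > 0"
  then show "\<exists>N. openin ST N \<and> s \<in> N \<and> (\<forall>t\<in>N \<inter> Lsec n. jet_norm U c \<phi> i C vs (t \<ominus>\<^bsub>Cm\<^esub> s) < \<epsilon>)"
    using jet_norm_continuous[OF jd vec_space_compact_sections compact_sections_subset, of s \<epsilon> vs] Lsec_subset[of n]
    by blast
qed

text \<open>
  A set that is bounded in the inductive limit lies in a step: otherwise there are points \<open>x n\<close>
  outside \<open>L n\<close> at which elements of the set do not vanish, and a suitable weighted sum of the
  evaluations at these points is a continuous seminorm that is unbounded on the set.
\<close>

lemma lf_seminorm_evaluations:
  assumes tr: "\<And>n. (V n, r n, \<phi> n) \<in> trivs E" "\<And>n. i n < r n" "\<And>n. x n \<in> V n"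
    and x: "\<And>n. x n \<notin> L n" and a: "\<And>n. a n \<ge> 0"
  shows "lf_seminorm (\<lambda>s. suminf (\<lambda>n. a n * norm (\<phi> n (x n) (s (x n)) (i n))))"
    and "s \<in> Csec \<Longrightarrow> a n * norm (\<phi> n (x n) (s (x n)) (i n)) \<le> suminf (\<lambda>n. a n * norm (\<phi> n (x n) (s (x n)) (i n)))"
proof -
  let ?e = "\<lambda>s n. a n * norm (\<phi> n (x n) (s (x n)) (i n))"
  have xM: "x n \<in> points M" for n
    using tr triv_subset by blast
  \<comment> \<open>For \<open>n \<ge> N\<close> the point \<open>x n\<close> lies outside
    \<open>L N\<close>. So on each step the series is a finite sum, which settles convergence and
    continuity.\<close>
  have vanish: "?e s n = 0" if "s \<in> Lsec N" "n \<ge> N" for s n N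
  proof -
    have "x n \<notin> L N" using x[of n] L_mono[OF that(2)] by blast
    then show ?thesis using that(1) xM[of n] triv_zero[OF tr(1,3)] by (simp add: Lsec_iff)
  qed
  have sum: "suminf (?e s) = sum (?e s) {..<N}" if "s \<in> Lsec N" for s N
    using vanish[OF that] by (intro suminf_finite) auto
  have add: "?e (s \<oplus>\<^bsub>Cm\<^esub> t) n \<le> ?e s n + ?e t n" if "s \<in> Csec" "t \<in> Csec" for s t n
  proof -
    have c: "s (x n) \<in> carrier (fiber E (x n))" "t (x n) \<in> carrier (fiber E (x n))"
      using that compact_sections_subset sectionsD(1)[OF _ xM] by blast+
    have "?e (s \<oplus>\<^bsub>Cm\<^esub> t) n = a n * norm (\<phi> n (x n) (s (x n)) (i n) + \<phi> n (x n) (t (x n)) (i n))"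
      using xM triv_add[OF tr(1,3) c] by simp
    also have "\<dots> \<le> a n * (norm (\<phi> n (x n) (s (x n)) (i n)) + norm (\<phi> n (x n) (t (x n)) (i n)))"
      by (intro mult_left_mono norm_triangle_ineq a)
    finally show ?thesis by (simp add: algebra_simps)
  qed
  have scale: "?e (k \<odot>\<^bsub>Cm\<^esub> s) n = norm k * ?e s n" if "s \<in> Csec" for s n k
  proof -
    have c: "s (x n) \<in> carrier (fiber E (x n))"
      using that compact_sections_subset sectionsD(1)[OF _ xM] by blast
    show ?thesis
      using xM triv_scale[OF tr(1,3) c] by (simp add: norm_mult)
  qed
  interpret Cm: vec_space Cm by (rule vec_space_compact_sections)
  have common: "\<exists>N. s \<in> Lsec N \<and> t \<in> Lsec N" if "s \<in> Csec" "t \<in> Csec" for s t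
    using Csec_Lsec[OF that(1)] Csec_Lsec[OF that(2)] Lsec_mono by (meson linear)
  have seminorm: "seminorm_on Cm (\<lambda>s. suminf (?e s))"
  proof (rule seminorm_onI[OF vec_space_compact_sections])
    fix s assume "s \<in> carrier Cm"
    then obtain N where "s \<in> Lsec N" using Csec_Lsec by auto
    then show "0 \<le> suminf (?e s)"
      using a sum by (simp add: sum_nonneg)
  next
    fix s t assume st: "s \<in> carrier Cm" "t \<in> carrier Cm"
    have "s \<oplus>\<^bsub>Cm\<^esub> t \<in> Csec" using Cm.M.a_closed[OF st] by (simp del: section_module_simps(3))
    then obtain N2 where N2: "s \<oplus>\<^bsub>Cm\<^esub> t \<in> Lsec N2"
      using Csec_Lsec by blast
    obtain N1 where N1: "s \<in> Lsec N1" "t \<in> Lsec N1"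
      using common[of s t] st by auto
    from N1 N2 have N: "s \<in> Lsec (max N1 N2)" "t \<in> Lsec (max N1 N2)" "s \<oplus>\<^bsub>Cm\<^esub> t \<in> Lsec (max N1 N2)"
      by (meson Lsec_mono max.cobounded1 max.cobounded2)+
    show "suminf (?e (s \<oplus>\<^bsub>Cm\<^esub> t)) \<le> suminf (?e s) + suminf (?e t)"
      unfolding sum[OF N(1)] sum[OF N(2)] sum[OF N(3)] sum.distrib[symmetric]
      using st by (intro sum_mono add) auto
  next
    fix k s assume s: "s \<in> carrier Cm"
    have "suminf (?e (k \<odot>\<^bsub>Cm\<^esub> s)) = suminf (\<lambda>n. norm k * ?e s n)"
      by (intro arg_cong[where f = suminf] ext scale) (use s in simp)
    also have "\<dots> = norm k * suminf (?e s)"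
    proof -
      obtain N where "s \<in> Lsec N" using Csec_Lsec s by auto
      then have "summable (?e s)"
        using vanish by (intro summable_finite[of "{..<N}"]) auto
      then show ?thesis by (rule suminf_mult)
    qed
    finally show "suminf (?e (k \<odot>\<^bsub>Cm\<^esub> s)) \<le> norm k * suminf (?e s)" by simp
  qed
  show "lf_seminorm (\<lambda>s. suminf (?e s))"
    unfolding lf_seminorm_def
  proof (intro conjI seminorm allI ballI impI)
    fix n s and \<epsilon> :: real assume s: "s \<in> Lsec n" and e: "\<epsilon> > 0"
    have sS: "s \<in> Sec" using s by (simp add: Lsec_iff)
    \<comment> \<open>On step \<open>n\<close> at most the first n terms are nonzero. Each is kept
      below \<epsilon> / (n + 1), so their sum stays strictly below \<epsilon>; the 1 added to
      \<open>a j\<close> avoids division by zero.\<close>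
    define \<delta> where "\<delta> j = \<epsilon> / ((a j + 1) * (real n + 1))" for j
    have d: "\<delta> j > 0" for j
      using e a[of j] by (auto simp: \<delta>_def intro!: divide_pos_pos mult_pos_pos)
    have "\<exists>N. openin ST N \<and> s \<in> N \<and>
        (\<forall>t\<in>N. t \<in> Sec \<and> norm (\<phi> j (x j) (t (x j)) (i j) - \<phi> j (x j) (s (x j)) (i j)) < \<delta> j)" for j
      by (rule eval_nbhd[OF tr sS d])
    then obtain N where N: "\<And>j. openin ST (N j)" "\<And>j. s \<in> N j"
      "\<And>j t. t \<in> N j \<Longrightarrow> norm (\<phi> j (x j) (t (x j)) (i j) - \<phi> j (x j) (s (x j)) (i j)) < \<delta> j"
      by metis
    let ?N = "Sec \<inter> (\<Inter>j\<in>{..<n}. N j)"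
    have "openin ST ?N"
      using openin_Int_Inter[of "N ` {..<n}" ST Sec] N(1) openin_topspace[of ST] by auto
    moreover have "s \<in> ?N" using sS N(2) by auto
    moreover have "suminf (?e (t \<ominus>\<^bsub>Cm\<^esub> s)) < \<epsilon>" if t: "t \<in> ?N \<inter> Lsec n" for t
    proof -
      have st: "s \<in> Csec" "t \<in> Csec" using s t Lsec_subset by auto
      have ev: "\<phi> j (x j) ((t \<ominus>\<^bsub>Cm\<^esub> s) (x j)) (i j) = \<phi> j (x j) (t (x j)) (i j) - \<phi> j (x j) (s (x j)) (i j)" for j
      proof -
        interpret F: vec_space "fiber E (x j)" by (rule vec_space_fiber[OF xM])
        have c: "s (x j) \<in> carrier (fiber E (x j))" "t (x j) \<in> carrier (fiber E (x j))"
          using st compact_sections_subset sectionsD(1)[OF _ xM] by blast+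
        show ?thesis
          unfolding module_minus[OF vec_space_compact_sections st]
          using xM[of j] triv_add[OF tr(1,3) c(2) F.scale_closed[OF c(1)]] triv_scale[OF tr(1,3) c(1)] by simp
      qed
      have "?e (t \<ominus>\<^bsub>Cm\<^esub> s) j \<le> \<epsilon> / (real n + 1)" if "j < n" for j
      proof -
        have "norm (\<phi> j (x j) (t (x j)) (i j) - \<phi> j (x j) (s (x j)) (i j)) \<le> \<delta> j"
          using N(3)[of t j] t that by fastforce
        then have "?e (t \<ominus>\<^bsub>Cm\<^esub> s) j \<le> (a j + 1) * \<delta> j"
          unfolding ev using a[of j] by (intro mult_mono) auto
        also have "\<dots> = \<epsilon> / (real n + 1)"
        proof -
          have "a j + 1 \<noteq> 0" using a[of j] by linarith
          then show ?thesis by (simp add: \<delta>_def)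
        qed
        finally show ?thesis .
      qed
      moreover have "t \<ominus>\<^bsub>Cm\<^esub> s \<in> Lsec n"
      proof -
        have "t \<ominus>\<^bsub>Cm\<^esub> s \<in> Csec"
          using Cm.M.minus_closed[of t s] st by simp
        moreover have "(t \<ominus>\<^bsub>Cm\<^esub> s) y = \<zero>\<^bsub>fiber E y\<^esub>" if "y \<in> points M - L n" for y
        proof -
          interpret F: vec_space "fiber E y" using vec_space_fiber that by blast
          show ?thesis
            unfolding module_minus[OF vec_space_compact_sections st] using that s t by (simp add: Lsec_iff)
        qed
        ultimately show ?thesis
          using compact_sections_subset by (auto simp: Lsec_iff)
      qed
      ultimately have "suminf (?e (t \<ominus>\<^bsub>Cm\<^esub> s)) \<le> (\<Sum>j<n. \<epsilon> / (real n + 1))"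
        unfolding sum[OF \<open>t \<ominus>\<^bsub>Cm\<^esub> s \<in> Lsec n\<close>] by (intro sum_mono) auto
      also have "\<dots> < \<epsilon>"
        using e by (simp add: field_simps)
      finally show ?thesis .
    qed
    ultimately show "\<exists>N. openin ST N \<and> s \<in> N \<and> (\<forall>t\<in>N \<inter> Lsec n. suminf (?e (t \<ominus>\<^bsub>Cm\<^esub> s)) < \<epsilon>)"
      by blast
  qed
  show "?e s n \<le> suminf (?e s)" if s: "s \<in> Csec"
  proof -
    obtain N where N: "s \<in> Lsec N" using Csec_Lsec s by auto
    show ?thesis
    proof (cases "n < N")
      case True
      then show ?thesis unfolding sum[OF N] using a by (intro member_le_sum) auto
    next
      case False
      then have "?e s n = 0"
        using vanish[OF N, of n] by (simp only: not_less)
      also have "0 \<le> suminf (?e s)"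
        unfolding sum[OF N] using a by (simp add: sum_nonneg)
      finally show ?thesis .
    qed
  qed
qed

lemma nonzero_coord:
  assumes "s \<in> Sec" "x \<in> points M" "s x \<noteq> \<zero>\<^bsub>fiber E x\<^esub>"
  shows "\<exists>V r \<phi> i. (V, r, \<phi>) \<in> trivs E \<and> i < r \<and> x \<in> V \<and> \<phi> x (s x) i \<noteq> 0"
  using triv_cover[OF assms(2)] triv_inj sectionsD(1)[OF assms(1,2)] assms(3) by blast

text \<open>Bounds on jets come from the seminorms \<open>jet_norm\<close>, which are continuous on
  every step. Conversely, an open set of any compatible topology meets a step in the trace of an
  open set of the section topology, so absorption there is enough.\<close>

theorem lf_bounded_iff:
  "von_neumann_bounded Cm (lf_topology M L E) B \<longleftrightarrow> (\<exists>n. B \<subseteq> Lsec n) \<and> jets_bounded B"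
proof
  assume B: "von_neumann_bounded Cm (lf_topology M L E) B"
  have BC: "B \<subseteq> Csec"
    using B unfolding von_neumann_bounded_def by simp
  have "jets_bounded B"
    unfolding jets_bounded_def bounded_jets_def
  proof (intro allI impI)
    fix U c V r \<phi> i C vs assume jd: "jet_domain U c V r \<phi> i C"
    obtain K where "\<forall>s\<in>B. jet_norm U c \<phi> i C vs s \<le> K"
      using lf_bounded_seminorm[OF B lf_seminorm_jet_norm[OF jd]] by blast
    then have "\<forall>s\<in>B. \<forall>y\<in>c ` C. norm (iter_deriv vs (local_rep U c \<phi> i s) y) \<le> K"
      using le_jet_norm[OF jd] BC compact_sections_subset by (meson order_trans subsetD)
    then show "\<exists>K. \<forall>f\<in>local_rep U c \<phi> i ` B. \<forall>y\<in>c ` C. norm (iter_deriv vs f y) \<le> K"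
      by blast
  qed
  moreover have "\<exists>n. B \<subseteq> Lsec n"
  proof (rule ccontr)
    assume "\<nexists>n. B \<subseteq> Lsec n"
    have "\<exists>s x. s \<in> B \<and> x \<in> points M - L n \<and> s x \<noteq> \<zero>\<^bsub>fiber E x\<^esub>" for n
    proof -
      obtain s where "s \<in> B" "s \<notin> Lsec n"
        using \<open>\<nexists>n. B \<subseteq> Lsec n\<close> by blast
      moreover have "s \<in> Sec"
        using \<open>s \<in> B\<close> BC compact_sections_subset by blast
      ultimately show ?thesis
        unfolding Lsec_iff by blast
    qed
    then obtain s x where sx: "\<And>n. s n \<in> B" "\<And>n. x n \<in> points M - L n" "\<And>n. s n (x n) \<noteq> \<zero>\<^bsub>fiber E (x n)\<^esub>"
      by metis
    have "\<exists>V r \<phi> i. (V, r, \<phi>) \<in> trivs E \<and> i < r \<and> x n \<in> V \<and> \<phi> (x n) (s n (x n)) i \<noteq> 0" for n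
      using sx BC compact_sections_subset by (intro nonzero_coord) blast+
    then obtain V r \<phi> i where tr: "\<And>n. (V n, r n, \<phi> n) \<in> trivs E" "\<And>n. i n < r n" "\<And>n. x n \<in> V n"
      and nz: "\<And>n. \<phi> n (x n) (s n (x n)) (i n) \<noteq> 0"
      by metis
    \<comment> \<open>With these weights the n-th term at \<open>s n\<close> equals n, so the
      seminorm of \<open>s n\<close> is at least n.\<close>
    define a where "a n = real n / norm (\<phi> n (x n) (s n (x n)) (i n))" for n
    have a: "a n \<ge> 0" for n by (simp add: a_def)
    have xL: "x n \<notin> L n" for n using sx(2) by blast
    obtain K where K: "\<forall>t\<in>B. suminf (\<lambda>n. a n * norm (\<phi> n (x n) (t (x n)) (i n))) \<le> K"
      using lf_bounded_seminorm[OF B lf_seminorm_evaluations(1)[of V r \<phi> i x a, OF tr xL a]] by blast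
    have "real n \<le> K" for n
    proof -
      have "real n = a n * norm (\<phi> n (x n) (s n (x n)) (i n))"
        using nz by (simp add: a_def)
      also have "\<dots> \<le> K"
        using lf_seminorm_evaluations(2)[of V r \<phi> i x a "s n" n, OF tr xL a] sx(1)[of n] BC K by force
      finally show ?thesis .
    qed
    then show False
      using reals_Archimedean2[of K] by (meson not_le)
  qed
  ultimately show "(\<exists>n. B \<subseteq> Lsec n) \<and> jets_bounded B" by blast
next
  assume "(\<exists>n. B \<subseteq> Lsec n) \<and> jets_bounded B"
  then obtain n where B: "B \<subseteq> Lsec n" "jets_bounded B" by blast
  have BS: "B \<subseteq> Sec" using B(1) by (auto simp: Lsec_iff)
  have BC: "B \<subseteq> carrier Cm" using B(1) Lsec_subset by auto
  have "von_neumann_bounded Cm T B" if T: "locally_convex_topology Cm T" "lf_compatible T" for T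
    unfolding von_neumann_bounded_iff[OF vec_space_compact_sections equalityD1[OF locally_convex_topspace[OF T(1)]]]
  proof (intro conjI BC allI impI)
    fix U assume U: "openin T U \<and> \<zero>\<^bsub>Cm\<^esub> \<in> U"
    have "openin (subtopology ST (Lsec n)) {s \<in> topspace (subtopology ST (Lsec n)). s \<in> U}"
      by (rule openin_continuous_map_preimage[OF spec[OF T(2)[unfolded lf_compatible_def]] conjunct1[OF U]])
    then obtain N where N: "openin ST N" "{s \<in> topspace (subtopology ST (Lsec n)). s \<in> U} = N \<inter> Lsec n"
      unfolding openin_subtopology by blast
    have z: "(\<lambda>x\<in>points M. \<zero>\<^bsub>fiber E x\<^esub>) \<in> Lsec n"
      using zero_section by (simp add: Lsec_iff)
    then have "(\<lambda>x\<in>points M. \<zero>\<^bsub>fiber E x\<^esub>) \<in> N"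
      using N(2) U zero_section by auto
    then obtain R where R: "R > 0" "\<And>k s. norm k \<ge> R \<Longrightarrow> s \<in> B \<Longrightarrow> (\<lambda>x\<in>points M. inverse k \<odot>\<^bsub>fiber E x\<^esub> s x) \<in> N"
      using jets_bounded_absorbed[OF B(2) BS N(1)] by blast
    have "inverse k \<odot>\<^bsub>Cm\<^esub> s \<in> U" if k: "norm k \<ge> R" "s \<in> B" for k s
    proof -
      have sL: "s \<in> Lsec n" using k B(1) by blast
      have "inverse k \<odot>\<^bsub>fiber E x\<^esub> s x = \<zero>\<^bsub>fiber E x\<^esub>" if "x \<in> points M - L n" for x
      proof -
        interpret F: vec_space "fiber E x" using vec_space_fiber that by blast
        show ?thesis using that sL by (simp add: Lsec_iff)
      qed
      then have "(\<lambda>x\<in>points M. inverse k \<odot>\<^bsub>fiber E x\<^esub> s x) \<in> Lsec n"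
        using sL scale_section by (simp add: Lsec_iff)
      then have "(\<lambda>x\<in>points M. inverse k \<odot>\<^bsub>fiber E x\<^esub> s x) \<in> U"
        using R(2)[OF k] N(2) by blast
      then show ?thesis by simp
    qed
    then show "\<exists>r>0. \<forall>c. norm c \<ge> r \<longrightarrow> (\<forall>x\<in>B. inverse c \<odot>\<^bsub>Cm\<^esub> x \<in> U)"
      using R(1) by blast
  qed
  then show "von_neumann_bounded Cm (lf_topology M L E) B"
    unfolding lf_topology_eq bounded_finest_iff[OF vec_space_compact_sections BC] by blast
qed

text \<open>One coordinate at a point where the section does not vanish is a continuous seminorm on
  the steps. Its ball about \<open>s\<close> with radius its value at \<open>s\<close> omits
  zero.\<close>

lemma lf_separated:
  assumes s: "s \<in> Csec" "s \<noteq> (\<lambda>x\<in>points M. \<zero>\<^bsub>fiber E x\<^esub>)"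
  shows "\<exists>T U. locally_convex_topology Cm T \<and> lf_compatible T \<and> openin T U \<and> s \<in> U \<and> \<zero>\<^bsub>Cm\<^esub> \<notin> U"
proof -
  interpret Cm: vec_space Cm by (rule vec_space_compact_sections)
  have sS: "s \<in> Sec" using s compact_sections_subset by blast
  obtain x where x: "x \<in> points M" "s x \<noteq> \<zero>\<^bsub>fiber E x\<^esub>"
    using s(2) sectionsD(2)[OF sS] by (auto simp: fun_eq_iff restrict_def split: if_splits)
  obtain V r \<phi> i where tr: "(V, r, \<phi>) \<in> trivs E" "i < r" "x \<in> V" "\<phi> x (s x) i \<noteq> 0"
    using nonzero_coord[OF sS x] by blast
  obtain U c where U: "(U, c) \<in> atlas M" "x \<in> U"
    using chart_cover[OF x(1)] by blast
  have jd: "jet_domain U c V r \<phi> i {x}"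
    unfolding jet_domain_def using U tr x by simp
  let ?q = "jet_norm U c \<phi> i {x} []"
  note q = lf_seminorm_jet_norm[OF jd, of "[]"]
  have sn: "seminorm_on Cm ?q" using q unfolding lf_seminorm_def by blast
  have qs: "?q s > 0"
  proof -
    have "norm (\<phi> x (s x) i) \<le> ?q s"
      using le_jet_norm[OF jd sS, of "c x" "[]"] rep_apply[OF jd U(2)] by simp
    then show ?thesis using tr(4) by (smt (verit) zero_less_norm_iff)
  qed
  let ?U = "{y \<in> carrier Cm. ?q (y \<ominus>\<^bsub>Cm\<^esub> s) < ?q s}"
  have "openin (seminorm_topology Cm ?q) ?U"
    using s by (intro seminorm_ball_open[OF vec_space_compact_sections sn]) simp
  moreover have "s \<in> ?U"
    using s qs minus_self[OF vec_space_compact_sections sn, of s] by simp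
  moreover have "?q (\<zero>\<^bsub>Cm\<^esub> \<ominus>\<^bsub>Cm\<^esub> s) = ?q s"
    using seminorm_minus_commute[OF vec_space_compact_sections sn, of "\<zero>\<^bsub>Cm\<^esub>" s]
      minus_zero_right[OF vec_space_compact_sections sn, of s] s(1) Cm.M.zero_closed by simp
  ultimately show ?thesis
    using locally_convex_seminorm[OF vec_space_compact_sections sn] lf_compatible_seminorm[OF q]
    by (intro exI[of _ "seminorm_topology Cm ?q"] exI[of _ ?U]) auto
qed

end


section \<open>Cut-off functions and local frames\<close>

context smooth_mfd
begin

text \<open>Smoothness is local, and \<open>V\<close> is covered by the parts inside
  \<open>W\<close> and outside \<open>K\<close>. The latter is open because compact sets are closed
  in the Hausdorff space \<open>M\<close>.\<close>

lemma smooth_fun_on_extend: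
  assumes "opn W" "opn V" "smooth_fun_on M (W \<inter> V) f" "compactin (mtop M) K" "K \<subseteq> W"
    and "\<And>x. x \<in> V \<Longrightarrow> x \<notin> K \<Longrightarrow> g x = (0 :: 'f::real_normed_vector)"
    and "\<And>x. x \<in> V \<Longrightarrow> x \<in> W \<Longrightarrow> g x = f x"
  shows "smooth_fun_on M V g"
proof (rule smooth_fun_on_local)
  fix x assume x: "x \<in> V"
  show "\<exists>W' h. opn W' \<and> x \<in> W' \<and> smooth_fun_on M W' h \<and> (\<forall>y\<in>W'. g y = h y)"
  proof (cases "x \<in> W")
    case True
    then show ?thesis
      using assms x by (intro exI[of _ "W \<inter> V"] exI[of _ f]) auto
  next
    case False
    have "opn (V - K)"
      using assms(2,4) compactin_imp_closedin[OF hausdorff] by blast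
    then show ?thesis
      using False assms(5,6) x smooth_fun_on_const[of "V - K" 0]
      by (intro exI[of _ "V - K"] exI[of _ "\<lambda>_. 0"]) auto
  qed
qed

text \<open>The squared distance in the chart is used because, unlike the distance in general, it is
  smooth at the centre too.\<close>

lemma smooth_fun_on_chart_bump:
  assumes U: "(U, c) \<in> atlas M"
  shows "smooth_fun_on M U (\<lambda>x. of_real (bump (inner (c x - z) (c x - z) * k)) :: 'k::real_or_complex)"
  unfolding smooth_fun_on_def
proof (intro ballI, clarify)
  fix V d assume V: "(V, d) \<in> atlas M"
  let ?O = "d ` (V \<inter> U)"
  let ?t = "\<lambda>y. (c \<circ> inv_into V d) y - z"
  have o: "open ?O" by (rule chart_open_image[OF V chart_open[OF U]])
  have t: "smooth_on ?O ?t"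
    by (rule smooth_on_minus[OF o chart_transition[OF V U] smooth_on_const])
  have "smooth_on ?O (\<lambda>y. of_real (bump (inner (?t y) (?t y) * k)) :: 'k)"
    by (rule smooth_on_bounded_linear[OF o smooth_on_bump[OF o smooth_on_mult[OF o smooth_on_inner[OF o t t]
            smooth_on_const]] bounded_linear_of_real])
  then show "smooth_on ?O ((\<lambda>x. of_real (bump (inner (c x - z) (c x - z) * k)) :: 'k) \<circ> inv_into V d)"
    by (simp add: comp_def)
qed

end

context exhausted_mfd
begin

lemma locally_compact: "neighbourhood_base_of (\<lambda>C. compactin (mtop M) C \<and> closedin (mtop M) C) (mtop M)"
proof -
  have "locally_compact_space (mtop M)"
    unfolding locally_compact_space_def
  proof
    fix x assume "x \<in> points M"
    then obtain n where "x \<in> L n" using L_cover by blast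
    then show "\<exists>U K. opn U \<and> compactin (mtop M) K \<and> x \<in> U \<and> U \<subseteq> K"
      using L_interior[of n] L_compact[of "Suc n"] interior_of_subset[of "mtop M" "L (Suc n)"]
      by (intro exI[of _ "mtop M interior_of L (Suc n)"] exI[of _ "L (Suc n)"]) auto
  qed
  then show ?thesis
    using locally_compact_regular_space_neighbourhood_base locally_compact_Hausdorff_imp_regular_space hausdorff
    by blast
qed

lemma cutoff_exists:
  assumes "opn W" "p \<in> W"
  obtains h :: "'m \<Rightarrow> 'k::real_or_complex" and K W' where "smooth_fun_on M (points M) h"
    "compactin (mtop M) K" "K \<subseteq> W" "\<And>x. x \<in> points M \<Longrightarrow> x \<notin> K \<Longrightarrow> h x = 0"
    "opn W'" "p \<in> W'" "\<And>x. x \<in> W' \<Longrightarrow> h x = 1"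
proof -
  have "p \<in> points M" using assms openin_subset by blast
  then obtain U c where U: "(U, c) \<in> atlas M" "p \<in> U" by (rule chart_cover)
  have "opn (U \<inter> W)" "p \<in> U \<inter> W" using chart_open[OF U(1)] assms U(2) by auto
  then obtain N K where N: "opn N" "compactin (mtop M) K" "p \<in> N" "N \<subseteq> K" "K \<subseteq> U \<inter> W"
    using locally_compact unfolding neighbourhood_base_of by meson
  have "open (c ` (U \<inter> N))" "c p \<in> c ` (U \<inter> N)"
    using chart_open_image[OF U(1) N(1)] U(2) N(3) by auto
  then obtain r where r: "r > 0" "ball (c p) r \<subseteq> c ` (U \<inter> N)"
    unfolding open_contains_ball by meson
  \<comment> \<open>Scaled so that \<open>q x < 1\<close> describes the ball of radius
    \<open>r\<close>, which lies in the image of \<open>N\<close>. Since \<open>bump\<close>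
    vanishes from 1 on, \<open>h\<close> vanishes off \<open>K\<close>.\<close>
  define q where "q x = inner (c x - c p) (c x - c p) * (1 / r\<^sup>2)" for x
  have q: "q x = (dist (c x) (c p) / r)\<^sup>2" for x
    by (simp add: q_def dot_square_norm dist_norm power_divide)
  define h :: "'m \<Rightarrow> 'k" where "h x = (if x \<in> U then of_real (bump (q x)) else 0)" for x
  have hK: "h x = 0" if "x \<notin> K" for x
  proof (cases "x \<in> U")
    case True
    have "c x \<notin> ball (c p) r"
    proof
      assume "c x \<in> ball (c p) r"
      then obtain y where "y \<in> U \<inter> N" "c x = c y" using r(2) by blast
      then have "x = y" using inj_onD[OF chart_inj[OF U(1)]] True by blast
      then show False using that N(4) \<open>y \<in> U \<inter> N\<close> by blast
    qed
    then have "1 \<le> dist (c x) (c p) / r"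
      using r(1) by (simp add: dist_commute)
    then have "1 \<le> q x"
      unfolding q by (rule one_le_power)
    then show ?thesis by (simp add: h_def bump_eq_0)
  qed (simp add: h_def)
  have UM: "U \<subseteq> points M" using openin_subset[OF chart_open[OF U(1)]] .
  show thesis
  proof
    show "smooth_fun_on M (points M) h"
    proof (rule smooth_fun_on_extend[OF chart_open[OF U(1)] openin_topspace _ N(2)])
      show "smooth_fun_on M (U \<inter> points M) (\<lambda>x. of_real (bump (inner (c x - c p) (c x - c p) * (1 / r\<^sup>2))) :: 'k)"
        unfolding Int_absorb2[OF UM] by (rule smooth_fun_on_chart_bump[OF U(1)])
    qed (use N(5) hK in \<open>auto simp: h_def q_def\<close>)
    \<comment> \<open>On the ball of half the radius \<open>q\<close> is at most 1/4, within the
      range up to 1/2 where \<open>bump\<close> is 1.\<close>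
    show "opn {x \<in> U. c x \<in> ball (c p) (r / 2)}"
      by (rule chart_preimage_open[OF U(1) open_ball])
    show "p \<in> {x \<in> U. c x \<in> ball (c p) (r / 2)}"
      using U(2) r(1) by simp
    show "h x = 1" if x: "x \<in> {x \<in> U. c x \<in> ball (c p) (r / 2)}" for x
    proof -
      have "dist (c x) (c p) / r \<le> 1 / 2"
        using x r(1) by (simp add: dist_commute divide_simps)
      then have "(dist (c x) (c p) / r)\<^sup>2 \<le> (1 / 2)\<^sup>2"
        using r(1) by (intro power_mono) auto
      then have "q x \<le> (1 / 2)\<^sup>2"
        unfolding q .
      also have "\<dots> \<le> 1 / 2"
        by (simp add: power2_eq_square)
      finally have "q x \<le> 1 / 2" .
      then show ?thesis using x by (simp add: h_def bump_eq_1)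
    qed
  qed (use N hK in auto)
qed

text \<open>A list keeps multiplicities in the sum of products. Both members of a pair share one
  compact set and one index \<open>i\<close>, which names the domain where they live.\<close>

definition cutoff_pairs :: "'i set \<Rightarrow> ('i \<Rightarrow> 'm set) \<Rightarrow> (('m \<Rightarrow> 'k::real_or_complex) \<times> ('m \<Rightarrow> 'k) \<times> 'i) list \<Rightarrow> bool"
  where "cutoff_pairs I D xs \<longleftrightarrow> (\<forall>(a, b, i)\<in>set xs. i \<in> I \<and>
    smooth_fun_on M (points M) a \<and> smooth_fun_on M (points M) b \<and>
    (\<exists>K. compactin (mtop M) K \<and> K \<subseteq> D i \<and> (\<forall>x\<in>points M - K. a x = 0 \<and> b x = 0)))"

text \<open>
  A substitute for a partition of unity: \<open>1 - (1 - h 1 * h 1) * \<dots> * (1 - h n * h n)\<close> is \<open>1\<close> wherever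
  some \<open>h i\<close> is, and it expands into a sum of products of pairs of cut-off functions.
\<close>

lemma cutoff_pairs_exist:
  fixes D :: "'i \<Rightarrow> 'm set"
  assumes open_D: "\<And>i. i \<in> I \<Longrightarrow> opn (D i)"
    and cover: "\<And>x. x \<in> points M \<Longrightarrow> \<exists>i\<in>I. x \<in> D i"
    and K: "compactin (mtop M) K"
  shows "\<exists>xs :: (('m \<Rightarrow> 'k::real_or_complex) \<times> ('m \<Rightarrow> 'k) \<times> 'i) list. cutoff_pairs I D xs \<and>
    (\<forall>x\<in>K. (\<Sum>(a, b, i)\<leftarrow>xs. a x * b x) = 1)"
proof -
  have "\<exists>i h C W. i \<in> I \<and> smooth_fun_on M (points M) (h :: 'm \<Rightarrow> 'k) \<and> compactin (mtop M) C \<and>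
    C \<subseteq> D i \<and> (\<forall>x\<in>points M - C. h x = 0) \<and> opn W \<and> p \<in> W \<and> (\<forall>x\<in>W. h x = 1)"
    if p: "p \<in> points M" for p
  proof -
    obtain i where i: "i \<in> I" "p \<in> D i" using cover[OF p] by blast
    obtain h :: "'m \<Rightarrow> 'k" and C W where h: "smooth_fun_on M (points M) h"
    "compactin (mtop M) C" "C \<subseteq> D i" "\<And>x. x \<in> points M \<Longrightarrow> x \<notin> C \<Longrightarrow> h x = 0"
    "opn W" "p \<in> W" "\<And>x. x \<in> W \<Longrightarrow> h x = 1"
      by (rule cutoff_exists[OF open_D[OF i(1)] i(2)]) (rule that)
    show ?thesis
      by (rule exI[of _ i], rule exI[of _ h], rule exI[of _ C], rule exI[of _ W]) (use i h in auto)
  qed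
  then obtain i h C W where iI: "\<And>p. p \<in> points M \<Longrightarrow> i p \<in> I"
    and h: "\<And>p. p \<in> points M \<Longrightarrow> smooth_fun_on M (points M) (h p :: 'm \<Rightarrow> 'k)"
    and C: "\<And>p. p \<in> points M \<Longrightarrow> compactin (mtop M) (C p) \<and> C p \<subseteq> D (i p) \<and> (\<forall>x\<in>points M - C p. h p x = 0)"
    and W: "\<And>p. p \<in> points M \<Longrightarrow> opn (W p) \<and> p \<in> W p \<and> (\<forall>x\<in>W p. h p x = 1)"
    by metis
  have KM: "K \<subseteq> points M" using compactin_subset_topspace[OF K] .
  have "K \<subseteq> \<Union> (W ` points M)" using KM W by blast
  then obtain \<F> where F: "finite \<F>" "\<F> \<subseteq> W ` points M" "K \<subseteq> \<Union>\<F>"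
    using compactinD[OF K, of "W ` points M"] W by (metis (no_types, lifting) imageE)
  then obtain A where A: "finite A" "A \<subseteq> points M" "\<F> = W ` A"
    by (metis finite_subset_image)
  have "\<exists>xs :: (('m \<Rightarrow> 'k) \<times> ('m \<Rightarrow> 'k) \<times> 'i) list. cutoff_pairs I D xs \<and>
      (\<forall>x\<in>\<Union> (W ` A). (\<Sum>(a, b, i)\<leftarrow>xs. a x * b x) = 1)"
    using A(1,2)
  proof (induction A rule: finite_induct)
    case empty
    then show ?case by (intro exI[of _ "[]"]) (simp add: cutoff_pairs_def)
  next
    case (insert p A)
    then obtain xs :: "(('m \<Rightarrow> 'k) \<times> ('m \<Rightarrow> 'k) \<times> 'i) list" where xs: "cutoff_pairs I D xs"
      "\<forall>x\<in>\<Union> (W ` A). (\<Sum>(a, b, i)\<leftarrow>xs. a x * b x) = 1"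
      by auto
    have p: "p \<in> points M" using insert.prems by blast
    \<comment> \<open>If S is the sum of products for \<open>xs\<close>, the new sum S g + h^2 is 1
      - (1 - S)(1 - h^2), so the value 1 is kept where S was 1 and attained where h is 1.\<close>
    define g where "g x = 1 + (- 1) * (h p x * h p x)" for x
    have g: "smooth_fun_on M (points M) g"
      unfolding g_def using h[OF p]
      by (intro smooth_fun_on_add smooth_fun_on_mult smooth_fun_on_const) auto
    \<comment> \<open>The factor \<open>g\<close> multiplies one member of each pair, so that the
      product of the pair gains it exactly once; the old compact sets still work.\<close>
    define ys where "ys = map (\<lambda>(a, b, i). (\<lambda>x. a x * g x, b, i)) xs @ [(h p, h p, i p)]"
    have val: "(\<Sum>(a, b, i)\<leftarrow>ys. a x * b x) = (\<Sum>(a, b, i)\<leftarrow>xs. a x * b x) * g x + h p x * h p x" for x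
      unfolding ys_def by (induction xs) (auto simp: algebra_simps)
    have "cutoff_pairs I D ys"
      unfolding cutoff_pairs_def
    proof (clarify)
      fix a b j assume "(a, b, j) \<in> set ys"
      then consider a' where "(a', b, j) \<in> set xs" "a = (\<lambda>x. a' x * g x)" | "a = h p" "b = h p" "j = i p"
        unfolding ys_def by auto
      then show "j \<in> I \<and> smooth_fun_on M (points M) a \<and> smooth_fun_on M (points M) b \<and>
          (\<exists>K. compactin (mtop M) K \<and> K \<subseteq> D j \<and> (\<forall>x\<in>points M - K. a x = 0 \<and> b x = 0))"
      proof cases
        case 1
        then have "j \<in> I" "smooth_fun_on M (points M) a'" "smooth_fun_on M (points M) b"
          "\<exists>K. compactin (mtop M) K \<and> K \<subseteq> D j \<and> (\<forall>x\<in>points M - K. a' x = 0 \<and> b x = 0)"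
          using xs(1) unfolding cutoff_pairs_def by fast+
        then show ?thesis
          using 1(2) smooth_fun_on_mult[OF openin_topspace _ g, of a'] by auto
      next
        case 2
        then show ?thesis using iI[OF p] h[OF p] C[OF p] by auto
      qed
    qed
    moreover have "(\<Sum>(a, b, i)\<leftarrow>ys. a x * b x) = 1" if x: "x \<in> \<Union> (W ` insert p A)" for x
    proof (cases "x \<in> W p")
      case True
      then have "h p x = 1" using W[OF p] by blast
      then show ?thesis unfolding val by (simp add: g_def)
    next
      case False
      then have "(\<Sum>(a, b, i)\<leftarrow>xs. a x * b x) = 1" using x xs(2) by blast
      then show ?thesis unfolding val by (simp add: g_def)
    qed
    ultimately show ?case by blast
  qed
  then show ?thesis
    using F(3) A(3) by (meson subsetD)
qed

end


section \<open>Local frames of a vector bundle\<close>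

locale smooth_vector_bundle = smooth_mfd M
  for M :: "('m, 'e::real_inner) manifold" +
  fixes E :: "('k::real_or_complex, 'm, 'v) vec_bundle"
  assumes vector_bundle: "vector_bundle M E"
begin

lemma bundle_triv:
  assumes "(V, r, \<phi>) \<in> trivs E"
  shows "openin (mtop M) V" "x \<in> V \<Longrightarrow> \<phi> x \<in> linear_iso (fiber E x) (tuples r)"
proof -
  have "\<forall>(U, r, \<phi>)\<in>trivs E. openin (mtop M) U \<and> (\<forall>x\<in>U. \<phi> x \<in> linear_iso (fiber E x) (tuples r))"
    using vector_bundle unfolding vector_bundle_def by (elim conjE)
  then show "openin (mtop M) V" "x \<in> V \<Longrightarrow> \<phi> x \<in> linear_iso (fiber E x) (tuples r)"
    using assms by auto
qed

lemma triv_iso: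
  assumes "(V, r, \<phi>) \<in> trivs E" "x \<in> V"
  shows "bij_betw (\<phi> x) (carrier (fiber E x)) {v. \<forall>i\<ge>r. v i = 0}"
    and "v \<in> carrier (fiber E x) \<Longrightarrow> w \<in> carrier (fiber E x) \<Longrightarrow> \<phi> x (v \<oplus>\<^bsub>fiber E x\<^esub> w) i = \<phi> x v i + \<phi> x w i"
    and "v \<in> carrier (fiber E x) \<Longrightarrow> \<phi> x (k \<odot>\<^bsub>fiber E x\<^esub> v) i = k * \<phi> x v i"
  using bundle_triv(2)[OF assms] unfolding linear_iso_def by (auto simp: tuples_def)

sublocale smooth_bundle M E
proof (rule smooth_bundle.intro[OF smooth_mfd_axioms smooth_bundle_axioms.intro])
  show fib: "vec_space (fiber E x)" if "x \<in> points M" for x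
    using vector_bundle that unfolding vector_bundle_def vec_space_iff by blast
  show "openin (mtop M) V" if "(V, r, \<phi>) \<in> trivs E" for V r \<phi>
    by (rule bundle_triv(1)[OF that])
  show "\<exists>V r \<phi>. (V, r, \<phi>) \<in> trivs E \<and> x \<in> V" if "x \<in> points M" for x
  proof -
    have "(\<Union>(U, r, \<phi>)\<in>trivs E. U) = points M"
      using vector_bundle unfolding vector_bundle_def by (elim conjE)
    then show ?thesis using that by blast
  qed
  show "v = \<zero>\<^bsub>fiber E x\<^esub>" if V: "(V, r, \<phi>) \<in> trivs E" "x \<in> V" and v: "v \<in> carrier (fiber E x)"
    and z: "\<And>i. i < r \<Longrightarrow> \<phi> x v i = 0" for V r \<phi> x v
  proof -
    have "x \<in> points M" using openin_subset[OF bundle_triv(1)[OF V(1)]] V(2) by blast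
    then interpret F: vec_space "fiber E x" by (rule fib)
    have "\<phi> x v \<in> {v. \<forall>i\<ge>r. v i = 0}"
      using bij_betwE[OF triv_iso(1)[OF V]] v by blast
    then have "\<phi> x v = (\<lambda>_. 0)"
      using z by (auto simp: fun_eq_iff) (meson not_le)
    moreover have "\<phi> x \<zero>\<^bsub>fiber E x\<^esub> = (\<lambda>_. 0)"
      using triv_iso(3)[OF V F.M.zero_closed, of 0] by (auto simp: fun_eq_iff)
    ultimately show ?thesis
      using inj_onD[OF bij_betw_imp_inj_on[OF triv_iso(1)[OF V]]] v F.M.zero_closed by metis
  qed
qed (use triv_iso in blast)+

definition frame :: "('m \<Rightarrow> 'v \<Rightarrow> nat \<Rightarrow> 'k) \<Rightarrow> nat \<Rightarrow> 'm \<Rightarrow> 'v"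
  where "frame \<phi> j x = inv_into (carrier (fiber E x)) (\<phi> x) (unit_tuple j)"

lemma frame:
  assumes V: "(V, r, \<phi>) \<in> trivs E" "x \<in> V" "j < r"
  shows frame_in: "frame \<phi> j x \<in> carrier (fiber E x)"
    and frame_coord: "\<phi> x (frame \<phi> j x) i = (if i = j then 1 else 0)"
proof -
  have u: "(unit_tuple j :: nat \<Rightarrow> 'k) \<in> \<phi> x ` carrier (fiber E x)"
    using bij_betw_imp_surj_on[OF triv_iso(1)[OF V(1,2)]] V(3) by (simp add: unit_tuple_def)
  show "frame \<phi> j x \<in> carrier (fiber E x)"
    unfolding frame_def by (rule inv_into_into[OF u])
  show "\<phi> x (frame \<phi> j x) i = (if i = j then 1 else 0)"
    unfolding frame_def f_inv_into_f[OF u] by (simp add: unit_tuple_def)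
qed

lemma frame_transition:
  assumes "(V, r, \<phi>) \<in> trivs E" "(V', r', \<phi>') \<in> trivs E" "j < r" "i < r'"
  shows "smooth_fun_on M (V \<inter> V') (\<lambda>x. \<phi>' x (frame \<phi> j x) i)"
proof -
  have "\<forall>(U, r, \<phi>)\<in>trivs E. \<forall>(V, s, \<psi>)\<in>trivs E. \<forall>j<r. \<forall>i<s.
      smooth_fun_on M (U \<inter> V) (\<lambda>x. \<psi> x (inv_into (carrier (fiber E x)) (\<phi> x) (unit_tuple j)) i)"
    using vector_bundle unfolding vector_bundle_def by (elim conjE)
  then show ?thesis
    using assms unfolding frame_def by fast
qed

lemma triv_finsum:
  assumes "(V, r, \<phi>) \<in> trivs E" "x \<in> V" "finite A" "\<And>a. a \<in> A \<Longrightarrow> g a \<in> carrier (fiber E x)"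
  shows "\<phi> x (finsum (fiber E x) g A) i = (\<Sum>a\<in>A. \<phi> x (g a) i)"
proof -
  have "x \<in> points M" using assms triv_subset by blast
  then interpret F: vec_space "fiber E x" by (rule vec_space_fiber)
  show ?thesis
    using assms(3,4)
  proof (induction A rule: finite_induct)
    case empty
    then show ?case using triv_zero[OF assms(1,2)] by simp
  next
    case (insert a A)
    then show ?case
      using triv_add[OF assms(1,2)] by (simp add: F.M.finsum_insert Pi_def F.M.finsum_closed)
  qed
qed

lemma frame_expansion:
  assumes V: "(V, r, \<phi>) \<in> trivs E" "x \<in> V" and v: "v \<in> carrier (fiber E x)"
  shows "v = finsum (fiber E x) (\<lambda>j. \<phi> x v j \<odot>\<^bsub>fiber E x\<^esub> frame \<phi> j x) {..<r}"
proof -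
  have x: "x \<in> points M" using V triv_subset by blast
  interpret F: vec_space "fiber E x" by (rule vec_space_fiber[OF x])
  let ?w = "finsum (fiber E x) (\<lambda>j. \<phi> x v j \<odot>\<^bsub>fiber E x\<^esub> frame \<phi> j x) {..<r}"
  have c: "\<phi> x v j \<odot>\<^bsub>fiber E x\<^esub> frame \<phi> j x \<in> carrier (fiber E x)" if "j < r" for j
    using frame_in[OF V that] by simp
  have w: "?w \<in> carrier (fiber E x)"
    using c by (intro F.M.finsum_closed) auto
  have m: "(- 1) \<odot>\<^bsub>fiber E x\<^esub> ?w \<in> carrier (fiber E x)" using w by simp
  have eq: "\<phi> x ?w i = \<phi> x v i" if i: "i < r" for i
  proof -
    have "\<phi> x ?w i = (\<Sum>j<r. \<phi> x (\<phi> x v j \<odot>\<^bsub>fiber E x\<^esub> frame \<phi> j x) i)"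
      using c by (intro triv_finsum[OF V]) auto
    also have "\<dots> = (\<Sum>j<r. if i = j then \<phi> x v j else 0)"
      using frame_in[OF V] frame_coord[OF V] triv_scale[OF V] by (intro sum.cong) auto
    also have "\<dots> = \<phi> x v i" using i by simp
    finally show ?thesis .
  qed
  have "v \<oplus>\<^bsub>fiber E x\<^esub> (- 1) \<odot>\<^bsub>fiber E x\<^esub> ?w = \<zero>\<^bsub>fiber E x\<^esub>"
    by (rule triv_inj[OF V F.M.a_closed[OF v m]])
      (simp add: triv_add[OF V v m] triv_scale[OF V w] eq)
  then have "v \<oplus>\<^bsub>fiber E x\<^esub> \<ominus>\<^bsub>fiber E x\<^esub> ?w = \<zero>\<^bsub>fiber E x\<^esub>"
    using F.scale_minus_1[OF w] by simp
  then show ?thesis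
    using F.M.minus_equality[of v "\<ominus>\<^bsub>fiber E x\<^esub> ?w"] v w by simp
qed

text \<open>In another trivialization the components are \<open>b\<close> times entries of the
  transition matrix, hence smooth on the overlap; the vanishing of \<open>b\<close> off
  \<open>K\<close> extends them by zero.\<close>

lemma frame_section:
  assumes V: "(V, r, \<phi>) \<in> trivs E" "j < r"
    and b: "smooth_fun_on M (points M) b" and K: "compactin (mtop M) K" "K \<subseteq> V" "\<And>x. x \<in> points M - K \<Longrightarrow> b x = 0"
  shows "(\<lambda>x\<in>points M. if x \<in> V then b x \<odot>\<^bsub>fiber E x\<^esub> frame \<phi> j x else \<zero>\<^bsub>fiber E x\<^esub>) \<in> Sec"
proof (rule sectionsI)
  fix x assume x: "x \<in> points M"
  interpret F: vec_space "fiber E x" by (rule vec_space_fiber[OF x])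
  show "(\<lambda>x\<in>points M. if x \<in> V then b x \<odot>\<^bsub>fiber E x\<^esub> frame \<phi> j x else \<zero>\<^bsub>fiber E x\<^esub>) x \<in> carrier (fiber E x)"
    using x frame_in[OF V(1) _ V(2)] by simp
next
  fix V' r' \<phi>' i assume V': "(V', r', \<phi>') \<in> trivs E" "i < r'"
  let ?s = "\<lambda>x\<in>points M. if x \<in> V then b x \<odot>\<^bsub>fiber E x\<^esub> frame \<phi> j x else \<zero>\<^bsub>fiber E x\<^esub>"
  have sub: "V' \<subseteq> points M" using triv_subset[OF V'(1)] .
  have o: "opn (V \<inter> V')" using triv_open[OF V(1)] triv_open[OF V'(1)] by blast
  show "smooth_fun_on M V' (coord \<phi>' i ?s)"
  proof (rule smooth_fun_on_extend[OF triv_open[OF V(1)] triv_open[OF V'(1)] _ K(1,2)])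
    show "smooth_fun_on M (V \<inter> V') (\<lambda>x. b x * \<phi>' x (frame \<phi> j x) i)"
      by (rule smooth_fun_on_mult[OF o smooth_fun_on_subset[OF b] frame_transition[OF V(1) V'(1) V(2) V'(2)]])
        (use sub in blast)
    show "\<phi>' x (?s x) i = b x * \<phi>' x (frame \<phi> j x) i" if "x \<in> V'" "x \<in> V" for x
      using that sub triv_scale[OF V'(1) that(1) frame_in[OF V(1) that(2) V(2)]] by auto
    show "\<phi>' x (?s x) i = 0" if x: "x \<in> V'" "x \<notin> K" for x
      using x sub K(3)[of x] triv_zero[OF V'(1) x(1)] triv_scale[OF V'(1) x(1) frame_in[OF V(1) _ V(2)]]
      by auto
  qed
qed simp

end


section \<open>The tensor product bundle\<close>

text \<open>All sequences serve as target, rather than \<open>tuples\<close>, so that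
  \<open>tensor_triv\<close> can be treated as a linear map without checking at which indices its
  components vanish.\<close>

definition fun_space :: "('k::field, nat \<Rightarrow> 'k) module"
  where "fun_space = mk_module UNIV (\<lambda>_. 0) (\<lambda>v w i. v i + w i) (\<lambda>c v i. c * v i)"

lemma fun_space_simps [simp]:
  "carrier fun_space = UNIV" "\<zero>\<^bsub>fun_space\<^esub> = (\<lambda>_. 0)"
  "v \<oplus>\<^bsub>fun_space\<^esub> w = (\<lambda>i. v i + w i)" "c \<odot>\<^bsub>fun_space\<^esub> v = (\<lambda>i. c * v i)"
  by (simp_all add: fun_space_def)

lemma vec_space_fun_space: "vec_space fun_space"
  by (rule vec_spaceI) (auto simp: algebra_simps)

lemma finsum_fun_space: "finite A \<Longrightarrow> finsum fun_space h A = (\<lambda>k. \<Sum>a\<in>A. h a k)"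
proof (induction A rule: finite_induct)
  case empty
  interpret vec_space fun_space by (rule vec_space_fun_space)
  show ?case by simp
next
  case (insert a A)
  interpret vec_space fun_space by (rule vec_space_fun_space)
  show ?case using insert by (simp add: M.finsum_insert)
qed

text \<open>Makes the universal property available for \<open>tensor_triv\<close>: linearity and the
  values on pure tensors follow from \<open>bilinear_map\<close>.\<close>

lemma tensor_triv_eq:
  "tensor_triv s f g = tensor_lift fun_space (\<lambda>v w k. f v (k div s) * g w (k mod s))"
proof
  fix Y
  have "(\<lambda>u k. \<Sum>(v, w)\<in>Poly_Mapping.keys u. Poly_Mapping.lookup u (v, w) * f v (k div s) * g w (k mod s))
      = lin_ext fun_space (\<lambda>(v, w) k. f v (k div s) * g w (k mod s))"
    unfolding lin_ext_def by (intro ext) (simp add: finsum_fun_space case_prod_beta mult.assoc)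
  then show "tensor_triv s f g Y = tensor_lift fun_space (\<lambda>v w k. f v (k div s) * g w (k mod s)) Y"
    unfolding tensor_triv_def tensor_lift_def induced_map_def by (simp only:)
qed

lemma (in vec_space) scale_sum_left:
  "finite A \<Longrightarrow> x \<in> carrier V \<Longrightarrow> (\<Sum>a\<in>A. c a) \<odot> x = finsum V (\<lambda>a. c a \<odot> x) A"
  by (induction A rule: finite_induct) (simp_all add: M.finsum_insert scale_add Pi_def)

context tensor_spaces
begin

lemma pure_zero_left: "q \<in> carrier Q \<Longrightarrow> pure_tensor P Q \<zero>\<^bsub>P\<^esub> q = \<zero>\<^bsub>tensor_module P Q\<^esub>"
proof -
  assume q: "q \<in> carrier Q"
  interpret PQ: vec_space "tensor_module P Q" by (rule vec_space_tensor)
  show ?thesis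
    using pure_scale_left[OF P.M.zero_closed q, of 0] q by simp
qed

lemma pure_linear_right: "p \<in> carrier P \<Longrightarrow> (\<lambda>q. pure_tensor P Q p q) \<in> linear_maps Q (tensor_module P Q)"
  unfolding linear_maps_def by (auto simp: pure_add_right pure_scale_right)

lemma pure_linear_left: "q \<in> carrier Q \<Longrightarrow> (\<lambda>p. pure_tensor P Q p q) \<in> linear_maps P (tensor_module P Q)"
  unfolding linear_maps_def by (auto simp: pure_add_left pure_scale_left)

end

locale two_bundles = exhausted_mfd M L + BE: smooth_vector_bundle M E + BF: smooth_vector_bundle M F
  for M :: "('m, 'e::real_inner) manifold" and L :: "nat \<Rightarrow> 'm set"
    and E :: "('k::real_or_complex, 'm, 'v) vec_bundle" and F :: "('k, 'm, 'w) vec_bundle"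
begin

abbreviation "T \<equiv> tensor_bundle E F"
abbreviation "TM x \<equiv> tensor_module (fiber E x) (fiber F x)"
abbreviation "tp x \<equiv> pure_tensor (fiber E x) (fiber F x)"

lemma fiber_T: "fiber T x = TM x"
  by (simp add: tensor_bundle_def)

lemma trivs_TE:
  assumes "(W, r', \<theta>) \<in> trivs T"
  obtains U r \<phi> V s \<psi> where "(U, r, \<phi>) \<in> trivs E" "(V, s, \<psi>) \<in> trivs F" "W = U \<inter> V" "r' = r * s"
    "\<theta> = (\<lambda>x. tensor_triv s (\<phi> x) (\<psi> x))"
  using assms that unfolding tensor_bundle_def by auto

lemma trivs_TI:
  "(U, r, \<phi>) \<in> trivs E \<Longrightarrow> (V, s, \<psi>) \<in> trivs F \<Longrightarrow>
    (U \<inter> V, r * s, \<lambda>x. tensor_triv s (\<phi> x) (\<psi> x)) \<in> trivs T"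
  unfolding tensor_bundle_def vec_bundle.simps by blast

lemma tensor_spaces_fiber: "x \<in> points M \<Longrightarrow> tensor_spaces (fiber E x) (fiber F x)"
  unfolding tensor_spaces_def using BE.vec_space_fiber BF.vec_space_fiber by blast

lemma bilinear_triv:
  assumes "(U, r, \<phi>) \<in> trivs E" "x \<in> U" "(V, s, \<psi>) \<in> trivs F" "x \<in> V"
  shows "bilinear_map (fiber E x) (fiber F x) fun_space (\<lambda>v w k. \<phi> x v (k div s) * \<psi> x w (k mod s))"
proof (rule bilinear_map.intro[OF tensor_spaces_fiber vec_space_fun_space bilinear_map_axioms.intro])
  show "x \<in> points M" using assms BE.triv_subset by blast
qed (auto simp: BE.triv_add[OF assms(1,2)] BE.triv_scale[OF assms(1,2)] BF.triv_add[OF assms(3,4)]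
    BF.triv_scale[OF assms(3,4)] algebra_simps)

lemma tensor_triv_linear:
  assumes "(U, r, \<phi>) \<in> trivs E" "x \<in> U" "(V, s, \<psi>) \<in> trivs F" "x \<in> V"
  shows "tensor_triv s (\<phi> x) (\<psi> x) \<in> linear_maps (TM x) fun_space"
  unfolding tensor_triv_eq by (rule bilinear_map.lift_linear[OF bilinear_triv[OF assms]])

lemma tensor_triv_pure:
  assumes "(U, r, \<phi>) \<in> trivs E" "x \<in> U" "(V, s, \<psi>) \<in> trivs F" "x \<in> V"
    and "v \<in> carrier (fiber E x)" "w \<in> carrier (fiber F x)"
  shows "tensor_triv s (\<phi> x) (\<psi> x) (tp x v w) k = \<phi> x v (k div s) * \<psi> x w (k mod s)"
  unfolding tensor_triv_eq bilinear_map.lift_pure[OF bilinear_triv[OF assms(1-4)] assms(5,6)] ..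

text \<open>The map id \<otimes> e'_j on one fiber, where the dual frame element e'_j is the j-th
  coordinate of \<psi>.\<close>

definition contraction :: "('m \<Rightarrow> 'w \<Rightarrow> nat \<Rightarrow> 'k) \<Rightarrow> nat \<Rightarrow> 'm \<Rightarrow> (('v \<times> 'w) \<Rightarrow>\<^sub>0 'k) set \<Rightarrow> 'v"
  where "contraction \<psi> j x = tensor_lift (fiber E x) (\<lambda>v w. \<psi> x w j \<odot>\<^bsub>fiber E x\<^esub> v)"

context
  fixes V s \<psi> x
  assumes Vx: "(V, s, \<psi>) \<in> trivs F" "x \<in> V"
begin

lemma Vx_point: "x \<in> points M"
  using Vx BF.triv_subset by blast

interpretation FE: vec_space "fiber E x" by (rule BE.vec_space_fiber[OF Vx_point])
interpretation FF: vec_space "fiber F x" by (rule BF.vec_space_fiber[OF Vx_point])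
interpretation TS: tensor_spaces "fiber E x" "fiber F x" by (rule tensor_spaces_fiber[OF Vx_point])

lemma bilinear_contraction:
  "bilinear_map (fiber E x) (fiber F x) (fiber E x) (\<lambda>v w. \<psi> x w j \<odot>\<^bsub>fiber E x\<^esub> v)"
  by (rule bilinear_map.intro[OF tensor_spaces_fiber[OF Vx_point] FE.vec_space_axioms bilinear_map_axioms.intro])
    (auto simp: BF.triv_add[OF Vx] BF.triv_scale[OF Vx] FE.scale_distrib FE.scale_add FE.scale_scale mult.commute)

lemma contraction_linear: "contraction \<psi> j x \<in> linear_maps (TM x) (fiber E x)"
  unfolding contraction_def by (rule bilinear_map.lift_linear[OF bilinear_contraction])

lemma contraction_pure: "v \<in> carrier (fiber E x) \<Longrightarrow> w \<in> carrier (fiber F x) \<Longrightarrow>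
    contraction \<psi> j x (tp x v w) = \<psi> x w j \<odot>\<^bsub>fiber E x\<^esub> v"
  unfolding contraction_def by (rule bilinear_map.lift_pure[OF bilinear_contraction])

text \<open>Both sides are additive in \<open>z\<close>, so pure tensors suffice. There the claim
  amounts to \<open>k * s + j\<close> having quotient \<open>k\<close> and remainder
  \<open>j\<close> on division by \<open>s\<close>.\<close>

lemma contraction_coord:
  assumes U: "(U, r, \<phi>) \<in> trivs E" "x \<in> U" and z: "z \<in> carrier (TM x)" and j: "j < s"
  shows "\<phi> x (contraction \<psi> j x z) k = tensor_triv s (\<phi> x) (\<psi> x) z (k * s + j)"
  using z
proof (induction rule: TS.tensor_induct)
  case (pure p q)
  then show ?case
    using j by (simp add: contraction_pure tensor_triv_pure[OF U Vx] BE.triv_scale[OF U])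
next
  case (add y z)
  then show ?case
    using linear_mapsD(1,2)[OF contraction_linear] linear_mapsD(2)[OF tensor_triv_linear[OF U Vx]]
    by (simp add: BE.triv_add[OF U])
qed

text \<open>By linearity only pure tensors matter. For them the coordinates of the right factor
  cross the tensor sign, and the frame expansion in the fiber of \<open>F\<close> restores that
  factor. This identity is behind \<open>lift_R\<close>.\<close>

lemma contraction_expansion:
  assumes z: "z \<in> carrier (TM x)"
  shows "finsum (TM x)
    (\<lambda>j. tp x (contraction \<psi> j x z) (BF.frame \<psi> j x)) {..<s} = z"
proof -
  let ?T = "TM x"
  let ?R = "\<lambda>z. finsum ?T (\<lambda>j. tp x (contraction \<psi> j x z) (BF.frame \<psi> j x)) {..<s}"
  have R: "?R \<in> linear_maps ?T ?T"
    by (rule linear_maps_finsum_fun[OF TS.vec_space_tensor TS.vec_space_tensor])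
      (auto intro!: linear_maps_comp[OF contraction_linear] TS.pure_linear_left BF.frame_in[OF Vx])
  show ?thesis
    using z
  proof (induction rule: TS.tensor_induct)
    case (pure p q)
    interpret PQ: vec_space ?T by (rule TS.vec_space_tensor)
    have "?R (tp x p q)
        = finsum ?T (\<lambda>j. tp x p (\<psi> x q j \<odot>\<^bsub>fiber F x\<^esub> BF.frame \<psi> j x)) {..<s}"
      using pure BF.frame_in[OF Vx]
      by (intro PQ.M.finsum_cong') (auto simp: contraction_pure TS.pure_scale_left TS.pure_scale_right)
    also have "\<dots> = tp x p (finsum (fiber F x) (\<lambda>j. \<psi> x q j \<odot>\<^bsub>fiber F x\<^esub> BF.frame \<psi> j x) {..<s})"
      using BF.frame_in[OF Vx]
      by (intro linear_maps_finsum[OF FF.vec_space_axioms TS.vec_space_tensor TS.pure_linear_right[OF pure(1)], symmetric]) auto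
    also have "\<dots> = tp x p q"
      using BF.frame_expansion[OF Vx pure(2)] by simp
    finally show ?case .
  next
    case (add y z)
    then show ?case
      using linear_mapsD(2)[OF R add(1,2)] by simp
  qed
qed

text \<open>Vanishing components make every contraction vanish, by injectivity of the trivialization
  of \<open>E\<close>; the expansion of \<open>z\<close> is then a sum of zeros.\<close>

lemma tensor_triv_inj:
  assumes U: "(U, r, \<phi>) \<in> trivs E" "x \<in> U" and z: "z \<in> carrier (TM x)"
    and 0: "\<And>i. i < r * s \<Longrightarrow> tensor_triv s (\<phi> x) (\<psi> x) z i = 0"
  shows "z = \<zero>\<^bsub>TM x\<^esub>"
proof -
  let ?T = "TM x"
  interpret PQ: vec_space ?T by (rule TS.vec_space_tensor)
  have "contraction \<psi> j x z = \<zero>\<^bsub>fiber E x\<^esub>" if j: "j < s" for j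
  proof (rule BE.triv_inj[OF U linear_mapsD(1)[OF contraction_linear z]])
    fix k assume "k < r"
    then have "k * s + j < r * s"
      using j by (metis Suc_leI add_less_cancel_left less_le_trans mult_Suc mult_le_mono1 add.commute)
    then show "\<phi> x (contraction \<psi> j x z) k = 0"
      unfolding contraction_coord[OF U z j] by (rule 0)
  qed
  then have "finsum ?T (\<lambda>j. tp x (contraction \<psi> j x z) (BF.frame \<psi> j x)) {..<s}
      = finsum ?T (\<lambda>j. \<zero>\<^bsub>?T\<^esub>) {..<s}"
    using BF.frame_in[OF Vx] by (intro PQ.M.finsum_cong') (auto simp: TS.pure_zero_left)
  then show ?thesis
    unfolding contraction_expansion[OF z] by simp
qed

end

sublocale BT: smooth_bundle M T
proof (rule smooth_bundle.intro[OF smooth_mfd_axioms smooth_bundle_axioms.intro])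
  show "vec_space (fiber T x)" if "x \<in> points M" for x
    unfolding fiber_T by (rule tensor_spaces.vec_space_tensor[OF tensor_spaces_fiber[OF that]])
  show "openin (mtop M) W" if "(W, r', \<theta>) \<in> trivs T" for W r' \<theta>
    using that BE.triv_open BF.triv_open by (elim trivs_TE) blast
  show "\<exists>W r' \<theta>. (W, r', \<theta>) \<in> trivs T \<and> x \<in> W" if x: "x \<in> points M" for x
  proof -
    obtain U r \<phi> V s \<psi> where "(U, r, \<phi>) \<in> trivs E" "x \<in> U" "(V, s, \<psi>) \<in> trivs F" "x \<in> V"
      using BE.triv_cover[OF x] BF.triv_cover[OF x] by blast
    then show ?thesis using trivs_TI[of U r \<phi> V s \<psi>] by blast
  qed
next
  fix W r' \<theta> x v w i assume W: "(W, r', \<theta>) \<in> trivs T" "x \<in> W" and v: "v \<in> carrier (fiber T x)"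
  then obtain U r \<phi> V s \<psi> where U: "(U, r, \<phi>) \<in> trivs E" "x \<in> U" and V: "(V, s, \<psi>) \<in> trivs F" "x \<in> V"
    and eq: "r' = r * s" "\<theta> = (\<lambda>x. tensor_triv s (\<phi> x) (\<psi> x))"
    by (elim trivs_TE) blast
  note lin = linear_mapsD[OF tensor_triv_linear[OF U V]]
  show "\<theta> x (v \<oplus>\<^bsub>fiber T x\<^esub> w) i = \<theta> x v i + \<theta> x w i" if "w \<in> carrier (fiber T x)"
    using lin(2) v that by (simp add: eq fiber_T)
  show "\<theta> x (k \<odot>\<^bsub>fiber T x\<^esub> v) i = k * \<theta> x v i" for k
    using lin(3) v by (simp add: eq fiber_T)
  show "v = \<zero>\<^bsub>fiber T x\<^esub>" if "\<And>i. i < r' \<Longrightarrow> \<theta> x v i = 0"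
    unfolding fiber_T by (rule tensor_triv_inj[OF V U]) (use v that in \<open>simp_all add: eq fiber_T\<close>)
qed

sublocale XE: exhausted_bundle M L E
  by unfold_locales

sublocale XT: exhausted_bundle M L T
  by unfold_locales


subsection \<open>Products and contractions of sections\<close>

definition tsec :: "('m \<Rightarrow> 'v) \<Rightarrow> ('m \<Rightarrow> 'w) \<Rightarrow> 'm \<Rightarrow> (('v \<times> 'w) \<Rightarrow>\<^sub>0 'k) set"
  where "tsec s t = (\<lambda>x\<in>points M. tp x (s x) (t x))"

lemma tsec_in:
  assumes s: "s \<in> BE.Sec" and t: "t \<in> BF.Sec"
  shows "tsec s t \<in> BT.Sec"
proof (rule BT.sectionsI)
  show "tsec s t x \<in> carrier (fiber T x)" if x: "x \<in> points M" for x
    using tensor_spaces.pure_in[OF tensor_spaces_fiber[OF x]] BE.sectionsD(1)[OF s x] BF.sectionsD(1)[OF t x] x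
    by (simp add: tsec_def fiber_T)
  show "tsec s t x = undefined" if "x \<notin> points M" for x
    using that by (simp add: tsec_def)
  fix W r' \<theta> i assume W: "(W, r', \<theta>) \<in> trivs T" "i < r'"
  obtain U r \<phi> V k \<psi> where U: "(U, r, \<phi>) \<in> trivs E" and V: "(V, k, \<psi>) \<in> trivs F" and eq: "W = U \<inter> V" "r' = r * k"
    "\<theta> = (\<lambda>x. tensor_triv k (\<phi> x) (\<psi> x))"
    using W(1) by (rule trivs_TE)
  \<comment> \<open>An index below \<open>r * k\<close> exists, so the rank \<open>k\<close> is
    positive and the remainder modulo \<open>k\<close> is an admissible index.\<close>
  have "0 < k"
    using W(2) unfolding eq by (cases k) auto
  then have i: "i div k < r" "i mod k < k"
    using W(2) unfolding eq by (simp_all add: less_mult_imp_div_less)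
  have o: "opn (U \<inter> V)" using BE.triv_open[OF U] BF.triv_open[OF V] by blast
  have "smooth_fun_on M (U \<inter> V) (\<lambda>x. \<phi> x (s x) (i div k) * \<psi> x (t x) (i mod k))"
    by (rule smooth_fun_on_mult[OF o smooth_fun_on_subset[OF BE.sectionsD(3)[OF s U i(1)]]
          smooth_fun_on_subset[OF BF.sectionsD(3)[OF t V i(2)]]]) auto
  then have "smooth_fun_on M (U \<inter> V) (\<lambda>x. tensor_triv k (\<phi> x) (\<psi> x) (tsec s t x) i)"
    by (rule smooth_fun_on_cong[OF o])
      (use BE.triv_subset[OF U] BE.sectionsD(1)[OF s] BF.sectionsD(1)[OF t] tensor_triv_pure[OF U _ V]
        in \<open>auto simp: tsec_def subset_iff\<close>)
  then show "smooth_fun_on M W (\<lambda>x. \<theta> x (tsec s t x) i)"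
    unfolding eq .
qed

lemma tsec_Lsec:
  assumes s: "s \<in> XE.Lsec n" and t: "t \<in> BF.Sec"
  shows "tsec s t \<in> XT.Lsec n"
  unfolding XT.Lsec_iff
proof
  show "tsec s t \<in> BT.Sec" using tsec_in s t XE.Lsec_iff by blast
  show "\<forall>x\<in>points M - L n. tsec s t x = \<zero>\<^bsub>fiber T x\<^esub>"
  proof
    fix x assume x: "x \<in> points M - L n"
    then have "tp x \<zero>\<^bsub>fiber E x\<^esub> (t x) = \<zero>\<^bsub>TM x\<^esub>"
      by (intro tensor_spaces.pure_zero_left[OF tensor_spaces_fiber] BF.sectionsD(1)[OF t]) auto
    then show "tsec s t x = \<zero>\<^bsub>fiber T x\<^esub>"
      using x s by (simp add: tsec_def fiber_T XE.Lsec_iff)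
  qed
qed

text \<open>In a product trivialization each component of the product is a product of one component
  of each factor, so the estimate is \<open>bounded_jets_mult\<close>.\<close>

lemma tsec_jets_bounded:
  assumes B: "B \<subseteq> BE.Sec" "BE.jets_bounded B" and C: "C \<subseteq> BF.Sec" "BF.jets_bounded C"
  shows "BT.jets_bounded {tsec s t | s t. s \<in> B \<and> t \<in> C}"
  unfolding BT.jets_bounded_def
proof (intro allI impI)
  fix U c W r' \<theta> i K assume jd: "BT.jet_domain U c W r' \<theta> i K"
  note jdD = BT.jdD[OF jd]
  obtain V1 r \<phi> V2 k \<psi> where V1: "(V1, r, \<phi>) \<in> trivs E" and V2: "(V2, k, \<psi>) \<in> trivs F"
    and eq: "W = V1 \<inter> V2" "r' = r * k" "\<theta> = (\<lambda>x. tensor_triv k (\<phi> x) (\<psi> x))"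
    using jdD(2) by (rule trivs_TE)
  have "0 < k"
    using jdD(3) unfolding eq by (cases k) auto
  then have i: "i div k < r" "i mod k < k"
    using jdD(3) unfolding eq by (simp_all add: less_mult_imp_div_less)
  have jd1: "BE.jet_domain U c V1 r \<phi> (i div k) K" and jd2: "BF.jet_domain U c V2 k \<psi> (i mod k) K"
    using jdD V1 V2 i unfolding BE.jet_domain_def BF.jet_domain_def eq by auto
  let ?O = "c ` (U \<inter> W)"
  let ?H1 = "local_rep U c \<phi> (i div k) ` B" and ?H2 = "local_rep U c \<psi> (i mod k) ` C"
  have O1: "?O \<subseteq> c ` (U \<inter> V1)" and O2: "?O \<subseteq> c ` (U \<inter> V2)" unfolding eq by auto
  have bd: "bounded_jets (c ` K) {\<lambda>x. f x * g x | f g. f \<in> ?H1 \<and> g \<in> ?H2}"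
  proof (rule bounded_jets_mult[OF BT.rep_open[OF jd] BT.rep_subset[OF jd]])
    show "smooth_on ?O f" if "f \<in> ?H1" for f
      using that B(1) smooth_on_subset[OF BE.rep_smooth[OF jd1] O1] by blast
    show "smooth_on ?O f" if "f \<in> ?H2" for f
      using that C(1) smooth_on_subset[OF BF.rep_smooth[OF jd2] O2] by blast
    show "bounded_jets (c ` K) ?H1" "bounded_jets (c ` K) ?H2"
      using B(2) C(2) jd1 jd2 unfolding BE.jets_bounded_def BF.jets_bounded_def by blast+
  qed
  have rep: "iter_deriv vs (local_rep U c \<theta> i (tsec s t)) y
      = iter_deriv vs (\<lambda>z. local_rep U c \<phi> (i div k) s z * local_rep U c \<psi> (i mod k) t z) y"
    if st: "s \<in> B" "t \<in> C" and y: "y \<in> c ` K" for s t y vs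
  proof (rule BT.rep_cong[OF jd y])
    fix x assume x: "x \<in> U \<inter> W"
    have "x \<in> points M" "x \<in> V1" "x \<in> V2" using x BE.triv_subset[OF V1] unfolding eq by auto
    then show "local_rep U c \<theta> i (tsec s t) (c x)
        = local_rep U c \<phi> (i div k) s (c x) * local_rep U c \<psi> (i mod k) t (c x)"
      using x st B(1) C(1) BE.sectionsD(1)[of s x] BF.sectionsD(1)[of t x]
      unfolding BT.rep_apply[OF jd IntD1[OF x]] BE.rep_apply[OF jd1 IntD1[OF x]] BF.rep_apply[OF jd2 IntD1[OF x]]
      by (auto simp: eq tsec_def tensor_triv_pure[OF V1 _ V2] subset_iff)
  qed
  show "bounded_jets (c ` K) (local_rep U c \<theta> i ` {tsec s t | s t. s \<in> B \<and> t \<in> C})"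
    unfolding bounded_jets_def
  proof
    fix vs
    obtain R where R: "\<forall>f\<in>{\<lambda>x. f x * g x | f g. f \<in> ?H1 \<and> g \<in> ?H2}. \<forall>y\<in>c ` K. norm (iter_deriv vs f y) \<le> R"
      using bd unfolding bounded_jets_def by blast
    have "norm (iter_deriv vs (local_rep U c \<theta> i (tsec s t)) y) \<le> R" if "s \<in> B" "t \<in> C" "y \<in> c ` K" for s t y
      unfolding rep[OF that] using R that by blast
    then show "\<exists>R. \<forall>f\<in>local_rep U c \<theta> i ` {tsec s t | s t. s \<in> B \<and> t \<in> C}. \<forall>y\<in>c ` K. norm (iter_deriv vs f y) \<le> R"
      by blast
  qed
qed

text \<open>The section a (id \<otimes> e'_j) u of \<open>E\<close> from the formula for
  \<open>R\<close>, extended by zero outside the trivialization.\<close>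

definition csec :: "('m \<Rightarrow> 'k) \<Rightarrow> 'm set \<Rightarrow> ('m \<Rightarrow> 'w \<Rightarrow> nat \<Rightarrow> 'k) \<Rightarrow> nat
    \<Rightarrow> ('m \<Rightarrow> (('v \<times> 'w) \<Rightarrow>\<^sub>0 'k) set) \<Rightarrow> 'm \<Rightarrow> 'v"
  where "csec a V \<psi> j u = (\<lambda>x\<in>points M.
    if x \<in> V then a x \<odot>\<^bsub>fiber E x\<^esub> contraction \<psi> j x (u x) else \<zero>\<^bsub>fiber E x\<^esub>)"

text \<open>The function a e'_j(t). It is the coefficient that can cross the tensor sign, see
  \<open>csec_tsec\<close>.\<close>

definition cfun :: "('m \<Rightarrow> 'k) \<Rightarrow> 'm set \<Rightarrow> ('m \<Rightarrow> 'w \<Rightarrow> nat \<Rightarrow> 'k) \<Rightarrow> nat \<Rightarrow> ('m \<Rightarrow> 'w) \<Rightarrow> 'm \<Rightarrow> 'k"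
  where "cfun a V \<psi> j t = (\<lambda>x\<in>points M. if x \<in> V then a x * \<psi> x (t x) j else 0)"

context
  fixes V s \<psi> j and a :: "'m \<Rightarrow> 'k" and K
  assumes V: "(V, s, \<psi>) \<in> trivs F" "j < s"
    and a: "smooth_fun_on M (points M) a" and K: "compactin (mtop M) K" "K \<subseteq> V" "\<And>x. x \<in> points M - K \<Longrightarrow> a x = 0"
begin

lemma contraction_in:
  assumes u: "u \<in> BT.Sec" and x: "x \<in> V"
  shows "contraction \<psi> j x (u x) \<in> carrier (fiber E x)"
  using BT.sectionsD(1)[OF u Vx_point[OF V(1) x]] linear_mapsD(1)[OF contraction_linear[OF V(1) x]]
  by (simp add: fiber_T)

lemma csec_coord:
  assumes U: "(U, r, \<phi>) \<in> trivs E" "k < r" and u: "u \<in> BT.Sec"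
  shows "x \<in> U \<Longrightarrow> x \<in> V \<Longrightarrow> \<phi> x (csec a V \<psi> j u x) k = a x * tensor_triv s (\<phi> x) (\<psi> x) (u x) (k * s + j)"
    and "x \<in> U \<Longrightarrow> x \<notin> K \<Longrightarrow> \<phi> x (csec a V \<psi> j u x) k = 0"
proof -
  assume x: "x \<in> U"
  then have xM: "x \<in> points M" using BE.triv_subset[OF U(1)] by blast
  show 1: "\<phi> x (csec a V \<psi> j u x) k = a x * tensor_triv s (\<phi> x) (\<psi> x) (u x) (k * s + j)" if "x \<in> V"
    using that xM BE.triv_scale[OF U(1) x contraction_in[OF u that]] BT.sectionsD(1)[OF u xM]
      contraction_coord[OF V(1) that U(1) x _ V(2)] by (simp add: csec_def fiber_T)
  show "\<phi> x (csec a V \<psi> j u x) k = 0" if "x \<notin> K"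
  proof (cases "x \<in> V")
    case True
    then show ?thesis using 1 K(3)[of x] xM that by simp
  next
    case False
    then show ?thesis using xM BE.triv_zero[OF U(1) x] by (simp add: csec_def)
  qed
qed

lemma index_less: "k < r \<Longrightarrow> k * s + j < r * s"
  using V(2) by (metis Suc_leI add_less_cancel_left less_le_trans mult_Suc mult_le_mono1 add.commute)

lemma csec_in:
  assumes u: "u \<in> BT.Sec"
  shows "csec a V \<psi> j u \<in> BE.Sec"
proof (rule BE.sectionsI)
  show "csec a V \<psi> j u x \<in> carrier (fiber E x)" if x: "x \<in> points M" for x
  proof -
    interpret F: vec_space "fiber E x" by (rule BE.vec_space_fiber[OF x])
    show ?thesis using x contraction_in[OF u] by (simp add: csec_def)
  qed
  show "csec a V \<psi> j u x = undefined" if "x \<notin> points M" for x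
    using that by (simp add: csec_def)
  fix U r \<phi> k assume U: "(U, r, \<phi>) \<in> trivs E" "k < r"
  have o: "opn (V \<inter> U)" using BE.triv_open[OF U(1)] BF.triv_open[OF V(1)] by blast
  show "smooth_fun_on M U (\<lambda>x. \<phi> x (csec a V \<psi> j u x) k)"
  proof (rule smooth_fun_on_extend[OF BF.triv_open[OF V(1)] BE.triv_open[OF U(1)] _ K(1,2)])
    have "smooth_fun_on M (U \<inter> V) (\<lambda>x. tensor_triv s (\<phi> x) (\<psi> x) (u x) (k * s + j))"
      by (rule BT.sectionsD(3)[OF u trivs_TI[OF U(1) V(1)] index_less[OF U(2)]])
    then show "smooth_fun_on M (V \<inter> U) (\<lambda>x. a x * tensor_triv s (\<phi> x) (\<psi> x) (u x) (k * s + j))"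
      using BE.triv_subset[OF U(1)]
      by (intro smooth_fun_on_mult[OF o smooth_fun_on_subset[OF a]]) (auto simp: Int_commute)
  qed (use csec_coord[OF U u] in auto)
qed

lemma csec_Lsec:
  assumes u: "u \<in> XT.Lsec n"
  shows "csec a V \<psi> j u \<in> XE.Lsec n"
  unfolding XE.Lsec_iff
proof
  have uS: "u \<in> BT.Sec" using u XT.Lsec_iff by blast
  show "csec a V \<psi> j u \<in> BE.Sec" by (rule csec_in[OF uS])
  show "\<forall>x\<in>points M - L n. csec a V \<psi> j u x = \<zero>\<^bsub>fiber E x\<^esub>"
  proof
    fix x assume x: "x \<in> points M - L n"
    interpret F: vec_space "fiber E x" using BE.vec_space_fiber x by blast
    have "u x = \<zero>\<^bsub>TM x\<^esub>"
      using u x by (simp add: XT.Lsec_iff fiber_T)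
    moreover have "contraction \<psi> j x \<zero>\<^bsub>TM x\<^esub> = \<zero>\<^bsub>fiber E x\<^esub>" if "x \<in> V"
      using linear_maps_zero[OF tensor_spaces.vec_space_tensor F.vec_space_axioms contraction_linear[OF V(1) that]]
        tensor_spaces_fiber x by blast
    ultimately show "csec a V \<psi> j u x = \<zero>\<^bsub>fiber E x\<^esub>"
      using x by (simp add: csec_def)
  qed
qed

text \<open>The given compact set \<open>C\<close> need not lie in \<open>V\<close>, where the
  components of \<open>u\<close> are available. It is split along \<open>K\<close>: on the compact
  part inside \<open>K\<close> the product trivialization gives the estimate, and elsewhere the
  section vanishes locally.\<close>

lemma csec_jets_bounded:
  assumes B: "B \<subseteq> BT.Sec" "BT.jets_bounded B"
  shows "BE.jets_bounded (csec a V \<psi> j ` B)"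
  unfolding BE.jets_bounded_def
proof (intro allI impI)
  fix U c V' r \<phi> k C assume jd: "BE.jet_domain U c V' r \<phi> k C"
  note jdD = BE.jdD[OF jd]
  let ?\<theta> = "\<lambda>x. tensor_triv s (\<phi> x) (\<psi> x)"
  let ?C = "C \<inter> K"
  have cC: "compactin (mtop M) ?C"
    by (rule compact_Int_closedin[OF jdD(4) compactin_imp_closedin[OF hausdorff K(1)]])
  have jdT: "BT.jet_domain U c (V' \<inter> V) (r * s) ?\<theta> (k * s + j) ?C"
    unfolding BT.jet_domain_def using jdD trivs_TI[OF jdD(2) V(1)] index_less[OF jdD(3)] cC K(2) by auto
  let ?H = "local_rep U c ?\<theta> (k * s + j) ` B"
  let ?O = "c ` (U \<inter> (V' \<inter> V))"
  have sa: "smooth_on ?O (a \<circ> inv_into U c)"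
    by (rule smooth_on_subset[OF smooth_fun_onD[OF a jdD(1)]]) (use BE.triv_subset[OF jdD(2)] in blast)
  have bd: "bounded_jets (c ` ?C) {\<lambda>x. f x * g x | f g. f \<in> {a \<circ> inv_into U c} \<and> g \<in> ?H}"
  proof (rule bounded_jets_mult[OF BT.rep_open[OF jdT] BT.rep_subset[OF jdT]])
    show "smooth_on ?O f" if "f \<in> {a \<circ> inv_into U c}" for f
      using that sa by blast
    show "smooth_on ?O f" if "f \<in> ?H" for f
      using that B(1) BT.rep_smooth[OF jdT] by blast
    show "bounded_jets (c ` ?C) {a \<circ> inv_into U c}"
      by (rule bounded_jets_singleton[OF BT.rep_compact[OF jdT] BT.rep_subset[OF jdT] sa])
    show "bounded_jets (c ` ?C) ?H"
      using B(2) jdT unfolding BT.jets_bounded_def by blast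
  qed
  have in_K: "iter_deriv vs (local_rep U c \<phi> k (csec a V \<psi> j u)) y
      = iter_deriv vs (\<lambda>z. (a \<circ> inv_into U c) z * local_rep U c ?\<theta> (k * s + j) u z) y"
    if u: "u \<in> B" and y: "y \<in> c ` ?C" for u y vs
  proof (rule iter_deriv_cong_open[OF BT.rep_open[OF jdT]])
    show "y \<in> ?O" using y BT.rep_subset[OF jdT] by blast
    fix z assume "z \<in> ?O"
    then obtain x where x: "x \<in> U" "x \<in> V'" "x \<in> V" "z = c x" by blast
    then show "local_rep U c \<phi> k (csec a V \<psi> j u) z = (a \<circ> inv_into U c) z * local_rep U c ?\<theta> (k * s + j) u z"
      using csec_coord(1)[OF jdD(2,3)] u B(1) jdD(1)
      by (auto simp: BE.rep_apply[OF jd] BT.rep_apply[OF jdT])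
  qed
  \<comment> \<open>Zero on the open set \<open>U \<inter> (V' - K)\<close>, not merely at the
    point, so all derivatives vanish.\<close>
  have off_K: "iter_deriv vs (local_rep U c \<phi> k (csec a V \<psi> j u)) y = 0"
    if u: "u \<in> B" and y: "y \<in> c ` C" "y \<notin> c ` ?C" for u y vs
  proof -
    have o: "open (c ` (U \<inter> (V' - K)))"
      using BE.triv_open[OF jdD(2)] compactin_imp_closedin[OF hausdorff K(1)]
      by (intro chart_open_image[OF jdD(1)]) auto
    have "iter_deriv vs (local_rep U c \<phi> k (csec a V \<psi> j u)) y = iter_deriv vs (\<lambda>_. 0) y"
    proof (rule iter_deriv_cong_open[OF o])
      show "y \<in> c ` (U \<inter> (V' - K))" using y jdD by auto
      fix z assume "z \<in> c ` (U \<inter> (V' - K))"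
      then obtain x where x: "x \<in> U" "x \<in> V'" "x \<notin> K" "z = c x" by blast
      then show "local_rep U c \<phi> k (csec a V \<psi> j u) z = 0"
        using csec_coord(2)[OF jdD(2,3)] u B(1) by (auto simp: BE.rep_apply[OF jd])
    qed
    then show ?thesis by (simp add: iter_deriv_zero)
  qed
  show "bounded_jets (c ` C) (local_rep U c \<phi> k ` csec a V \<psi> j ` B)"
    unfolding bounded_jets_def
  proof
    fix vs
    obtain R where R: "\<forall>f\<in>{\<lambda>x. f x * g x | f g. f \<in> {a \<circ> inv_into U c} \<and> g \<in> ?H}. \<forall>y\<in>c ` ?C. norm (iter_deriv vs f y) \<le> R"
      using bd unfolding bounded_jets_def by blast
    \<comment> \<open>The 0 covers the points off \<open>K\<close>, because \<open>R\<close> bounds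
      only those in \<open>K\<close> and may be negative when there are none.\<close>
    have "norm (iter_deriv vs (local_rep U c \<phi> k (csec a V \<psi> j u)) y) \<le> max R 0" if "u \<in> B" "y \<in> c ` C" for u y
    proof (cases "y \<in> c ` ?C")
      case True
      have "norm (iter_deriv vs (\<lambda>z. (a \<circ> inv_into U c) z * local_rep U c ?\<theta> (k * s + j) u z) y) \<le> R"
        using R that(1) True by blast
      then show ?thesis unfolding in_K[OF that(1) True] by simp
    next
      case False
      then show ?thesis using off_K[OF that] by simp
    qed
    then show "\<exists>R. \<forall>f\<in>local_rep U c \<phi> k ` csec a V \<psi> j ` B. \<forall>y\<in>c ` C. norm (iter_deriv vs f y) \<le> R"
      by blast
  qed
qed

lemma csec_linear: "csec a V \<psi> j \<in> linear_maps XT.Cm XE.Cm"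
  unfolding linear_maps_def
proof (intro CollectI conjI ballI allI)
  show "csec a V \<psi> j \<in> carrier XT.Cm \<rightarrow> carrier XE.Cm"
    using XT.Csec_Lsec csec_Lsec XE.Lsec_subset by fastforce
next
  fix u v assume uv: "u \<in> carrier XT.Cm" "v \<in> carrier XT.Cm"
  then have S: "u \<in> BT.Sec" "v \<in> BT.Sec" using BT.compact_sections_subset by auto
  show "csec a V \<psi> j (u \<oplus>\<^bsub>XT.Cm\<^esub> v) = csec a V \<psi> j u \<oplus>\<^bsub>XE.Cm\<^esub> csec a V \<psi> j v"
  proof
    fix x
    show "csec a V \<psi> j (u \<oplus>\<^bsub>XT.Cm\<^esub> v) x = (csec a V \<psi> j u \<oplus>\<^bsub>XE.Cm\<^esub> csec a V \<psi> j v) x"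
    proof (cases "x \<in> points M")
      case True
      interpret F: vec_space "fiber E x" by (rule BE.vec_space_fiber[OF True])
      show ?thesis
        using True BT.sectionsD(1)[OF S(1) True] BT.sectionsD(1)[OF S(2) True] contraction_in[OF S(1)] contraction_in[OF S(2)]
          linear_mapsD(2)[OF contraction_linear[OF V(1)]]
        by (simp add: csec_def fiber_T F.scale_distrib)
    qed (simp add: csec_def)
  qed
next
  fix k u assume "u \<in> carrier XT.Cm"
  then have S: "u \<in> BT.Sec" using BT.compact_sections_subset by auto
  show "csec a V \<psi> j (k \<odot>\<^bsub>XT.Cm\<^esub> u) = k \<odot>\<^bsub>XE.Cm\<^esub> csec a V \<psi> j u"
  proof
    fix x
    show "csec a V \<psi> j (k \<odot>\<^bsub>XT.Cm\<^esub> u) x = (k \<odot>\<^bsub>XE.Cm\<^esub> csec a V \<psi> j u) x"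
    proof (cases "x \<in> points M")
      case True
      interpret F: vec_space "fiber E x" by (rule BE.vec_space_fiber[OF True])
      show ?thesis
        using True BT.sectionsD(1)[OF S True] contraction_in[OF S] linear_mapsD(3)[OF contraction_linear[OF V(1)]]
        by (simp add: csec_def fiber_T F.scale_scale mult.commute)
    qed (simp add: csec_def)
  qed
qed

lemma cfun_smooth:
  assumes t: "t \<in> BF.Sec"
  shows "cfun a V \<psi> j t \<in> carrier (smooth_functions M)"
proof -
  have "smooth_fun_on M (points M) (cfun a V \<psi> j t)"
  proof (rule smooth_fun_on_extend[OF BF.triv_open[OF V(1)] openin_topspace _ K(1,2)])
    have "V \<inter> points M = V" using BF.triv_subset[OF V(1)] by blast
    then show "smooth_fun_on M (V \<inter> points M) (\<lambda>x. a x * \<psi> x (t x) j)"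
      using smooth_fun_on_mult[OF BF.triv_open[OF V(1)] smooth_fun_on_subset[OF a BF.triv_subset[OF V(1)]]
          BF.sectionsD(3)[OF t V]] by simp
  qed (use K(3) in \<open>auto simp: cfun_def\<close>)
  then show ?thesis
    by (simp add: smooth_functions_def cfun_def)
qed

text \<open>Contracting a pure tensor yields a scalar multiple of its left factor. The contraction
  of a product is thus a smooth function times \<open>s'\<close>, which the balancing relators can
  transfer to the other side.\<close>

lemma csec_tsec:
  assumes s': "s' \<in> BE.Sec" and t: "t \<in> BF.Sec"
  shows "csec a V \<psi> j (tsec s' t) = section_act M E (cfun a V \<psi> j t) s'"
proof
  fix x
  show "csec a V \<psi> j (tsec s' t) x = section_act M E (cfun a V \<psi> j t) s' x"
  proof (cases "x \<in> points M")
    case True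
    interpret F: vec_space "fiber E x" by (rule BE.vec_space_fiber[OF True])
    show ?thesis
      using True contraction_pure[OF V(1) _ BE.sectionsD(1)[OF s' True] BF.sectionsD(1)[OF t True]]
        BE.sectionsD(1)[OF s' True]
      by (simp add: csec_def tsec_def section_act_def cfun_def F.scale_scale)
  qed (simp add: csec_def section_act_def)
qed

end

end


section \<open>The isomorphism\<close>

lemma linear_maps_mk_lc_module_left [simp]: "linear_maps (mk_lc_module V T ac) W = linear_maps V W"
  by (simp add: linear_maps_def)

lemma linear_maps_mk_lc_module_right [simp]: "linear_maps V (mk_lc_module W T ac) = linear_maps V W"
  by (simp add: linear_maps_def)

lemma (in smooth_bundle) eval_linear:
  "S \<subseteq> Sec \<Longrightarrow> x \<in> points M \<Longrightarrow> (\<lambda>s. s x) \<in> linear_maps (section_module M E S) (fiber E x)"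
  unfolding linear_maps_def using sectionsD(1) by auto

lemma smooth_functions_smooth:
  "a \<in> carrier (smooth_functions M) \<Longrightarrow> smooth_fun_on M (points M) a"
  by (simp add: smooth_functions_def)

context exhausted_bundle
begin

section \<open>Multiplication of sections by smooth functions\<close>

lemma act_Lsec:
  assumes a: "smooth_fun_on M (points M) a" and s: "s \<in> Lsec n"
  shows "section_act M E a s \<in> Lsec n"
proof -
  have "section_act M E a s x = \<zero>\<^bsub>fiber E x\<^esub>" if x: "x \<in> points M - L n" for x
  proof -
    interpret F: vec_space "fiber E x" using vec_space_fiber x by blast
    show ?thesis using s x by (simp add: section_act_def Lsec_iff)
  qed
  then show ?thesis
    using act_section[OF _ a] s by (simp add: Lsec_iff)
qed

lemma act_linear:
  assumes a: "smooth_fun_on M (points M) a"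
  shows "section_act M E a \<in> linear_maps Cm Cm"
  unfolding linear_maps_def
proof (intro CollectI conjI ballI allI)
  show "section_act M E a \<in> carrier Cm \<rightarrow> carrier Cm"
    using act_Lsec[OF a] Csec_Lsec Lsec_subset by fastforce
next
  fix s t assume st: "s \<in> carrier Cm" "t \<in> carrier Cm"
  show "section_act M E a (s \<oplus>\<^bsub>Cm\<^esub> t) = section_act M E a s \<oplus>\<^bsub>Cm\<^esub> section_act M E a t"
  proof
    fix x
    show "section_act M E a (s \<oplus>\<^bsub>Cm\<^esub> t) x = (section_act M E a s \<oplus>\<^bsub>Cm\<^esub> section_act M E a t) x"
    proof (cases "x \<in> points M")
      case True
      interpret F: vec_space "fiber E x" by (rule vec_space_fiber[OF True])
      have "s x \<in> carrier (fiber E x)" "t x \<in> carrier (fiber E x)"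
        using st compact_sections_subset sectionsD(1)[OF _ True] by auto
      then show ?thesis using True by (simp add: section_act_def F.scale_distrib)
    qed (simp add: section_act_def)
  qed
next
  fix k s assume s: "s \<in> carrier Cm"
  show "section_act M E a (k \<odot>\<^bsub>Cm\<^esub> s) = k \<odot>\<^bsub>Cm\<^esub> section_act M E a s"
  proof
    fix x
    show "section_act M E a (k \<odot>\<^bsub>Cm\<^esub> s) x = (k \<odot>\<^bsub>Cm\<^esub> section_act M E a s) x"
    proof (cases "x \<in> points M")
      case True
      interpret F: vec_space "fiber E x" by (rule vec_space_fiber[OF True])
      have "s x \<in> carrier (fiber E x)"
        using s compact_sections_subset sectionsD(1)[OF _ True] by auto
      then show ?thesis using True by (simp add: section_act_def F.scale_scale mult.commute)
    qed (simp add: section_act_def)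
  qed
qed

end

context two_bundles
begin

abbreviation "Pm \<equiv> mk_lc_module XE.Cm (lf_topology M L E) (section_act M E)"
abbreviation "Qm \<equiv> mk_lc_module (section_module M F BF.Sec) (section_topology M F) (section_act M F)"
abbreviation "Wm \<equiv> mk_lc_module XT.Cm (lf_topology M L T) (section_act M T)"

lemma tsec_bilinear: "bilinear_map Pm Qm Wm tsec"
proof (rule bilinear_map.intro)
  show "tensor_spaces Pm Qm"
    unfolding tensor_spaces_def
    using vec_space_mk_lc_module[OF BE.vec_space_compact_sections] vec_space_mk_lc_module[OF BF.vec_space_sections]
    by blast
  show "vec_space Wm"
    by (rule vec_space_mk_lc_module[OF BT.vec_space_compact_sections])
  show "bilinear_map_axioms Pm Qm Wm tsec"
  proof
    fix p q p' q' k assume "p \<in> carrier Pm" "q \<in> carrier Qm"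
    then have p: "p \<in> BE.Csec" and q: "q \<in> BF.Sec" by simp_all
    have pc: "p x \<in> carrier (fiber E x)" if "x \<in> points M" for x
      using p BE.compact_sections_subset BE.sectionsD(1)[OF _ that] by blast
    note qc = BF.sectionsD(1)[OF q]
    show "tsec p q \<in> carrier Wm"
      using XE.Csec_Lsec[OF p] tsec_Lsec[OF _ q] XT.Lsec_subset by auto
    show "tsec (p \<oplus>\<^bsub>Pm\<^esub> p') q = tsec p q \<oplus>\<^bsub>Wm\<^esub> tsec p' q" if p': "p' \<in> carrier Pm"
    proof -
      have "p' x \<in> carrier (fiber E x)" if "x \<in> points M" for x
        using p' BE.compact_sections_subset BE.sectionsD(1)[OF _ that] by auto
      then show ?thesis
        using pc qc tensor_spaces.pure_add_left[OF tensor_spaces_fiber]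
        by (auto simp: tsec_def fun_eq_iff fiber_T)
    qed
    show "tsec p (q \<oplus>\<^bsub>Qm\<^esub> q') = tsec p q \<oplus>\<^bsub>Wm\<^esub> tsec p q'" if q': "q' \<in> carrier Qm"
    proof -
      have "q' x \<in> carrier (fiber F x)" if "x \<in> points M" for x
        using q' BF.sectionsD(1)[OF _ that] by auto
      then show ?thesis
        using pc qc tensor_spaces.pure_add_right[OF tensor_spaces_fiber]
        by (auto simp: tsec_def fun_eq_iff fiber_T)
    qed
    show "tsec (k \<odot>\<^bsub>Pm\<^esub> p) q = k \<odot>\<^bsub>Wm\<^esub> tsec p q"
      using pc qc tensor_spaces.pure_scale_left[OF tensor_spaces_fiber]
      by (auto simp: tsec_def fun_eq_iff fiber_T)
    show "tsec p (k \<odot>\<^bsub>Qm\<^esub> q) = k \<odot>\<^bsub>Wm\<^esub> tsec p q"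
      using pc qc tensor_spaces.pure_scale_right[OF tensor_spaces_fiber]
      by (auto simp: tsec_def fun_eq_iff fiber_T)
  qed
qed

sublocale BM: bilinear_map Pm Qm Wm tsec
  by (rule tsec_bilinear)

abbreviation "PQ \<equiv> tensor_module Pm Qm"
abbreviation "pt \<equiv> pure_tensor Pm Qm"
abbreviation "lift \<equiv> tensor_lift Wm tsec"

definition relators :: "((('m \<Rightarrow> 'v) \<times> ('m \<Rightarrow> 'w)) \<Rightarrow>\<^sub>0 'k) set set"
  where "relators = {pt (act Pm a p) q \<ominus>\<^bsub>PQ\<^esub> pt p (act Qm a q)
    | a p q. a \<in> carrier (smooth_functions M) \<and> p \<in> carrier Pm \<and> q \<in> carrier Qm}"

lemma act_Pm:
  assumes "a \<in> carrier (smooth_functions M)" "p \<in> carrier Pm"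
  shows "act Pm a p \<in> carrier Pm"
  using linear_mapsD(1)[OF XE.act_linear[OF smooth_functions_smooth[OF assms(1)]]] assms(2) by simp

lemma act_Qm:
  assumes "a \<in> carrier (smooth_functions M)" "q \<in> carrier Qm"
  shows "act Qm a q \<in> carrier Qm"
  using BF.act_section[OF _ smooth_functions_smooth[OF assms(1)]] assms(2) by simp

lemma relators_subset: "relators \<subseteq> carrier PQ"
proof
  interpret PQ: vec_space PQ by (rule BM.vec_space_tensor)
  fix z assume "z \<in> relators"
  then obtain a p q where z: "z = pt (act Pm a p) q \<ominus>\<^bsub>PQ\<^esub> pt p (act Qm a q)"
    and apq: "a \<in> carrier (smooth_functions M)" "p \<in> carrier Pm" "q \<in> carrier Qm"
    unfolding relators_def by blast
  show "z \<in> carrier PQ"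
    unfolding z by (intro PQ.M.minus_closed BM.pure_in act_Pm act_Qm apq)
qed

text \<open>The quotient by the span itself, without closure. Congruence modulo the relators becomes
  equality of cosets, and sums can be transformed with linear maps.\<close>

sublocale QS: vec_quotient PQ "lin_span PQ relators"
  unfolding vec_quotient_def vec_quotient_axioms_def
  using BM.vec_space_tensor subspace_lin_span[OF BM.vec_space_tensor relators_subset] by blast

abbreviation "QR \<equiv> quot_module PQ (lin_span PQ relators)"
abbreviation "qmap z \<equiv> lin_span PQ relators +>\<^bsub>PQ\<^esub> z"

lemma qmap_act:
  assumes "a \<in> carrier (smooth_functions M)" "p \<in> carrier Pm" "q \<in> carrier Qm"
  shows "qmap (pt (section_act M E a p) q) = qmap (pt p (section_act M F a q))"
proof -
  have c: "section_act M E a p \<in> carrier Pm" "section_act M F a q \<in> carrier Qm"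
    using act_Pm[OF assms(1,2)] act_Qm[OF assms(1,3)] by simp_all
  have "pt (act Pm a p) q \<ominus>\<^bsub>PQ\<^esub> pt p (act Qm a q) \<in> relators"
    unfolding relators_def using assms by blast
  then have "pt (section_act M E a p) q \<ominus>\<^bsub>PQ\<^esub> pt p (section_act M F a q)
      \<in> lin_span PQ relators"
    using subsetD[OF lin_span_superset] by simp
  then show ?thesis
    using QS.coset_eq_iff BM.pure_in c assms(2,3) by blast
qed

end

section \<open>The linear section of the lift over one step\<close>

locale cutoff_bundles = two_bundles M L E F
  for M :: "('m, 'e::real_inner) manifold" and L :: "nat \<Rightarrow> 'm set"
    and E :: "('k::real_or_complex, 'm, 'v) vec_bundle" and F :: "('k, 'm, 'w) vec_bundle" +
  fixes n :: nat and xs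
  assumes cut: "cutoff_pairs (trivs F) fst xs"
    and one: "x \<in> L n \<Longrightarrow> (\<Sum>(a, b, i)\<leftarrow>xs. a x * b x) = (1 :: 'k)"
begin

definition "ca k = fst (xs ! k)"
definition "cb k = fst (snd (xs ! k))"
definition "cV k = fst (snd (snd (xs ! k)))"
definition "cs k = fst (snd (snd (snd (xs ! k))))"
definition "cp k = snd (snd (snd (snd (xs ! k))))"

text \<open>Phrased as an elimination rule, because the compact set differs with \<open>k\<close>
  and occurs in the premises, but not in the conclusions, of the lemmas on \<open>csec\<close> and
  \<open>cfun\<close>.\<close>

lemma cutoff:
  assumes "k < length xs"
  obtains K where "(cV k, cs k, cp k) \<in> trivs F" "smooth_fun_on M (points M) (ca k)"
    "smooth_fun_on M (points M) (cb k)" "compactin (mtop M) K" "K \<subseteq> cV k"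
    "\<And>x. x \<in> points M - K \<Longrightarrow> ca k x = 0" "\<And>x. x \<in> points M - K \<Longrightarrow> cb k x = 0"
proof -
  have xk: "xs ! k = (ca k, cb k, (cV k, cs k, cp k))"
    by (simp add: ca_def cb_def cV_def cs_def cp_def)
  have "(ca k, cb k, (cV k, cs k, cp k)) \<in> set xs"
    using nth_mem[OF assms] unfolding xk .
  then have c: "(cV k, cs k, cp k) \<in> trivs F \<and>
    smooth_fun_on M (points M) (ca k) \<and> smooth_fun_on M (points M) (cb k) \<and>
    (\<exists>K. compactin (mtop M) K \<and> K \<subseteq> fst (cV k, cs k, cp k) \<and> (\<forall>x\<in>points M - K. ca k x = 0 \<and> cb k x = 0))"
    using cut unfolding cutoff_pairs_def by fast
  then obtain K where "compactin (mtop M) K" "K \<subseteq> cV k" "\<forall>x\<in>points M - K. ca k x = 0 \<and> cb k x = 0"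
    by auto
  then show thesis
    using that[of K] c by blast
qed

lemma triv_k: "k < length xs \<Longrightarrow> (cV k, cs k, cp k) \<in> trivs F"
  by (rule cutoff)

definition "fsec k j = (\<lambda>x\<in>points M. if x \<in> cV k then cb k x \<odot>\<^bsub>fiber F x\<^esub> BF.frame (cp k) j x else \<zero>\<^bsub>fiber F x\<^esub>)"

abbreviation "ucsec k j \<equiv> csec (ca k) (cV k) (cp k) j"

text \<open>Known to be 1 on \<open>L n\<close> only. It is kept as a global smooth function so that
  it can itself be moved across the tensor sign in \<open>qmap_R\<close>.\<close>

definition "gsum = (\<lambda>x\<in>points M. \<Sum>k<length xs. ca k x * cb k x)"

lemma gsum_1: "x \<in> L n \<Longrightarrow> gsum x = 1"
proof -
  assume x: "x \<in> L n"
  have "(\<Sum>(a, b, i)\<leftarrow>xs. a x * b x) = (\<Sum>k<length xs. ca k x * cb k x)"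
    by (simp add: sum_list_sum_nth ca_def cb_def case_prod_beta atLeast0LessThan)
  then show ?thesis
    using one[OF x] x L_cover by (auto simp: gsum_def)
qed

lemma gsum_smooth: "gsum \<in> carrier (smooth_functions M)"
proof -
  have "smooth_fun_on M (points M) (\<lambda>x. \<Sum>k<m. ca k x * cb k x)" if "m \<le> length xs" for m
    using that
  proof (induction m)
    case 0
    then show ?case using smooth_fun_on_const[of _ 0] by simp
  next
    case (Suc m)
    then have m: "m < length xs" by simp
    have ab: "smooth_fun_on M (points M) (ca m)" "smooth_fun_on M (points M) (cb m)"
      by (rule cutoff[OF m], assumption)+
    show ?case
      using smooth_fun_on_add[OF openin_topspace _ smooth_fun_on_mult[OF openin_topspace ab]] Suc by simp
  qed
  then have "smooth_fun_on M (points M) gsum"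
    by (rule smooth_fun_on_cong[OF openin_topspace]) (auto simp: gsum_def)
  then show ?thesis
    by (simp add: smooth_functions_def gsum_def)
qed

lemma fsec_in: "k < length xs \<Longrightarrow> j < cs k \<Longrightarrow> fsec k j \<in> BF.Sec"
proof -
  assume k: "k < length xs" and j: "j < cs k"
  from k show ?thesis
    unfolding fsec_def by (rule cutoff) (rule BF.frame_section[OF _ j])
qed

lemma ucsec_linear: "k < length xs \<Longrightarrow> j < cs k \<Longrightarrow> ucsec k j \<in> linear_maps XT.Cm XE.Cm"
proof -
  assume k: "k < length xs" and j: "j < cs k"
  from k show ?thesis by (rule cutoff) (rule csec_linear[OF _ j])
qed

lemma ucsec_Lsec: "k < length xs \<Longrightarrow> j < cs k \<Longrightarrow> u \<in> XT.Lsec m \<Longrightarrow> ucsec k j u \<in> XE.Lsec m"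
proof -
  assume k: "k < length xs" and j: "j < cs k" and u: "u \<in> XT.Lsec m"
  from k show ?thesis by (rule cutoff) (rule csec_Lsec[OF _ j _ _ _ _ u])
qed

lemma ucsec_jets: "k < length xs \<Longrightarrow> j < cs k \<Longrightarrow> B \<subseteq> BT.Sec \<Longrightarrow> BT.jets_bounded B \<Longrightarrow> BE.jets_bounded (ucsec k j ` B)"
proof -
  assume k: "k < length xs" and j: "j < cs k" and B: "B \<subseteq> BT.Sec" "BT.jets_bounded B"
  from k show ?thesis by (rule cutoff) (rule csec_jets_bounded[OF _ j _ _ _ _ B])
qed

definition "R u = finsum PQ (\<lambda>k. finsum PQ (\<lambda>j. pt (ucsec k j u) (fsec k j)) {..<cs k}) {..<length xs}"

lemma summand_linear:
  assumes "k < length xs" "j < cs k"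
  shows "(\<lambda>u. pt (ucsec k j u) (fsec k j)) \<in> linear_maps XT.Cm PQ"
proof (rule linear_maps_comp[OF ucsec_linear[OF assms]])
  show "(\<lambda>p. pt p (fsec k j)) \<in> linear_maps XE.Cm PQ"
    using BM.pure_linear_left[of "fsec k j"] fsec_in[OF assms] by simp
qed

lemma inner_linear:
  assumes "k < length xs"
  shows "(\<lambda>u. finsum PQ (\<lambda>j. pt (ucsec k j u) (fsec k j)) {..<cs k}) \<in> linear_maps XT.Cm PQ"
  by (rule linear_maps_finsum_fun[OF BT.vec_space_compact_sections BM.vec_space_tensor])
    (use summand_linear[OF assms] in auto)

lemma R_linear: "R \<in> linear_maps XT.Cm PQ"
  unfolding R_def[abs_def]
  by (rule linear_maps_finsum_fun[OF BT.vec_space_compact_sections BM.vec_space_tensor])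
    (use inner_linear in auto)

lemma linear_R:
  assumes h: "h \<in> linear_maps PQ V" and V: "vec_space V" and u: "u \<in> BT.Csec"
  shows "h (R u) = finsum V (\<lambda>k. finsum V (\<lambda>j. h (pt (ucsec k j u) (fsec k j))) {..<cs k}) {..<length xs}"
proof -
  interpret V: vec_space V by fact
  have u': "u \<in> carrier XT.Cm" using u by simp
  have s: "pt (ucsec k j u) (fsec k j) \<in> carrier PQ" if "k < length xs" "j < cs k" for k j
    by (rule linear_mapsD(1)[OF summand_linear[OF that] u'])
  have "h (R u) = finsum V (\<lambda>k. h (finsum PQ (\<lambda>j. pt (ucsec k j u) (fsec k j)) {..<cs k})) {..<length xs}"
    unfolding R_def using linear_mapsD(1)[OF inner_linear u']
    by (intro linear_maps_finsum[OF BM.vec_space_tensor V h]) auto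
  also have "\<dots> = finsum V (\<lambda>k. finsum V (\<lambda>j. h (pt (ucsec k j u) (fsec k j))) {..<cs k}) {..<length xs}"
  proof (rule V.M.finsum_cong')
    show "(\<lambda>k. finsum V (\<lambda>j. h (pt (ucsec k j u) (fsec k j))) {..<cs k}) \<in> {..<length xs} \<rightarrow> carrier V"
      using s linear_mapsD(1)[OF h] by (auto intro!: V.M.finsum_closed)
    show "h (finsum PQ (\<lambda>j. pt (ucsec k j u) (fsec k j)) {..<cs k})
        = finsum V (\<lambda>j. h (pt (ucsec k j u) (fsec k j))) {..<cs k}" if "k \<in> {..<length xs}" for k
      using s that by (intro linear_maps_finsum[OF BM.vec_space_tensor V h]) auto
  qed simp
  finally show ?thesis .
qed

text \<open>At a point of the k-th domain, \<open>contraction_expansion\<close> collapses the sum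
  over the frame to the k-th product of cut-offs times \<open>u x\<close>; outside it both sides are
  zero. The total factor is \<open>gsum x\<close>, which is 1 on \<open>L n\<close>, and
  \<open>u\<close> vanishes elsewhere.\<close>

lemma lift_R:
  assumes u: "u \<in> XT.Lsec n"
  shows "lift (R u) = u"
proof
  fix x
  have uC: "u \<in> BT.Csec" and uS: "u \<in> BT.Sec"
    using u XT.Lsec_subset BT.compact_sections_subset by blast+
  have RC: "R u \<in> carrier PQ" using linear_mapsD(1)[OF R_linear] uC by simp
  have lC: "lift (R u) \<in> BT.Sec"
    using linear_mapsD(1)[OF BM.lift_linear RC] BT.compact_sections_subset by auto
  show "lift (R u) x = u x"
  proof (cases "x \<in> points M")
    case False
    then show ?thesis using BT.sectionsD(2)[OF lC] BT.sectionsD(2)[OF uS] by simp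
  next
    case x: True
    let ?T = "TM x"
    interpret TS: tensor_spaces "fiber E x" "fiber F x" by (rule tensor_spaces_fiber[OF x])
    interpret TV: vec_space ?T by (rule TS.vec_space_tensor)
    interpret FE: vec_space "fiber E x" by (rule BE.vec_space_fiber[OF x])
    interpret FF: vec_space "fiber F x" by (rule BF.vec_space_fiber[OF x])
    have ux: "u x \<in> carrier ?T"
      using BT.sectionsD(1)[OF uS x] by (simp add: fiber_T)
    have ev: "(\<lambda>z. lift z x) \<in> linear_maps PQ ?T"
      using linear_maps_comp[OF BM.lift_linear, of "\<lambda>s. s x" ?T] BT.eval_linear[OF BT.compact_sections_subset x]
      by (simp add: fiber_T)
    have inner: "finsum ?T (\<lambda>j. lift (pt (ucsec k j u) (fsec k j)) x) {..<cs k}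
        = (ca k x * cb k x) \<odot>\<^bsub>?T\<^esub> u x" if k: "k < length xs" for k
    proof (cases "x \<in> cV k")
      case V: True
      note tr = triv_k[OF k]
      have c: "contraction (cp k) j x (u x) \<in> carrier (fiber E x)" for j
        by (rule linear_mapsD(1)[OF contraction_linear[OF tr V] ux])
      have "finsum ?T (\<lambda>j. lift (pt (ucsec k j u) (fsec k j)) x) {..<cs k}
          = finsum ?T (\<lambda>j. (ca k x * cb k x) \<odot>\<^bsub>?T\<^esub>
            tp x (contraction (cp k) j x (u x)) (BF.frame (cp k) j x)) {..<cs k}"
      proof (rule TV.M.finsum_cong')
        fix j assume "j \<in> {..<cs k}"
        then have j: "j < cs k" by simp
        have f: "BF.frame (cp k) j x \<in> carrier (fiber F x)"
          by (rule BF.frame_in[OF tr V j])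
        have "ucsec k j u \<in> carrier Pm"
          using linear_mapsD(1)[OF ucsec_linear[OF k j]] uC by simp
        moreover have "fsec k j \<in> carrier Qm" using fsec_in[OF k j] by simp
        ultimately have "lift (pt (ucsec k j u) (fsec k j)) x
            = tp x (ca k x \<odot>\<^bsub>fiber E x\<^esub> contraction (cp k) j x (u x))
              (cb k x \<odot>\<^bsub>fiber F x\<^esub> BF.frame (cp k) j x)"
          using x V by (simp add: BM.lift_pure tsec_def csec_def fsec_def)
        also have "\<dots> = (ca k x * cb k x) \<odot>\<^bsub>?T\<^esub>
            tp x (contraction (cp k) j x (u x)) (BF.frame (cp k) j x)"
          using c f by (simp add: TS.pure_scale_left TS.pure_scale_right TV.scale_scale mult.commute)
        finally show "lift (pt (ucsec k j u) (fsec k j)) x = (ca k x * cb k x) \<odot>\<^bsub>?T\<^esub>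
            tp x (contraction (cp k) j x (u x)) (BF.frame (cp k) j x)" .
      qed (use c BF.frame_in[OF tr V] in auto)
      also have "\<dots> = (ca k x * cb k x) \<odot>\<^bsub>?T\<^esub> finsum ?T (\<lambda>j.
          tp x (contraction (cp k) j x (u x)) (BF.frame (cp k) j x)) {..<cs k}"
        using c BF.frame_in[OF tr V]
        by (intro linear_maps_finsum[OF TV.vec_space_axioms TV.vec_space_axioms, symmetric])
          (auto simp: linear_maps_def TV.scale_distrib TV.scale_scale mult.commute)
      also have "\<dots> = (ca k x * cb k x) \<odot>\<^bsub>?T\<^esub> u x"
        by (simp only: contraction_expansion[OF tr V ux])
      finally show ?thesis .
    next
      case V: False
      have a0: "ca k x = 0"
      proof (rule cutoff[OF k])
        fix K assume "K \<subseteq> cV k" "\<And>x. x \<in> points M - K \<Longrightarrow> ca k x = 0"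
        then show ?thesis using V x by blast
      qed
      have "finsum ?T (\<lambda>j. lift (pt (ucsec k j u) (fsec k j)) x) {..<cs k}
          = finsum ?T (\<lambda>j. \<zero>\<^bsub>?T\<^esub>) {..<cs k}"
      proof (rule TV.M.finsum_cong')
        fix j assume "j \<in> {..<cs k}"
        then have j: "j < cs k" by simp
        have "ucsec k j u \<in> carrier Pm"
          using linear_mapsD(1)[OF ucsec_linear[OF k j]] uC by simp
        moreover have "fsec k j \<in> carrier Qm" using fsec_in[OF k j] by simp
        ultimately show "lift (pt (ucsec k j u) (fsec k j)) x = \<zero>\<^bsub>?T\<^esub>"
          using x V by (simp add: BM.lift_pure tsec_def csec_def fsec_def TS.pure_zero_left)
      qed auto
      then show ?thesis using ux by (simp add: a0)
    qed
    have "lift (R u) x = finsum ?T (\<lambda>k. finsum ?T (\<lambda>j. lift (pt (ucsec k j u) (fsec k j)) x) {..<cs k}) {..<length xs}"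
      by (rule linear_R[OF ev TV.vec_space_axioms uC])
    also have "\<dots> = finsum ?T (\<lambda>k. (ca k x * cb k x) \<odot>\<^bsub>?T\<^esub> u x) {..<length xs}"
      using inner ux by (intro TV.M.finsum_cong') auto
    also have "\<dots> = gsum x \<odot>\<^bsub>?T\<^esub> u x"
      using TV.scale_sum_left[OF _ ux, of "{..<length xs}" "\<lambda>k. ca k x * cb k x"] x by (simp add: gsum_def)
    also have "\<dots> = u x"
    proof (cases "x \<in> L n")
      case True
      then show ?thesis using gsum_1 ux by simp
    next
      case False
      then have "u x = \<zero>\<^bsub>?T\<^esub>" using u x by (simp add: XT.Lsec_iff fiber_T)
      then show ?thesis by simp
    qed
    finally show ?thesis .
  qed
qed

text \<open>Each summand has a fixed section of \<open>F\<close> as right factor and a left factor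
  ranging over a bounded set, so it lies in a set that every member of the family for
  \<open>beta\<close> has to bound. Finite sums are then handled in each member separately.\<close>

lemma R_bounded:
  assumes B: "B \<subseteq> XT.Lsec n" "BT.jets_bounded B"
  shows "von_neumann_bounded PQ (beta_topology Pm Qm) (R ` B)"
proof -
  have BC: "B \<subseteq> BT.Csec" and BS: "B \<subseteq> BT.Sec"
    using B XT.Lsec_subset BT.compact_sections_subset by blast+
  have RB: "R ` B \<subseteq> carrier PQ"
    using linear_mapsD(1)[OF R_linear] BC by auto
  have "von_neumann_bounded PQ S (R ` B)"
    if lc: "locally_convex_topology PQ S" and S: "\<forall>B C. bounded_in Pm B \<and> bounded_in Qm C \<longrightarrow>
      von_neumann_bounded PQ S {pt x y | x y. x \<in> B \<and> y \<in> C}" for S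
    unfolding R_def[abs_def]
  proof (intro bounded_finsum[OF BM.vec_space_tensor lc] finite_lessThan)
    fix k j assume "k \<in> {..<length xs}" "j \<in> {..<cs k}"
    then have k: "k < length xs" and j: "j < cs k" by auto
    have "ucsec k j ` B \<subseteq> XE.Lsec n"
      using ucsec_Lsec[OF k j] B(1) by blast
    then have "bounded_in Pm (ucsec k j ` B)"
      using ucsec_jets[OF k j BS B(2)] XE.lf_bounded_iff by auto
    moreover have "bounded_in Qm {fsec k j}"
      using BF.bounded_sections_iff BF.jets_bounded_singleton fsec_in[OF k j] by simp
    ultimately have "von_neumann_bounded PQ S {pt x y | x y. x \<in> ucsec k j ` B \<and> y \<in> {fsec k j}}"
      using S by blast
    then show "von_neumann_bounded PQ S ((\<lambda>u. pt (ucsec k j u) (fsec k j)) ` B)"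
      by (rule bounded_subset) blast
  qed
  then show ?thesis
    unfolding beta_topology_def bounded_finest_iff[OF BM.vec_space_tensor RB] by blast
qed

text \<open>The chain of equations moves each coefficient function from \<open>s\<close> to the
  frame section, sums inside the right factor to get \<open>gsum\<close> times \<open>t\<close>, and
  moves \<open>gsum\<close> back to \<open>s\<close>.\<close>

lemma qmap_R:
  assumes s: "s \<in> XE.Lsec n" and t: "t \<in> BF.Sec"
  shows "qmap (R (tsec s t)) = qmap (pt s t)"
proof -
  interpret Q: vec_space "QR" by (rule QS.vec_space_quot)
  have sC: "s \<in> BE.Csec" and sS: "s \<in> BE.Sec"
    using s XE.Lsec_subset BE.compact_sections_subset by blast+
  have sP: "s \<in> carrier Pm" and tQ: "t \<in> carrier Qm" using sC t by simp_all
  have uC: "tsec s t \<in> BT.Csec" using tsec_Lsec[OF s t] XT.Lsec_subset by blast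
  define f where "f k j = cfun (ca k) (cV k) (cp k) j t" for k j
  have f: "f k j \<in> carrier (smooth_functions M)" "ucsec k j (tsec s t) = section_act M E (f k j) s"
    if k: "k < length xs" and j: "j < cs k" for k j
  proof -
    from k show "f k j \<in> carrier (smooth_functions M)"
      unfolding f_def by (rule cutoff) (rule cfun_smooth[OF _ j _ _ _ _ t])
    from k show "ucsec k j (tsec s t) = section_act M E (f k j) s"
      unfolding f_def by (rule cutoff) (rule csec_tsec[OF _ j _ _ _ _ sS t])
  qed
  let ?g = "\<lambda>k j. section_act M F (f k j) (fsec k j)"
  have gQ: "?g k j \<in> carrier Qm" if "k < length xs" "j < cs k" for k j
    using act_Qm[OF f(1)[OF that]] fsec_in[OF that] by simp
  have G1: "finsum Qm (?g k) {..<cs k} \<in> carrier Qm" if "k < length xs" for k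
    by (rule BM.Q.M.finsum_closed) (use gQ[OF that] in blast)
  have lin: "(\<lambda>q. qmap (pt s q)) \<in> linear_maps Qm QR"
    by (rule linear_maps_comp[OF BM.pure_linear_right[OF sP] QS.linear_maps_coset])
  have "qmap (R (tsec s t)) = finsum QR (\<lambda>k.
      finsum QR (\<lambda>j. qmap (pt (ucsec k j (tsec s t)) (fsec k j))) {..<cs k}) {..<length xs}"
    by (rule linear_R[OF QS.linear_maps_coset QS.vec_space_quot uC])
  also have "\<dots> = finsum QR (\<lambda>k.
      finsum QR (\<lambda>j. qmap (pt s (?g k j))) {..<cs k}) {..<length xs}"
  proof (rule Q.M.finsum_cong')
    show in_Q: "(\<lambda>k. finsum QR (\<lambda>j. qmap (pt s (?g k j))) {..<cs k})
        \<in> {..<length xs} \<rightarrow> carrier QR"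
      using linear_mapsD(1)[OF lin gQ] by (auto intro!: Q.M.finsum_closed)
    fix k assume "k \<in> {..<length xs}"
    then have k: "k < length xs" by simp
    show "finsum QR (\<lambda>j. qmap (pt (ucsec k j (tsec s t)) (fsec k j))) {..<cs k}
        = finsum QR (\<lambda>j. qmap (pt s (?g k j))) {..<cs k}"
    proof (rule Q.M.finsum_cong')
      show "(\<lambda>j. qmap (pt s (?g k j))) \<in> {..<cs k} \<rightarrow> carrier QR"
        using linear_mapsD(1)[OF lin gQ[OF k]] by auto
      fix j assume "j \<in> {..<cs k}"
      then have j: "j < cs k" by simp
      show "qmap (pt (ucsec k j (tsec s t)) (fsec k j)) = qmap (pt s (?g k j))"
        unfolding f(2)[OF k j] using fsec_in[OF k j] by (intro qmap_act[OF f(1)[OF k j] sP]) simp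
    qed simp
  qed simp
  also have "\<dots> = finsum QR (\<lambda>k. qmap (pt s (finsum Qm (?g k) {..<cs k}))) {..<length xs}"
  proof (rule Q.M.finsum_cong')
    show "(\<lambda>k. qmap (pt s (finsum Qm (?g k) {..<cs k}))) \<in> {..<length xs} \<rightarrow> carrier QR"
      using linear_mapsD(1)[OF lin G1] by blast
    fix k assume "k \<in> {..<length xs}"
    then show "finsum QR (\<lambda>j. qmap (pt s (?g k j))) {..<cs k}
        = qmap (pt s (finsum Qm (?g k) {..<cs k}))"
      using gQ by (intro linear_maps_finsum[OF BM.Q.vec_space_axioms QS.vec_space_quot lin, symmetric]) auto
  qed simp
  also have "\<dots> = qmap (pt s (finsum Qm (\<lambda>k. finsum Qm (?g k) {..<cs k}) {..<length xs}))"
    by (rule linear_maps_finsum[OF BM.Q.vec_space_axioms QS.vec_space_quot lin, symmetric])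
      (use G1 in blast)+
  \<comment> \<open>On the k-th domain the coefficients are the coordinates of \<open>t\<close>
    times the first cut-off, and the frame section carries the second one.
    \<open>frame_expansion\<close> leaves the product of the pair times \<open>t\<close>.\<close>
  also have "finsum Qm (\<lambda>k. finsum Qm (?g k) {..<cs k}) {..<length xs} = section_act M F gsum t"
  proof
    fix x
    let ?G = "finsum Qm (\<lambda>k. finsum Qm (?g k) {..<cs k}) {..<length xs}"
    have G: "?G \<in> carrier Qm"
      by (rule BM.Q.M.finsum_closed) (use G1 in blast)
    show "?G x = section_act M F gsum t x"
    proof (cases "x \<in> points M")
      case False
      then show ?thesis using BF.sectionsD(2)[of ?G x] G by (simp add: section_act_def)
    next
      case x: True
      interpret FF: vec_space "fiber F x" by (rule BF.vec_space_fiber[OF x])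
      have ev: "(\<lambda>s. s x) \<in> linear_maps Qm (fiber F x)"
        using BF.eval_linear[OF subset_refl x] by simp
      have tx: "t x \<in> carrier (fiber F x)" by (rule BF.sectionsD(1)[OF t x])
      have inner: "finsum Qm (?g k) {..<cs k} x = (ca k x * cb k x) \<odot>\<^bsub>fiber F x\<^esub> t x" if k: "k < length xs" for k
      proof -
        have "finsum Qm (?g k) {..<cs k} x = finsum (fiber F x) (\<lambda>j. ?g k j x) {..<cs k}"
          using gQ[OF k] by (intro linear_maps_finsum[OF BM.Q.vec_space_axioms FF.vec_space_axioms ev]) auto
        also have "\<dots> = (ca k x * cb k x) \<odot>\<^bsub>fiber F x\<^esub> t x"
        proof (cases "x \<in> cV k")
          case V: True
          note tr = triv_k[OF k]
          have fr: "cp k x (t x) j \<odot>\<^bsub>fiber F x\<^esub> BF.frame (cp k) j x \<in> carrier (fiber F x)" if "j < cs k" for j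
            using BF.frame_in[OF tr V that] by simp
          have "finsum (fiber F x) (\<lambda>j. ?g k j x) {..<cs k} = finsum (fiber F x) (\<lambda>j. (ca k x * cb k x) \<odot>\<^bsub>fiber F x\<^esub>
              (cp k x (t x) j \<odot>\<^bsub>fiber F x\<^esub> BF.frame (cp k) j x)) {..<cs k}"
            using fr BF.frame_in[OF tr V] x V
            by (intro FF.M.finsum_cong') (auto simp: section_act_def fsec_def f_def cfun_def FF.scale_scale mult_ac)
          also have "\<dots> = (ca k x * cb k x) \<odot>\<^bsub>fiber F x\<^esub>
              finsum (fiber F x) (\<lambda>j. cp k x (t x) j \<odot>\<^bsub>fiber F x\<^esub> BF.frame (cp k) j x) {..<cs k}"
            using fr by (intro linear_maps_finsum[OF FF.vec_space_axioms FF.vec_space_axioms, symmetric])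
              (auto simp: linear_maps_def FF.scale_distrib FF.scale_scale mult.commute)
          also have "\<dots> = (ca k x * cb k x) \<odot>\<^bsub>fiber F x\<^esub> t x"
            by (simp only: BF.frame_expansion[OF tr V tx, symmetric])
          finally show ?thesis .
        next
          case V: False
          have a0: "ca k x = 0"
          proof (rule cutoff[OF k])
            fix K assume "K \<subseteq> cV k" "\<And>x. x \<in> points M - K \<Longrightarrow> ca k x = 0"
            then show ?thesis using V x by blast
          qed
          have "finsum (fiber F x) (\<lambda>j. ?g k j x) {..<cs k} = finsum (fiber F x) (\<lambda>j. \<zero>\<^bsub>fiber F x\<^esub>) {..<cs k}"
            using x V by (intro FF.M.finsum_cong') (auto simp: section_act_def fsec_def)
          then show ?thesis using tx by (simp add: a0)
        qed
        finally show ?thesis .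
      qed
      have "?G x = finsum (fiber F x) (\<lambda>k. finsum Qm (?g k) {..<cs k} x) {..<length xs}"
        using G1 by (intro linear_maps_finsum[OF BM.Q.vec_space_axioms FF.vec_space_axioms ev]) auto
      also have "\<dots> = finsum (fiber F x) (\<lambda>k. (ca k x * cb k x) \<odot>\<^bsub>fiber F x\<^esub> t x) {..<length xs}"
        using inner tx by (intro FF.M.finsum_cong') auto
      also have "\<dots> = gsum x \<odot>\<^bsub>fiber F x\<^esub> t x"
        using FF.scale_sum_left[OF _ tx, of "{..<length xs}" "\<lambda>k. ca k x * cb k x"] x by (simp add: gsum_def)
      finally show ?thesis using x by (simp add: section_act_def)
    qed
  qed
  \<comment> \<open>\<open>gsum\<close> cannot simply be dropped from \<open>t\<close>, whose
    support is unrestricted. On \<open>s\<close>, which vanishes off \<open>L n\<close>,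
    multiplication by it has no effect.\<close>
  also have "qmap (pt s (section_act M F gsum t)) = qmap (pt (section_act M E gsum s) t)"
    by (rule qmap_act[OF gsum_smooth sP tQ, symmetric])
  also have "section_act M E gsum s = s"
  proof
    fix x
    show "section_act M E gsum s x = s x"
    proof (cases "x \<in> points M")
      case x: True
      interpret FE: vec_space "fiber E x" by (rule BE.vec_space_fiber[OF x])
      show ?thesis
        using x s gsum_1[of x] BE.sectionsD(1)[OF sS x] by (cases "x \<in> L n") (simp_all add: section_act_def XE.Lsec_iff)
    next
      case False
      then show ?thesis using BE.sectionsD(2)[OF sS] by (simp add: section_act_def)
    qed
  qed
  finally show ?thesis .
qed

end

section \<open>The kernel of the lift and the verification of the criterion\<close>

context two_bundles
begin

lemma cutoff_system: "\<exists>xs. cutoff_bundles M L E F n xs"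
proof -
  obtain xs :: "(('m \<Rightarrow> 'k) \<times> ('m \<Rightarrow> 'k) \<times> 'm set \<times> nat \<times> ('m \<Rightarrow> 'w \<Rightarrow> nat \<Rightarrow> 'k)) list"
    where "cutoff_pairs (trivs F) fst xs" "\<forall>x\<in>L n. (\<Sum>(a, b, i)\<leftarrow>xs. a x * b x) = 1"
  proof -
    have "\<exists>xs :: (('m \<Rightarrow> 'k) \<times> ('m \<Rightarrow> 'k) \<times> 'm set \<times> nat \<times> ('m \<Rightarrow> 'w \<Rightarrow> nat \<Rightarrow> 'k)) list.
      cutoff_pairs (trivs F) fst xs \<and> (\<forall>x\<in>L n. (\<Sum>(a, b, i)\<leftarrow>xs. a x * b x) = 1)"
    proof (rule cutoff_pairs_exist[OF _ _ L_compact])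
      show "opn (fst i)" if "i \<in> trivs F" for i
        using that BF.triv_open by (cases i) auto
      show "\<exists>i\<in>trivs F. x \<in> fst i" if "x \<in> points M" for x
        using BF.triv_cover[OF that] by force
    qed
    then show thesis using that by blast
  qed
  then have "cutoff_bundles M L E F n xs"
    by (intro cutoff_bundles.intro[OF two_bundles_axioms] cutoff_bundles_axioms.intro) auto
  then show ?thesis by blast
qed

lemma section_of_lift:
  "\<exists>R. R \<in> linear_maps XT.Cm PQ \<and> (\<forall>u\<in>XT.Lsec n. lift (R u) = u) \<and>
    (\<forall>B. B \<subseteq> XT.Lsec n \<and> BT.jets_bounded B \<longrightarrow> von_neumann_bounded PQ (beta_topology Pm Qm) (R ` B)) \<and>
    (\<forall>s\<in>XE.Lsec n. \<forall>t\<in>BF.Sec. qmap (R (tsec s t)) = qmap (pt s t))"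
proof -
  obtain xs where "cutoff_bundles M L E F n xs" using cutoff_system by blast
  then interpret C: cutoff_bundles M L E F n xs .
  show ?thesis
    using C.R_linear C.lift_R C.R_bounded C.qmap_R by (intro exI[of _ C.R]) blast
qed

text \<open>An element is a finite sum of pure tensors, so one step contains all their left factors
  and on it \<open>R\<close> inverts the lift modulo the relators. If the lift of \<open>z\<close>
  is zero, linearity of \<open>R\<close> puts \<open>z\<close> in the span.\<close>

lemma lift_kernel:
  assumes z: "z \<in> carrier PQ" "lift z = \<zero>\<^bsub>Wm\<^esub>"
  shows "z \<in> lin_span PQ relators"
proof -
  \<comment> \<open>One choice for every step, fixed before the induction, so that two summands can
    be compared with the same map.\<close>
  define R where "R n = (SOME R. R \<in> linear_maps XT.Cm PQ \<and>
    (\<forall>s\<in>XE.Lsec n. \<forall>t\<in>BF.Sec. qmap (R (tsec s t)) = qmap (pt s t)))" for n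
  have "\<exists>R. R \<in> linear_maps XT.Cm PQ \<and>
    (\<forall>s\<in>XE.Lsec n. \<forall>t\<in>BF.Sec. qmap (R (tsec s t)) = qmap (pt s t))" for n
    using section_of_lift[of n] by (elim exE conjE) (intro exI conjI)
  then have "R n \<in> linear_maps XT.Cm PQ \<and>
    (\<forall>s\<in>XE.Lsec n. \<forall>t\<in>BF.Sec. qmap (R n (tsec s t)) = qmap (pt s t))" for n
    unfolding R_def by (rule someI_ex)
  then have R: "\<And>n. R n \<in> linear_maps XT.Cm PQ"
    "\<And>n s t. s \<in> XE.Lsec n \<Longrightarrow> t \<in> BF.Sec \<Longrightarrow> qmap (R n (tsec s t)) = qmap (pt s t)"
    by simp_all
  have lin: "(\<lambda>y. qmap (R n (lift y))) \<in> linear_maps PQ QR" for n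
    using linear_maps_comp[OF linear_maps_comp[OF BM.lift_linear, of "R n" PQ] QS.linear_maps_coset] R(1)[of n] by simp
  \<comment> \<open>The claim is made for all large \<open>n\<close>, since a claim for some
    \<open>n\<close> would not be preserved by sums.\<close>
  have "\<exists>N. \<forall>n\<ge>N. qmap (R n (lift z)) = qmap z"
    using z(1)
  proof (induction rule: BM.tensor_induct)
    case (pure p q)
    then obtain N where N: "p \<in> XE.Lsec N" using XE.Csec_Lsec by auto
    have "qmap (R n (lift (pt p q))) = qmap (pt p q)" if "n \<ge> N" for n
      using R(2)[OF XE.Lsec_mono[OF that N], of q] pure by (simp add: BM.lift_pure)
    then show ?case by blast
  next
    case (add x y)
    then obtain N1 N2 where N: "\<forall>n\<ge>N1. qmap (R n (lift x)) = qmap x" "\<forall>n\<ge>N2. qmap (R n (lift y)) = qmap y"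
      by blast
    have "qmap (R n (lift (x \<oplus>\<^bsub>PQ\<^esub> y))) = qmap (x \<oplus>\<^bsub>PQ\<^esub> y)" if "n \<ge> max N1 N2" for n
      using linear_mapsD(2)[OF lin add(1,2), of n] linear_mapsD(2)[OF QS.linear_maps_coset add(1,2)] N that by simp
    then show ?case by blast
  qed
  then obtain n where n: "qmap (R n (lift z)) = qmap z" by blast
  have "R n (lift z) = \<zero>\<^bsub>PQ\<^esub>"
    using linear_maps_zero[OF BT.vec_space_compact_sections BM.vec_space_tensor R(1)] z(2) by simp
  then have "qmap z = qmap \<zero>\<^bsub>PQ\<^esub>" using n by simp
  then have "z \<ominus>\<^bsub>PQ\<^esub> \<zero>\<^bsub>PQ\<^esub> \<in> lin_span PQ relators"
    using QS.coset_eq_iff[OF z(1) QS.M.zero_closed] by blast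
  moreover have "z \<ominus>\<^bsub>PQ\<^esub> \<zero>\<^bsub>PQ\<^esub> = z"
    using z(1) QS.scale_minus_1[of "\<zero>\<^bsub>PQ\<^esub>"] by (simp add: a_minus_def)
  ultimately show ?thesis by simp
qed

lemma tensor_iso: "bornological_tensor_iso Pm Qm Wm tsec (smooth_functions M) XT.lf_compatible"
proof (rule bornological_tensor_iso.intro[OF tsec_bilinear bornological_tensor_iso_axioms.intro])
  show "topol Wm = finest_locally_convex Wm XT.lf_compatible"
    by (simp add: XT.lf_topology_eq finest_locally_convex_def locally_convex_topology_def)
next
  fix B C assume "bounded_in Pm B" "bounded_in Qm C"
  then obtain n where B: "B \<subseteq> XE.Lsec n" "BE.jets_bounded B" and C: "C \<subseteq> BF.Sec" "BF.jets_bounded C"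
    using XE.lf_bounded_iff BF.bounded_sections_iff by auto
  have BS: "B \<subseteq> BE.Sec" using B(1) XE.Lsec_iff by blast
  have "{tsec x y | x y. x \<in> B \<and> y \<in> C} \<subseteq> XT.Lsec n"
    using tsec_Lsec B(1) C(1) by blast
  then show "bounded_in Wm {tsec x y | x y. x \<in> B \<and> y \<in> C}"
    using tsec_jets_bounded[OF BS B(2) C] XT.lf_bounded_iff[of "{tsec x y | x y. x \<in> B \<and> y \<in> C}"] by auto
next
  fix w assume "w \<in> carrier Wm" "w \<noteq> \<zero>\<^bsub>Wm\<^esub>"
  then show "\<exists>T U. locally_convex_topology Wm T \<and> XT.lf_compatible T \<and> openin T U \<and> w \<in> U \<and> \<zero>\<^bsub>Wm\<^esub> \<notin> U"
    using XT.lf_separated[of w] by (simp add: locally_convex_topology_def)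
next
  fix a :: "'m \<Rightarrow> 'k" assume a: "a \<in> carrier (smooth_functions M)"
  show "act Wm a \<in> linear_maps Wm Wm"
    using XT.act_linear[OF smooth_functions_smooth[OF a]] by simp
  fix p assume p: "p \<in> carrier Pm"
  show "act Pm a p \<in> carrier Pm" by (rule act_Pm[OF a p])
  fix q assume q: "q \<in> carrier Qm"
  have c: "p x \<in> carrier (fiber E x)" "q x \<in> carrier (fiber F x)" if "x \<in> points M" for x
    using p q BE.compact_sections_subset BE.sectionsD(1)[OF _ that] BF.sectionsD(1)[OF _ that] by auto
  show "tsec (act Pm a p) q = act Wm a (tsec p q)"
    using c tensor_spaces.pure_scale_left[OF tensor_spaces_fiber]
    by (auto simp: tsec_def section_act_def fun_eq_iff fiber_T)
  show "tsec p (act Qm a q) = act Wm a (tsec p q)"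
    using c tensor_spaces.pure_scale_right[OF tensor_spaces_fiber]
    by (auto simp: tsec_def section_act_def fun_eq_iff fiber_T)
next
  fix a :: "'m \<Rightarrow> 'k" and q assume "a \<in> carrier (smooth_functions M)" "q \<in> carrier Qm"
  then show "act Qm a q \<in> carrier Qm" by (rule act_Qm)
next
  fix w assume w: "w \<in> carrier Wm"
  then obtain n where n: "w \<in> XT.Lsec n" using XT.Csec_Lsec by auto
  obtain R where "R \<in> linear_maps XT.Cm PQ" "\<forall>u\<in>XT.Lsec n. lift (R u) = u"
    using section_of_lift[of n] by blast
  then show "\<exists>z\<in>carrier PQ. lift z = w"
    using n w linear_mapsD(1)[of R XT.Cm PQ w] by auto
next
  fix z assume "z \<in> carrier PQ" "lift z = \<zero>\<^bsub>Wm\<^esub>"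
  then show "z \<in> lin_span PQ {pt (act Pm a p) q \<ominus>\<^bsub>PQ\<^esub> pt p (act Qm a q)
      | a p q. a \<in> carrier (smooth_functions M) \<and> p \<in> carrier Pm \<and> q \<in> carrier Qm}"
    using lift_kernel unfolding relators_def by blast
next
  fix D assume "bounded_in Wm D"
  then obtain n where D: "D \<subseteq> XT.Lsec n" "BT.jets_bounded D"
    using XT.lf_bounded_iff by auto
  obtain R where R: "R \<in> linear_maps XT.Cm PQ" "\<forall>u\<in>XT.Lsec n. lift (R u) = u"
    "von_neumann_bounded PQ (beta_topology Pm Qm) (R ` D)"
    using section_of_lift[of n] D by blast
  have "R u \<in> carrier PQ \<and> lift (R u) = u" if "u \<in> D" for u
    using that D(1) XT.Lsec_subset linear_mapsD(1)[OF R(1)] R(2) by auto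
  then show "\<exists>R. (\<forall>u\<in>D. R u \<in> carrier PQ \<and> lift (R u) = u) \<and>
      von_neumann_bounded PQ (beta_topology Pm Qm) (R ` D)"
    using R(3) by blast
qed

end

theorem theorem31:
  fixes M :: "('m, 'e::real_inner) manifold"
    and E :: "('k::real_or_complex, 'm, 'v) vec_bundle"
    and F :: "('k, 'm, 'w) vec_bundle"
    and L :: "nat \<Rightarrow> 'm set"
  assumes "smooth_manifold M"
    and "vector_bundle M E"
    and "vector_bundle M F"
    and "compact_exhaustion (mtop M) L"
  shows "\<exists>f. f \<in> bornological_module_iso (smooth_functions M)
    (bornological_tensor (smooth_functions M)
      (smooth_compact_sections M L E) (smooth_sections M F))
    (smooth_compact_sections M L (tensor_bundle E F))"
proof -
  interpret two_bundles M L E F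
    using assms
    by (intro two_bundles.intro exhausted_mfd.intro exhausted_mfd_axioms.intro smooth_vector_bundle.intro
        smooth_vector_bundle_axioms.intro smooth_mfd.intro)
  show ?thesis
    unfolding smooth_compact_sections_def smooth_sections_def
    using bornological_tensor_iso.bornological_iso[OF tensor_iso] by blast
qed

end
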